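(* Let $\mathcal{C}$ be any group-theoretical category of partitions and let $t\in\mathbb{C}$. Then the interpolating partition category $\underline{\mathrm{Rep}}(\mathcal{C},t)$ is semisimple if and only if $t\notin\mathbb{N}_0$.
   Context: For $k,l\in\mathbb{N}_0=\{0,1,2,\dots\}$ let $P(k,l)$ be the set of set partitions of $\{1,\dots,k,1',\dots,l'\}$ ($k$ upper points, $l$ lower points); its members' parts are called blocks. Operations: the tensor product $p\otimes q\in P(k+k',l+l')$ is horizontal concatenation of $p\in P(k,l)$ and $q\in P(k',l')$ ($p$ on the left); the involution $p^*\in P(l,k)$ swaps upper and lower points; for $p\in P(k,l)$, $q\in P(l,m)$, stack $p$ above $q$, identifying the lower points of $p$ with the upper points of $q$; the composition $q\cdot p\in P(k,m)$ is the induced partition of the outer points by connected components, and $\ell(q,p)$ is the number of connected components ("loops") containing only middle points. A category of partitions $\mathcal{C}$ is a collection of subsets $\mathcal{C}(k,l)\subseteq P(k,l)$, $k,l\in\mathbb{N}_0$, containing $\{\{1,2\}\}\in P(2,0)$ and $\{\{1,1'\}\}\in P(1,1)$ and closed under tensor product, involution and composition. It is called group-theoretical if it contains the partition $\{\{1,2,2',3'\},\{3,1'\}\}\in P(3,3)$. For $t\in\mathbb{C}$, $\underline{\mathrm{Rep}}_0(\mathcal{C},t)$ is the $\mathbb{C}$-linear category with objects $[k]$, $k\in\mathbb{N}_0$, with $\mathrm{Hom}([k],[l])=\mathbb{C}\,\mathcal{C}(k,l)$ (the vector space with basis $\mathcal{C}(k,l)$) and composition the bilinear extension of $qp:=t^{\ell(q,p)}\,q\cdot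 p$. The interpolating partition category $\underline{\mathrm{Rep}}(\mathcal{C},t)$ is its Karoubi envelope (idempotent completion of the additive completion). Semisimple means: abelian, and every object is a finite direct sum of simple objects. *)

theory Defs
  imports Complex_Main "HOL-Library.Disjoint_Sets" "HOL-Library.Function_Algebras"
begin

section \<open>Partitions and their operations\<close>

text \<open>\<open>Upper i\<close> is the upper point $i$ and \<open>Lower j\<close> the lower point $j'$; both are numbered from 1.\<close>

datatype point = Upper nat | Lower nat

type_synonym partition = "point set set"

definition points :: "nat \<Rightarrow> nat \<Rightarrow> point set" where
  "points k l = Upper ` {1..k} \<union> Lower ` {1..l}"

definition partitions :: "nat \<Rightarrow> nat \<Rightarrow> partition set" where
  "partitions k l = {p. partition_on (points k l) p}"

fun shift :: "nat \<Rightarrow> nat \<Rightarrow> point \<Rightarrow> point" where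
  "shift k l (Upper i) = Upper (k + i)"
| "shift k l (Lower j) = Lower (l + j)"

text \<open>\<open>tensor k l p q\<close> is $p \otimes q$ for $p \in P(k,l)$.\<close>

definition tensor :: "nat \<Rightarrow> nat \<Rightarrow> partition \<Rightarrow> partition \<Rightarrow> partition" where
  "tensor k l p q = p \<union> (\<lambda>B. shift k l ` B) ` q"

fun flip :: "point \<Rightarrow> point" where
  "flip (Upper i) = Lower i"
| "flip (Lower j) = Upper j"

definition involution :: "partition \<Rightarrow> partition" where
  "involution p = (\<lambda>B. flip ` B) ` p"

text \<open>Stacking \<open>p\<close> above \<open>q\<close> takes place on three rows of points; the lower points of \<open>p\<close> and
  the upper points of \<open>q\<close> both become the middle row.\<close>

datatype row_point = Top nat | Mid nat | Bot nat

fun in_top :: "point \<Rightarrow> row_point" where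
  "in_top (Upper i) = Top i"
| "in_top (Lower j) = Mid j"

fun in_bottom :: "point \<Rightarrow> row_point" where
  "in_bottom (Upper i) = Mid i"
| "in_bottom (Lower j) = Bot j"

fun in_outer :: "point \<Rightarrow> row_point" where
  "in_outer (Upper i) = Top i"
| "in_outer (Lower j) = Bot j"

definition stacked :: "partition \<Rightarrow> partition \<Rightarrow> row_point set set" where
  "stacked q p = (\<lambda>B. in_top ` B) ` p \<union> (\<lambda>B. in_bottom ` B) ` q"

definition components :: "partition \<Rightarrow> partition \<Rightarrow> row_point set set" where
  "components q p = \<Union>(stacked q p) // (\<Union>B\<in>stacked q p. B \<times> B)\<^sup>+"

text \<open>As in the notation $q \cdot p$, the partition on top is the second argument.\<close>

definition compose :: "partition \<Rightarrow> partition \<Rightarrow> partition" where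
  "compose q p = (\<lambda>K. in_outer -` K) ` components q p - {{}}"

definition loops :: "partition \<Rightarrow> partition \<Rightarrow> nat" where
  "loops q p = card {K \<in> components q p. K \<subseteq> range Mid}"

definition category_of_partitions :: "(nat \<Rightarrow> nat \<Rightarrow> partition set) \<Rightarrow> bool" where
  "category_of_partitions C \<longleftrightarrow>
     (\<forall>k l. C k l \<subseteq> partitions k l) \<and>
     {{Upper 1, Upper 2}} \<in> C 2 0 \<and>
     {{Upper 1, Lower 1}} \<in> C 1 1 \<and>
     (\<forall>k l k' l'. \<forall>p\<in>C k l. \<forall>q\<in>C k' l'. tensor k l p q \<in> C (k + k') (l + l')) \<and>
     (\<forall>k l. \<forall>p\<in>C k l. involution p \<in> C l k) \<and>
     (\<forall>k l m. \<forall>p\<in>C k l. \<forall>q\<in>C l m. compose q p \<in> C k m)"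

definition group_theoretical :: "(nat \<Rightarrow> nat \<Rightarrow> partition set) \<Rightarrow> bool" where
  "group_theoretical C \<longleftrightarrow>
     {{Upper 1, Upper 2, Lower 2, Lower 3}, {Upper 3, Lower 1}} \<in> C 3 3"

section \<open>Linear categories\<close>

text \<open>Hom-sets are subspaces of one ambient vector space, with the addition of the type and
  scalar multiplication \<open>Scale\<close>. Hom-sets of different pairs of objects may overlap, so
  composition takes the objects as arguments: \<open>Comp D a b c g f\<close> is $g \circ f$ for
  $f : a \to b$ and $g : b \to c$.\<close>

record ('o, 'm) lincat =
  Obj :: "'o set"
  Hom :: "'o \<Rightarrow> 'o \<Rightarrow> 'm set"
  Comp :: "'o \<Rightarrow> 'o \<Rightarrow> 'o \<Rightarrow> 'm \<Rightarrow> 'm \<Rightarrow> 'm"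
  Ident :: "'o \<Rightarrow> 'm"
  Scale :: "complex \<Rightarrow> 'm \<Rightarrow> 'm"

locale linear_category =
  fixes D :: "('o, 'm::ab_group_add) lincat"
  assumes ambient: "vector_space (Scale D)"
    and Hom_subspace: "\<lbrakk>a \<in> Obj D; b \<in> Obj D\<rbrakk> \<Longrightarrow> module.subspace (Scale D) (Hom D a b)"
    and Ident_in_Hom: "a \<in> Obj D \<Longrightarrow> Ident D a \<in> Hom D a a"
    and Comp_in_Hom: "\<lbrakk>a \<in> Obj D; b \<in> Obj D; c \<in> Obj D; f \<in> Hom D a b; g \<in> Hom D b c\<rbrakk>
          \<Longrightarrow> Comp D a b c g f \<in> Hom D a c"
    and Comp_Ident_left: "\<lbrakk>a \<in> Obj D; b \<in> Obj D; f \<in> Hom D a b\<rbrakk>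
          \<Longrightarrow> Comp D a b b (Ident D b) f = f"
    and Comp_Ident_right: "\<lbrakk>a \<in> Obj D; b \<in> Obj D; f \<in> Hom D a b\<rbrakk>
          \<Longrightarrow> Comp D a a b f (Ident D a) = f"
    and Comp_assoc: "\<lbrakk>a \<in> Obj D; b \<in> Obj D; c \<in> Obj D; d \<in> Obj D;
          f \<in> Hom D a b; g \<in> Hom D b c; h \<in> Hom D c d\<rbrakk>
          \<Longrightarrow> Comp D a c d h (Comp D a b c g f) = Comp D a b d (Comp D b c d h g) f"
    and Comp_add_left: "\<lbrakk>a \<in> Obj D; b \<in> Obj D; c \<in> Obj D; f \<in> Hom D a b;
          g \<in> Hom D b c; g' \<in> Hom D b c\<rbrakk>
          \<Longrightarrow> Comp D a b c (g + g') f = Comp D a b c g f + Comp D a b c g' f"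
    and Comp_add_right: "\<lbrakk>a \<in> Obj D; b \<in> Obj D; c \<in> Obj D; f \<in> Hom D a b; f' \<in> Hom D a b;
          g \<in> Hom D b c\<rbrakk>
          \<Longrightarrow> Comp D a b c g (f + f') = Comp D a b c g f + Comp D a b c g f'"
    and Comp_Scale_left: "\<lbrakk>a \<in> Obj D; b \<in> Obj D; c \<in> Obj D; f \<in> Hom D a b; g \<in> Hom D b c\<rbrakk>
          \<Longrightarrow> Comp D a b c (Scale D r g) f = Scale D r (Comp D a b c g f)"
    and Comp_Scale_right: "\<lbrakk>a \<in> Obj D; b \<in> Obj D; c \<in> Obj D; f \<in> Hom D a b; g \<in> Hom D b c\<rbrakk>
          \<Longrightarrow> Comp D a b c g (Scale D r f) = Scale D r (Comp D a b c g f)"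

definition zero_object :: "('o, 'm::ab_group_add) lincat \<Rightarrow> 'o \<Rightarrow> bool" where
  "zero_object D z \<longleftrightarrow> z \<in> Obj D \<and> (\<forall>a\<in>Obj D. Hom D z a = {0} \<and> Hom D a z = {0})"

text \<open>For \<open>xs = []\<close> the last condition says that the identity of \<open>s\<close> is 0.\<close>

definition direct_sum :: "('o, 'm::ab_group_add) lincat \<Rightarrow> 'o \<Rightarrow> 'o list \<Rightarrow> bool" where
  "direct_sum D s xs \<longleftrightarrow> s \<in> Obj D \<and> set xs \<subseteq> Obj D \<and>
     (\<exists>inc prj.
        (\<forall>i<length xs. inc i \<in> Hom D (xs ! i) s \<and> prj i \<in> Hom D s (xs ! i)) \<and>
        (\<forall>i<length xs. \<forall>j<length xs.
           Comp D (xs ! j) s (xs ! i) (prj i) (inc j) = (if i = j then Ident D (xs ! i) else 0)) \<and>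
        (\<Sum>i<length xs. Comp D s (xs ! i) s (inc i) (prj i)) = Ident D s)"

definition mono_arrow :: "('o, 'm) lincat \<Rightarrow> 'o \<Rightarrow> 'o \<Rightarrow> 'm \<Rightarrow> bool" where
  "mono_arrow D a b f \<longleftrightarrow> f \<in> Hom D a b \<and>
     (\<forall>x\<in>Obj D. \<forall>g\<in>Hom D x a. \<forall>h\<in>Hom D x a. Comp D x a b f g = Comp D x a b f h \<longrightarrow> g = h)"

definition epi_arrow :: "('o, 'm) lincat \<Rightarrow> 'o \<Rightarrow> 'o \<Rightarrow> 'm \<Rightarrow> bool" where
  "epi_arrow D a b f \<longleftrightarrow> f \<in> Hom D a b \<and>
     (\<forall>x\<in>Obj D. \<forall>g\<in>Hom D b x. \<forall>h\<in>Hom D b x. Comp D a b x g f = Comp D a b x h f \<longrightarrow> g = h)"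

definition iso_arrow :: "('o, 'm) lincat \<Rightarrow> 'o \<Rightarrow> 'o \<Rightarrow> 'm \<Rightarrow> bool" where
  "iso_arrow D a b f \<longleftrightarrow> f \<in> Hom D a b \<and>
     (\<exists>g\<in>Hom D b a. Comp D a b a g f = Ident D a \<and> Comp D b a b f g = Ident D b)"

text \<open>\<open>kernel D a b f k i\<close>: the arrow $i : k \to a$ is a kernel of $f : a \to b$.
  \<open>cokernel D a b f c p\<close>: the arrow $p : b \to c$ is a cokernel of $f : a \to b$.\<close>

definition kernel :: "('o, 'm::ab_group_add) lincat \<Rightarrow> 'o \<Rightarrow> 'o \<Rightarrow> 'm \<Rightarrow> 'o \<Rightarrow> 'm \<Rightarrow> bool" where
  "kernel D a b f k i \<longleftrightarrow> k \<in> Obj D \<and> i \<in> Hom D k a \<and> Comp D k a b f i = 0 \<and>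
     (\<forall>x\<in>Obj D. \<forall>g\<in>Hom D x a. Comp D x a b f g = 0 \<longrightarrow>
        (\<exists>!h. h \<in> Hom D x k \<and> Comp D x k a i h = g))"

definition cokernel :: "('o, 'm::ab_group_add) lincat \<Rightarrow> 'o \<Rightarrow> 'o \<Rightarrow> 'm \<Rightarrow> 'o \<Rightarrow> 'm \<Rightarrow> bool" where
  "cokernel D a b f c p \<longleftrightarrow> c \<in> Obj D \<and> p \<in> Hom D b c \<and> Comp D a b c p f = 0 \<and>
     (\<forall>x\<in>Obj D. \<forall>g\<in>Hom D b x. Comp D a b x g f = 0 \<longrightarrow>
        (\<exists>!h. h \<in> Hom D c x \<and> Comp D b c x h p = g))"

locale abelian_category = linear_category +
  assumes ex_zero_object: "\<exists>z. zero_object D z"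
    and ex_direct_sum: "\<lbrakk>a \<in> Obj D; b \<in> Obj D\<rbrakk> \<Longrightarrow> \<exists>s. direct_sum D s [a, b]"
    and ex_kernel: "\<lbrakk>a \<in> Obj D; b \<in> Obj D; f \<in> Hom D a b\<rbrakk> \<Longrightarrow> \<exists>k i. kernel D a b f k i"
    and ex_cokernel: "\<lbrakk>a \<in> Obj D; b \<in> Obj D; f \<in> Hom D a b\<rbrakk> \<Longrightarrow> \<exists>c p. cokernel D a b f c p"
    and mono_is_kernel: "\<lbrakk>a \<in> Obj D; b \<in> Obj D; mono_arrow D a b f\<rbrakk>
          \<Longrightarrow> \<exists>c g. c \<in> Obj D \<and> g \<in> Hom D b c \<and> kernel D b c g a f"
    and epi_is_cokernel: "\<lbrakk>a \<in> Obj D; b \<in> Obj D; epi_arrow D a b f\<rbrakk>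
          \<Longrightarrow> \<exists>c g. c \<in> Obj D \<and> g \<in> Hom D c a \<and> cokernel D c a g b f"

definition simple_object :: "('o, 'm::ab_group_add) lincat \<Rightarrow> 'o \<Rightarrow> bool" where
  "simple_object D s \<longleftrightarrow> s \<in> Obj D \<and> \<not> zero_object D s \<and>
     (\<forall>a\<in>Obj D. \<forall>i. mono_arrow D a s i \<longrightarrow> zero_object D a \<or> iso_arrow D a s i)"

definition semisimple :: "('o, 'm::ab_group_add) lincat \<Rightarrow> bool" where
  "semisimple D \<longleftrightarrow> abelian_category D \<and>
     (\<forall>x\<in>Obj D. \<exists>ss. (\<forall>s\<in>set ss. simple_object D s) \<and> direct_sum D x ss)"

section \<open>Karoubi envelope\<close>

text \<open>An object of the additive completion is a list, the formal direct sum of its entries.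
  A morphism from \<open>xs\<close> to \<open>ys\<close> is a matrix whose entry in row \<open>i\<close> and column \<open>j\<close> is a morphism
  from \<open>xs ! j\<close> to \<open>ys ! i\<close>; outside the matrix the function is 0.\<close>

definition additive_completion ::
    "('o, 'm::ab_group_add) lincat \<Rightarrow> ('o list, nat \<Rightarrow> nat \<Rightarrow> 'm) lincat" where
  "additive_completion D =
     \<lparr> Obj = {xs. set xs \<subseteq> Obj D},
       Hom = (\<lambda>xs ys. {M. \<forall>i j.
                if i < length ys \<and> j < length xs then M i j \<in> Hom D (xs ! j) (ys ! i)
                else M i j = 0}),
       Comp = (\<lambda>xs ys zs N M. \<lambda>i j.
                if i < length zs \<and> j < length xs
                then \<Sum>l<length ys. Comp D (xs ! j) (ys ! l) (zs ! i) (N i l) (M l j)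
                else 0),
       Ident = (\<lambda>xs. \<lambda>i j. if i < length xs \<and> i = j then Ident D (xs ! i) else 0),
       Scale = (\<lambda>r M. \<lambda>i j. Scale D r (M i j)) \<rparr>"

definition idempotent_completion :: "('o, 'm) lincat \<Rightarrow> ('o \<times> 'm, 'm) lincat" where
  "idempotent_completion D =
     \<lparr> Obj = {(a, e). a \<in> Obj D \<and> e \<in> Hom D a a \<and> Comp D a a a e e = e},
       Hom = (\<lambda>(a, e) (b, f). {g \<in> Hom D a b. Comp D a a b (Comp D a b b f g) e = g}),
       Comp = (\<lambda>(a, _) (b, _) (c, _). Comp D a b c),
       Ident = (\<lambda>(a, e). e),
       Scale = Scale D \<rparr>"

definition karoubi_envelope ::
    "('o, 'm::ab_group_add) lincat \<Rightarrow> ('o list \<times> (nat \<Rightarrow> nat \<Rightarrow> 'm), nat \<Rightarrow> nat \<Rightarrow> 'm) lincat" where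
  "karoubi_envelope D = idempotent_completion (additive_completion D)"

section \<open>Interpolating partition categories\<close>

definition identity_partition :: "nat \<Rightarrow> partition" where
  "identity_partition k = (\<lambda>i. {Upper i, Lower i}) ` {1..k}"

text \<open>The vector space with basis $\mathcal{C}(k,l)$ is realised as the functions supported in
  \<open>C k l\<close>; no finiteness condition is needed since \<open>partitions k l\<close> is finite.\<close>

definition Rep\<^sub>0 :: "(nat \<Rightarrow> nat \<Rightarrow> partition set) \<Rightarrow> complex
    \<Rightarrow> (nat, partition \<Rightarrow> complex) lincat" where
  "Rep\<^sub>0 C t =
     \<lparr> Obj = UNIV,
       Hom = (\<lambda>k l. {f. \<forall>p. p \<notin> C k l \<longrightarrow> f p = 0}),
       Comp = (\<lambda>k l m g f. \<lambda>r. \<Sum>q\<in>C l m. \<Sum>p\<in>C k l.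
                if compose q p = r then t ^ loops q p * g q * f p else 0),
       Ident = (\<lambda>k p. if p = identity_partition k then 1 else 0),
       Scale = (\<lambda>c f p. c * f p) \<rparr>"

definition Rep :: "(nat \<Rightarrow> nat \<Rightarrow> partition set) \<Rightarrow> complex
    \<Rightarrow> (nat list \<times> (nat \<Rightarrow> nat \<Rightarrow> partition \<Rightarrow> complex), nat \<Rightarrow> nat \<Rightarrow> partition \<Rightarrow> complex) lincat"
  where "Rep C t = karoubi_envelope (Rep\<^sub>0 C t)"

end

theory Submission
  imports Defs "HOL-Computational_Algebra.Polynomial"
begin

text \<open>
  Semisimplicity of a Karoubi envelope with finite-dimensional morphism spaces amounts to von
  Neumann regularity: every morphism f admits g with f g f = f. For t outside the naturals such a g
  is obtained as in Maschke's theorem, by averaging a linear pseudo-inverse. The averaging operators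
  are built by induction over the projections e of the finite regular *-semigroups C(k,k): modulo
  smaller projections the corner at e is a twisted group algebra. What makes the averaging possible
  is that the trace form is nondegenerate: group-theoretical categories are closed under coarsening,
  so the Gram matrix is the congruence by a unitriangular zeta matrix of the diagonal matrix of
  falling factorials of t. If t = n is natural, the entries for more than n blocks vanish, which
  yields a nonzero negligible morphism from 0 to 2n + 2, and Schur's lemma excludes such a morphism
  in a semisimple category.

  Associativity and the loop count are read off from the 0/1 tensors that partitions define on words
  over a finite alphabet.
\<close>

section \<open>Completions of linear categories\<close>

text \<open>The obstacle behind the construction: a pseudo-inverse chosen by linear algebra on each
  space \<open>Hom c a\<close> is not given by composition with a morphism. Averaging makes it one.
  The trace form alone provides dual bases, hence a Casimir element; it is natural, but it need not
  act as the identity. Comparing it with the Casimir element of a finite group supplies the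
  correcting factor, for which nothing but the invertibility of the group order is used; no
  representations of the groups involved have to be known.

  A group appears only after smaller projections have been cut off, because an element
  \<open>p\<close> of the corner at \<open>e\<close> is invertible there unless one of its two
  projections (\<open>p\<close> times its involution, in either order) lies strictly below
  \<open>e\<close>.

  The diagonal entry of a partition with m blocks is t(t-1)...(t-m+1), which vanishes exactly for
  the natural numbers t < m. For t = n the first zero comes with n + 1 blocks. Pair partitions exist
  in every category, and n + 1 pairs side by side need 2n + 2 points, whence that number.\<close>

context linear_category
begin

sublocale vs: vector_space "Scale D"
  by (rule ambient)

lemma zero_in_Hom: "a \<in> Obj D \<Longrightarrow> b \<in> Obj D \<Longrightarrow> 0 \<in> Hom D a b"
  using Hom_subspace vs.subspace_0 by blast

lemma add_in_Hom: "\<lbrakk>a \<in> Obj D; b \<in> Obj D; f \<in> Hom D a b; g \<in> Hom D a b\<rbrakk> \<Longrightarrow> f + g \<in> Hom D a b"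
  using Hom_subspace vs.subspace_add by blast

lemma diff_in_Hom: "\<lbrakk>a \<in> Obj D; b \<in> Obj D; f \<in> Hom D a b; g \<in> Hom D a b\<rbrakk> \<Longrightarrow> f - g \<in> Hom D a b"
  using Hom_subspace vs.subspace_diff by blast

lemma Scale_in_Hom: "\<lbrakk>a \<in> Obj D; b \<in> Obj D; f \<in> Hom D a b\<rbrakk> \<Longrightarrow> Scale D r f \<in> Hom D a b"
  using Hom_subspace vs.subspace_scale by blast

lemma sum_in_Hom: "\<lbrakk>a \<in> Obj D; b \<in> Obj D; \<And>i. i \<in> I \<Longrightarrow> f i \<in> Hom D a b\<rbrakk> \<Longrightarrow> sum f I \<in> Hom D a b"
  using Hom_subspace vs.subspace_sum by blast

lemmas Hom_intros = zero_in_Hom add_in_Hom diff_in_Hom Scale_in_Hom sum_in_Hom Ident_in_Hom Comp_in_Hom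

lemma Comp_0_right: "\<lbrakk>a \<in> Obj D; b \<in> Obj D; c \<in> Obj D; g \<in> Hom D b c\<rbrakk> \<Longrightarrow> Comp D a b c g 0 = 0"
  using Comp_add_right[of a b c 0 0 g] zero_in_Hom by simp

lemma Comp_0_left: "\<lbrakk>a \<in> Obj D; b \<in> Obj D; c \<in> Obj D; f \<in> Hom D a b\<rbrakk> \<Longrightarrow> Comp D a b c 0 f = 0"
  using Comp_add_left[of a b c f 0 0] zero_in_Hom by simp

lemma Comp_diff_right:
  "\<lbrakk>a \<in> Obj D; b \<in> Obj D; c \<in> Obj D; f \<in> Hom D a b; f' \<in> Hom D a b; g \<in> Hom D b c\<rbrakk>
    \<Longrightarrow> Comp D a b c g (f - f') = Comp D a b c g f - Comp D a b c g f'"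
  using Comp_add_right[of a b c "f - f'" f' g] diff_in_Hom[of a b f f'] by (simp add: eq_diff_eq)

lemma Comp_diff_left:
  "\<lbrakk>a \<in> Obj D; b \<in> Obj D; c \<in> Obj D; f \<in> Hom D a b; g \<in> Hom D b c; g' \<in> Hom D b c\<rbrakk>
    \<Longrightarrow> Comp D a b c (g - g') f = Comp D a b c g f - Comp D a b c g' f"
  using Comp_add_left[of a b c f "g - g'" g'] diff_in_Hom[of b c g g'] by (simp add: eq_diff_eq)

lemma Comp_sum_right:
  assumes "a \<in> Obj D" "b \<in> Obj D" "c \<in> Obj D" "\<And>i. i \<in> I \<Longrightarrow> f i \<in> Hom D a b" "g \<in> Hom D b c"
  shows "Comp D a b c g (sum f I) = (\<Sum>i\<in>I. Comp D a b c g (f i))"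
  using assms(4)
proof (induction I rule: infinite_finite_induct)
  case (insert x F)
  then have "sum f F \<in> Hom D a b" using assms by (intro sum_in_Hom) auto
  then show ?case using insert assms by (simp add: Comp_add_right)
qed (use assms Comp_0_right in auto)

lemma Comp_sum_left:
  assumes "a \<in> Obj D" "b \<in> Obj D" "c \<in> Obj D" "f \<in> Hom D a b" "\<And>i. i \<in> I \<Longrightarrow> g i \<in> Hom D b c"
  shows "Comp D a b c (sum g I) f = (\<Sum>i\<in>I. Comp D a b c (g i) f)"
  using assms(5)
proof (induction I rule: infinite_finite_induct)
  case (insert x F)
  then have "sum g F \<in> Hom D b c" using assms by (intro sum_in_Hom) auto
  then show ?case using insert assms by (simp add: Comp_add_left)
qed (use assms Comp_0_left in auto)

end

lemma linear_category_additive_completion: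
  assumes "linear_category D"
  shows "linear_category (additive_completion D)"
proof -
  interpret linear_category D by fact
  note [simp] = additive_completion_def and [intro] = Hom_intros
  have obj: "xs ! i \<in> Obj D" if "set xs \<subseteq> Obj D" "i < length xs" for xs :: "'a list" and i
    using that by (meson nth_mem subset_code(1))
  note [simp] = obj
  have V: "vector_space (Scale (additive_completion D))"
    by unfold_locales (auto simp: fun_eq_iff vs.scale_right_distrib vs.scale_left_distrib)
  then interpret A: vector_space "Scale (additive_completion D)" .
  show ?thesis
  proof (rule linear_category.intro)
    show "vector_space (Scale (additive_completion D))" by (rule V)
  next
    fix xs ys assume "xs \<in> Obj (additive_completion D)" "ys \<in> Obj (additive_completion D)"
    then show "A.subspace (Hom (additive_completion D) xs ys)"
      by (intro A.subspaceI) auto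
  next
    fix xs assume "xs \<in> Obj (additive_completion D)"
    then show "Ident (additive_completion D) xs \<in> Hom (additive_completion D) xs xs"
      by auto
  next
    fix xs ys zs M N
    assume "xs \<in> Obj (additive_completion D)" "ys \<in> Obj (additive_completion D)"
      "zs \<in> Obj (additive_completion D)" "M \<in> Hom (additive_completion D) xs ys"
      "N \<in> Hom (additive_completion D) ys zs"
    then show "Comp (additive_completion D) xs ys zs N M \<in> Hom (additive_completion D) xs zs"
      by (auto intro!: sum_in_Hom Comp_in_Hom)
  next
    fix xs ys M
    assume A: "xs \<in> Obj (additive_completion D)" "ys \<in> Obj (additive_completion D)"
      "M \<in> Hom (additive_completion D) xs ys"
    show "Comp (additive_completion D) xs ys ys (Ident (additive_completion D) ys) M = M"
    proof (intro ext)
      fix i j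
      have "(\<Sum>l<length ys. Comp D (xs ! j) (ys ! l) (ys ! i)
              (if i < length ys \<and> i = l then Ident D (ys ! i) else 0) (M l j)) =
            (\<Sum>l<length ys. if l = i then M i j else 0)" if "i < length ys" "j < length xs"
        using that A by (intro sum.cong) (auto simp: Comp_Ident_left Comp_0_left)
      then show "Comp (additive_completion D) xs ys ys (Ident (additive_completion D) ys) M i j = M i j"
        using A by auto
    qed
    show "Comp (additive_completion D) xs xs ys M (Ident (additive_completion D) xs) = M"
    proof (intro ext)
      fix i j
      have "(\<Sum>l<length xs. Comp D (xs ! j) (xs ! l) (ys ! i) (M i l)
              (if l < length xs \<and> l = j then Ident D (xs ! l) else 0)) =
            (\<Sum>l<length xs. if l = j then M i j else 0)" if "i < length ys" "j < length xs"
        using that A by (intro sum.cong) (auto simp: Comp_Ident_right Comp_0_right)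
      then show "Comp (additive_completion D) xs xs ys M (Ident (additive_completion D) xs) i j = M i j"
        using A by auto
    qed
  next
    fix ws xs ys zs L M N
    assume A: "ws \<in> Obj (additive_completion D)" "xs \<in> Obj (additive_completion D)"
      "ys \<in> Obj (additive_completion D)" "zs \<in> Obj (additive_completion D)"
      "L \<in> Hom (additive_completion D) ws xs" "M \<in> Hom (additive_completion D) xs ys"
      "N \<in> Hom (additive_completion D) ys zs"
    show "Comp (additive_completion D) ws ys zs N (Comp (additive_completion D) ws xs ys M L) =
      Comp (additive_completion D) ws xs zs (Comp (additive_completion D) xs ys zs N M) L"
    proof (intro ext)
      fix i j
      have "(\<Sum>l<length ys. Comp D (ws ! j) (ys ! l) (zs ! i) (N i l)
              (\<Sum>m<length xs. Comp D (ws ! j) (xs ! m) (ys ! l) (M l m) (L m j))) =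
            (\<Sum>l<length ys. \<Sum>m<length xs. Comp D (ws ! j) (ys ! l) (zs ! i) (N i l)
              (Comp D (ws ! j) (xs ! m) (ys ! l) (M l m) (L m j)))"
        if "i < length zs" "j < length ws"
        using that A by (intro sum.cong Comp_sum_right) auto
      moreover have "(\<Sum>l<length ys. \<Sum>m<length xs. Comp D (ws ! j) (ys ! l) (zs ! i) (N i l)
              (Comp D (ws ! j) (xs ! m) (ys ! l) (M l m) (L m j))) =
           (\<Sum>l<length ys. \<Sum>m<length xs. Comp D (ws ! j) (xs ! m) (zs ! i)
              (Comp D (xs ! m) (ys ! l) (zs ! i) (N i l) (M l m)) (L m j))"
        if "i < length zs" "j < length ws"
        using that A by (intro sum.cong Comp_assoc) auto
      moreover have "(\<Sum>m<length xs. Comp D (ws ! j) (xs ! m) (zs ! i)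
              (\<Sum>l<length ys. Comp D (xs ! m) (ys ! l) (zs ! i) (N i l) (M l m)) (L m j)) =
           (\<Sum>m<length xs. \<Sum>l<length ys. Comp D (ws ! j) (xs ! m) (zs ! i)
              (Comp D (xs ! m) (ys ! l) (zs ! i) (N i l) (M l m)) (L m j))"
        if "i < length zs" "j < length ws"
        using that A by (intro sum.cong Comp_sum_left) auto
      ultimately show "Comp (additive_completion D) ws ys zs N (Comp (additive_completion D) ws xs ys M L) i j =
        Comp (additive_completion D) ws xs zs (Comp (additive_completion D) xs ys zs N M) L i j"
        by (auto intro: sum.swap)
    qed
  qed (auto simp: fun_eq_iff Comp_add_left Comp_add_right Comp_Scale_left Comp_Scale_right
         sum.distrib vs.scale_sum_right intro!: sum.cong)
qed

lemma linear_category_idempotent_completion: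
  assumes "linear_category D"
  shows "linear_category (idempotent_completion D)"
proof -
  interpret linear_category D by fact
  note [simp] = idempotent_completion_def
  have comp: "Comp D a b c g f \<in> Hom D a c \<and>
      Comp D a a c (Comp D a c c e3 (Comp D a b c g f)) e1 = Comp D a b c g f"
    if "a \<in> Obj D" "b \<in> Obj D" "c \<in> Obj D" "f \<in> Hom D a b" "g \<in> Hom D b c"
       "e1 \<in> Hom D a a" "e2 \<in> Hom D b b" "e3 \<in> Hom D c c"
       "Comp D a a a e1 e1 = e1" "Comp D c c c e3 e3 = e3"
       "Comp D a a b (Comp D a b b e2 f) e1 = f" "Comp D b b c (Comp D b c c e3 g) e2 = g"
     for a b c e1 e2 e3 f g
  proof -
    have "Comp D a a b f e1 = f"
      using that by (metis Comp_assoc Comp_in_Hom)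
    moreover have "Comp D b c c e3 g = g"
      using that by (metis Comp_assoc Comp_in_Hom)
    ultimately show ?thesis
      using that by (metis Comp_assoc Comp_in_Hom)
  qed
  \<comment> \<open>Invariance under the two-sided compression gives invariance on each side, so the
    idempotents act as identities.\<close>
  have unit: "Comp D a b b e2 f = f" "Comp D a a b f e1 = f"
    if "a \<in> Obj D" "b \<in> Obj D" "f \<in> Hom D a b" "e1 \<in> Hom D a a" "e2 \<in> Hom D b b"
       "Comp D a a a e1 e1 = e1" "Comp D b b b e2 e2 = e2"
       "Comp D a a b (Comp D a b b e2 f) e1 = f"
     for a b e1 e2 f
    using that by (metis Comp_assoc Comp_in_Hom)+
  show ?thesis
  proof (rule linear_category.intro)
    show "vector_space (Scale (idempotent_completion D))" by (simp add: vs.vector_space_axioms)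
  next
    fix x y assume "x \<in> Obj (idempotent_completion D)" "y \<in> Obj (idempotent_completion D)"
    then show "module.subspace (Scale (idempotent_completion D)) (Hom (idempotent_completion D) x y)"
      by (auto simp: vs.subspace_def Hom_intros Comp_0_left Comp_0_right Comp_add_left Comp_add_right
          Comp_Scale_left Comp_Scale_right)
  next
    fix x assume "x \<in> Obj (idempotent_completion D)"
    then show "Ident (idempotent_completion D) x \<in> Hom (idempotent_completion D) x x"
      by (cases x) simp
  next
    fix x y z f g
    assume "x \<in> Obj (idempotent_completion D)" "y \<in> Obj (idempotent_completion D)"
      "z \<in> Obj (idempotent_completion D)" "f \<in> Hom (idempotent_completion D) x y"
      "g \<in> Hom (idempotent_completion D) y z"
    then show "Comp (idempotent_completion D) x y z g f \<in> Hom (idempotent_completion D) x z"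
      using comp[of "fst x" "fst y" "fst z" f g "snd x" "snd y" "snd z"]
      by (cases x; cases y; cases z) simp
  next
    fix x y f
    assume A: "x \<in> Obj (idempotent_completion D)" "y \<in> Obj (idempotent_completion D)"
      "f \<in> Hom (idempotent_completion D) x y"
    show "Comp (idempotent_completion D) x y y (Ident (idempotent_completion D) y) f = f"
      using unit(1)[of "fst x" "fst y" f "snd x" "snd y"] A by (cases x; cases y) simp
    show "Comp (idempotent_completion D) x x y f (Ident (idempotent_completion D) x) = f"
      using unit(2)[of "fst x" "fst y" f "snd x" "snd y"] A by (cases x; cases y) simp
  next
    fix w x y z f g h
    assume A: "w \<in> Obj (idempotent_completion D)" "x \<in> Obj (idempotent_completion D)"
      "y \<in> Obj (idempotent_completion D)" "z \<in> Obj (idempotent_completion D)"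
      "f \<in> Hom (idempotent_completion D) w x" "g \<in> Hom (idempotent_completion D) x y"
      "h \<in> Hom (idempotent_completion D) y z"
    then show "Comp (idempotent_completion D) w y z h (Comp (idempotent_completion D) w x y g f) =
      Comp (idempotent_completion D) w x z (Comp (idempotent_completion D) x y z h g) f"
      using Comp_assoc[of "fst w" "fst x" "fst y" "fst z" f g h]
      by (cases w; cases x; cases y; cases z) simp
  qed (clarsimp simp: Comp_add_left Comp_add_right Comp_Scale_left Comp_Scale_right)+
qed


section \<open>Von Neumann regular categories\<close>

definition von_neumann_regular :: "('o, 'm) lincat \<Rightarrow> bool" where
  "von_neumann_regular D \<longleftrightarrow> (\<forall>a\<in>Obj D. \<forall>b\<in>Obj D. \<forall>f\<in>Hom D a b.
     \<exists>g\<in>Hom D b a. Comp D a a b f (Comp D a b a g f) = f)"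

definition idempotents_split :: "('o, 'm) lincat \<Rightarrow> bool" where
  "idempotents_split D \<longleftrightarrow> (\<forall>a\<in>Obj D. \<forall>e\<in>Hom D a a. Comp D a a a e e = e \<longrightarrow>
     (\<exists>k\<in>Obj D. \<exists>i\<in>Hom D k a. \<exists>s\<in>Hom D a k. Comp D k a k s i = Ident D k \<and> Comp D a k a i s = e))"

text \<open>Zero is excluded so that the number of elements is bounded by the dimension of the
  endomorphism space; this number is the measure for splitting an object into simple ones.\<close>

definition orthogonal_idempotents :: "('o, 'm::zero) lincat \<Rightarrow> 'o \<Rightarrow> 'm set \<Rightarrow> bool" where
  "orthogonal_idempotents D a S \<longleftrightarrow> S \<subseteq> Hom D a a - {0} \<and>
     (\<forall>e\<in>S. \<forall>e'\<in>S. Comp D a a a e e' = (if e = e' then e else 0))"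

section \<open>Abelian structure from regularity, decomposition into simple objects, Schur's
  lemma\<close>

context linear_category
begin

lemmas Comp_assoc_right = Comp_assoc[symmetric]

lemma zero_object_iff: "zero_object D a \<longleftrightarrow> a \<in> Obj D \<and> Ident D a = 0"
proof
  assume "zero_object D a"
  then show "a \<in> Obj D \<and> Ident D a = 0"
    using Ident_in_Hom unfolding zero_object_def by blast
next
  assume a: "a \<in> Obj D \<and> Ident D a = 0"
  then show "zero_object D a"
    unfolding zero_object_def using zero_in_Hom
    by (metis (no_types, lifting) Comp_0_left Comp_0_right Comp_Ident_left Comp_Ident_right
        insertI1 singletonI singletonD subsetI subset_antisym subset_singletonD empty_iff insert_iff)
qed

text \<open>The idempotent \<open>1 - g f\<close> is annihilated by \<open>f\<close>, and every
  \<open>u\<close> with \<open>f u = 0\<close> satisfies \<open>u = (1 - g f) u\<close>. An object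
  splitting this idempotent is therefore a kernel.\<close>

lemma kernel_of_split:
  assumes [simp]: "a \<in> Obj D" "b \<in> Obj D" "k \<in> Obj D"
    and [simp]: "f \<in> Hom D a b" "g \<in> Hom D b a" "i \<in> Hom D k a" "s \<in> Hom D a k"
    and reg: "Comp D a a b f (Comp D a b a g f) = f"
    and si: "Comp D k a k s i = Ident D k" and split: "Comp D a k a i s = Ident D a - Comp D a b a g f"
  shows "kernel D a b f k i"
proof -
  note [simp] = Hom_intros Comp_Ident_left Comp_Ident_right Comp_diff_left Comp_diff_right Comp_0_left Comp_0_right
  have i: "i = Comp D k a a (Comp D a k a i s) i"
    using si by (simp add: Comp_assoc_right)
  have "Comp D k a b f i = Comp D k a b f (Comp D k a a (Comp D a k a i s) i)"
    using i by simp
  also have "\<dots> = Comp D k a b (Comp D a a b f (Comp D a k a i s)) i"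
    by (rule Comp_assoc) simp_all
  also have "\<dots> = 0"
    by (simp add: split reg)
  finally have 0: "Comp D k a b f i = 0" .
  show ?thesis
    unfolding kernel_def
  proof (intro conjI ballI impI)
    fix x u assume x[simp]: "x \<in> Obj D" "u \<in> Hom D x a" and fu: "Comp D x a b f u = 0"
    show "\<exists>!h. h \<in> Hom D x k \<and> Comp D x k a i h = u"
    proof (rule ex1I[of _ "Comp D x a k s u"])
      have "Comp D x k a i (Comp D x a k s u) = Comp D x a a (Comp D a k a i s) u"
        by (rule Comp_assoc) simp_all
      also have "\<dots> = u - Comp D x b a g (Comp D x a b f u)"
        by (simp add: split Comp_assoc_right)
      finally show "Comp D x a k s u \<in> Hom D x k \<and> Comp D x k a i (Comp D x a k s u) = u"
        by (simp add: fu)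
    next
      fix h assume h: "h \<in> Hom D x k \<and> Comp D x k a i h = u"
      then have "Comp D x a k s u = Comp D x k k (Comp D k a k s i) h"
        by (auto intro!: Comp_assoc)
      then show "h = Comp D x a k s u" using h by (simp add: si)
    qed
  qed (use 0 in simp_all)
qed

text \<open>Dual to \<open>kernel_of_split\<close>, with the idempotent on the target:
  \<open>u f = 0\<close> means \<open>u = u (1 - f g)\<close>.\<close>

lemma cokernel_of_split:
  assumes [simp]: "a \<in> Obj D" "b \<in> Obj D" "c \<in> Obj D"
    and [simp]: "f \<in> Hom D a b" "g \<in> Hom D b a" "i \<in> Hom D c b" "s \<in> Hom D b c"
    and reg: "Comp D a a b f (Comp D a b a g f) = f"
    and si: "Comp D c b c s i = Ident D c" and split: "Comp D b c b i s = Ident D b - Comp D b a b f g"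
  shows "cokernel D a b f c s"
proof -
  note [simp] = Hom_intros Comp_Ident_left Comp_Ident_right Comp_diff_left Comp_diff_right Comp_0_left Comp_0_right
  have s: "s = Comp D b b c s (Comp D b c b i s)"
    using si by (simp add: Comp_assoc)
  have "Comp D a b c s f = Comp D a b c (Comp D b b c s (Comp D b c b i s)) f"
    using s by simp
  also have "\<dots> = Comp D a b c s (Comp D a b b (Comp D b c b i s) f)"
    by (rule Comp_assoc_right) simp_all
  also have "\<dots> = 0"
    by (simp add: split reg Comp_assoc_right)
  finally have 0: "Comp D a b c s f = 0" .
  show ?thesis
    unfolding cokernel_def
  proof (intro conjI ballI impI)
    fix x u assume x[simp]: "x \<in> Obj D" "u \<in> Hom D b x" and fu: "Comp D a b x u f = 0"
    show "\<exists>!h. h \<in> Hom D c x \<and> Comp D b c x h s = u"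
    proof (rule ex1I[of _ "Comp D c b x u i"])
      have "Comp D b c x (Comp D c b x u i) s = Comp D b b x u (Comp D b c b i s)"
        by (rule Comp_assoc_right) simp_all
      also have "\<dots> = u - Comp D b a x (Comp D a b x u f) g"
        by (simp add: split Comp_assoc)
      finally show "Comp D c b x u i \<in> Hom D c x \<and> Comp D b c x (Comp D c b x u i) s = u"
        by (simp add: fu)
    next
      fix h assume h: "h \<in> Hom D c x \<and> Comp D b c x h s = u"
      then have "Comp D c b x u i = Comp D c c x h (Comp D c b c s i)"
        by (auto intro!: Comp_assoc_right)
      then show "h = Comp D c b x u i" using h by (simp add: si)
    qed
  qed (use 0 in simp_all)
qed

lemma idempotent_complement:
  assumes "a \<in> Obj D" "e \<in> Hom D a a" "Comp D a a a e e = e"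
  shows "Ident D a - e \<in> Hom D a a"
    "Comp D a a a (Ident D a - e) (Ident D a - e) = Ident D a - e"
  using assms by (simp_all add: Hom_intros Comp_diff_left Comp_diff_right Comp_Ident_left Comp_Ident_right)

lemma regular_idempotents:
  assumes [simp]: "a \<in> Obj D" "b \<in> Obj D" "f \<in> Hom D a b" "g \<in> Hom D b a"
    and reg: "Comp D a a b f (Comp D a b a g f) = f"
  shows "Comp D a a a (Comp D a b a g f) (Comp D a b a g f) = Comp D a b a g f"
    "Comp D b b b (Comp D b a b f g) (Comp D b a b f g) = Comp D b a b f g"
proof -
  show "Comp D a a a (Comp D a b a g f) (Comp D a b a g f) = Comp D a b a g f"
    by (simp add: Comp_assoc_right Hom_intros reg)
  have "Comp D b b b (Comp D b a b f g) (Comp D b a b f g) = Comp D b a b (Comp D a a b f (Comp D a b a g f)) g"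
    by (simp add: Comp_assoc_right Hom_intros del: reg)
  then show "Comp D b b b (Comp D b a b f g) (Comp D b a b f g) = Comp D b a b f g"
    by (simp add: reg)
qed

theorem abelian_if_regular:
  assumes reg: "von_neumann_regular D" and split: "idempotents_split D"
    and zero: "\<exists>z. zero_object D z"
    and sum: "\<And>a b. \<lbrakk>a \<in> Obj D; b \<in> Obj D\<rbrakk> \<Longrightarrow> \<exists>s. direct_sum D s [a, b]"
  shows "abelian_category D"
proof unfold_locales
  fix a b f assume [simp]: "a \<in> Obj D" "b \<in> Obj D" "f \<in> Hom D a b"
  obtain g where [simp]: "g \<in> Hom D b a" and g: "Comp D a a b f (Comp D a b a g f) = f"
    using reg unfolding von_neumann_regular_def by (meson \<open>a \<in> Obj D\<close> \<open>b \<in> Obj D\<close> \<open>f \<in> Hom D a b\<close>)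
  have "Comp D a b a g f \<in> Hom D a a" "Comp D b a b f g \<in> Hom D b b"
    by (simp_all add: Hom_intros)
  note compl = idempotent_complement[OF _ this(1) regular_idempotents(1)[OF _ _ _ _ g]]
    idempotent_complement[OF _ this(2) regular_idempotents(2)[OF _ _ _ _ g]]
  show "\<exists>k i. kernel D a b f k i"
  proof -
    obtain k i s where "k \<in> Obj D" "i \<in> Hom D k a" "s \<in> Hom D a k"
      "Comp D k a k s i = Ident D k" "Comp D a k a i s = Ident D a - Comp D a b a g f"
      using split compl unfolding idempotents_split_def by (metis \<open>a \<in> Obj D\<close> \<open>b \<in> Obj D\<close> \<open>f \<in> Hom D a b\<close> \<open>g \<in> Hom D b a\<close>)
    then have "kernel D a b f k i"
      by (intro kernel_of_split[OF _ _ _ _ _ _ _ g]) auto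
    then show ?thesis by blast
  qed
  show "\<exists>c p. cokernel D a b f c p"
  proof -
    obtain k i s where "k \<in> Obj D" "i \<in> Hom D k b" "s \<in> Hom D b k"
      "Comp D k b k s i = Ident D k" "Comp D b k b i s = Ident D b - Comp D b a b f g"
      using split compl unfolding idempotents_split_def by (metis \<open>a \<in> Obj D\<close> \<open>b \<in> Obj D\<close> \<open>f \<in> Hom D a b\<close> \<open>g \<in> Hom D b a\<close>)
    then have "cokernel D a b f k s"
      by (intro cokernel_of_split[OF _ _ _ _ _ _ _ g]) auto
    then show ?thesis by blast
  qed
next
  fix a b f assume [simp]: "a \<in> Obj D" "b \<in> Obj D" and mono: "mono_arrow D a b f"
  then have [simp]: "f \<in> Hom D a b" by (simp add: mono_arrow_def)
  obtain g where [simp]: "g \<in> Hom D b a" and g: "Comp D a a b f (Comp D a b a g f) = f"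
    using reg unfolding von_neumann_regular_def by (meson \<open>a \<in> Obj D\<close> \<open>b \<in> Obj D\<close> \<open>f \<in> Hom D a b\<close>)
  let ?e = "Ident D b - Comp D b a b f g"
  note [simp] = Hom_intros Comp_Ident_left Comp_Ident_right Comp_diff_left Comp_diff_right
  have "kernel D b b ?e a f"
    unfolding kernel_def
  proof (intro conjI ballI impI)
    show "Comp D a b b ?e f = 0" by (simp add: g Comp_assoc_right)
  next
    fix x u assume x[simp]: "x \<in> Obj D" "u \<in> Hom D x b" and "Comp D x b b ?e u = 0"
    then have "u = Comp D x a b f (Comp D x b a g u)" by (simp add: Comp_assoc_right)
    then show "\<exists>!h. h \<in> Hom D x a \<and> Comp D x a b f h = u"
    proof (intro ex1I[of _ "Comp D x b a g u"])
      fix h assume "h \<in> Hom D x a \<and> Comp D x a b f h = u"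
      then show "h = Comp D x b a g u"
        using mono x \<open>u = _\<close> unfolding mono_arrow_def by (elim conjE) (drule bspec[of _ _ x], simp, simp)
    qed simp
  qed simp_all
  then show "\<exists>c g. c \<in> Obj D \<and> g \<in> Hom D b c \<and> kernel D b c g a f"
    by (intro exI[of _ b] exI[of _ ?e]) simp
next
  fix a b f assume [simp]: "a \<in> Obj D" "b \<in> Obj D" and epi: "epi_arrow D a b f"
  then have [simp]: "f \<in> Hom D a b" by (simp add: epi_arrow_def)
  obtain g where [simp]: "g \<in> Hom D b a" and g: "Comp D a a b f (Comp D a b a g f) = f"
    using reg unfolding von_neumann_regular_def by (meson \<open>a \<in> Obj D\<close> \<open>b \<in> Obj D\<close> \<open>f \<in> Hom D a b\<close>)
  let ?e = "Ident D a - Comp D a b a g f"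
  note [simp] = Hom_intros Comp_Ident_left Comp_Ident_right Comp_diff_left Comp_diff_right
  \<comment> \<open>Dually, an epimorphism \<open>f\<close> is a cokernel of \<open>1 - g f\<close>,
    with \<open>u = (u g) f\<close> as factorization.\<close>
  have "cokernel D a a ?e b f"
    unfolding cokernel_def
  proof (intro conjI ballI impI)
    show "Comp D a a b f ?e = 0" by (simp add: g)
  next
    fix x u assume x[simp]: "x \<in> Obj D" "u \<in> Hom D a x" and "Comp D a a x u ?e = 0"
    then have "u = Comp D a b x (Comp D b a x u g) f" by (simp add: Comp_assoc_right)
    then show "\<exists>!h. h \<in> Hom D b x \<and> Comp D a b x h f = u"
    proof (intro ex1I[of _ "Comp D b a x u g"])
      fix h assume "h \<in> Hom D b x \<and> Comp D a b x h f = u"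
      then show "h = Comp D b a x u g"
        using epi x \<open>u = _\<close> unfolding epi_arrow_def by (elim conjE) (drule bspec[of _ _ x], simp, simp)
    qed simp
  qed simp_all
  then show "\<exists>c g. c \<in> Obj D \<and> g \<in> Hom D c a \<and> cokernel D c a g b f"
    by (intro exI[of _ a] exI[of _ ?e]) simp
qed (use zero sum in auto)


text \<open>In composites nested to the right the two leftmost factors are not a subterm; this form
  lets a known product of these two be substituted.\<close>

lemma Comp_cancel:
  assumes "a \<in> Obj D" "b \<in> Obj D" "x \<in> Obj D" "y \<in> Obj D"
    and "f \<in> Hom D a b" "g \<in> Hom D b y" "u \<in> Hom D x a" "Comp D a b y g f = h"
  shows "Comp D x b y g (Comp D x a b f u) = Comp D x a y h u"
  using assms by (metis Comp_assoc)

lemma direct_sum_append: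
  assumes [simp]: "a \<in> Obj D" "b \<in> Obj D" "x \<in> Obj D"
    and [simp]: "i \<in> Hom D a x" "g \<in> Hom D x a" "j \<in> Hom D b x" "r \<in> Hom D x b"
    and [simp]: "Comp D a x a g i = Ident D a" "Comp D b x b r j = Ident D b"
      "Comp D a x b r i = 0" "Comp D b x a g j = 0"
    and sum: "Comp D x a x i g + Comp D x b x j r = Ident D x"
    and "direct_sum D a ss" "direct_sum D b ts"
  shows "direct_sum D x (ss @ ts)"
proof -
  obtain inc prj where ss: "set ss \<subseteq> Obj D"
    "\<And>k. k < length ss \<Longrightarrow> inc k \<in> Hom D (ss ! k) a" "\<And>k. k < length ss \<Longrightarrow> prj k \<in> Hom D a (ss ! k)"
    "\<And>k l. k < length ss \<Longrightarrow> l < length ss \<Longrightarrow>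
       Comp D (ss ! l) a (ss ! k) (prj k) (inc l) = (if k = l then Ident D (ss ! k) else 0)"
    "(\<Sum>k<length ss. Comp D a (ss ! k) a (inc k) (prj k)) = Ident D a"
    using \<open>direct_sum D a ss\<close> unfolding direct_sum_def by blast
  obtain inc' prj' where ts: "set ts \<subseteq> Obj D"
    "\<And>k. k < length ts \<Longrightarrow> inc' k \<in> Hom D (ts ! k) b" "\<And>k. k < length ts \<Longrightarrow> prj' k \<in> Hom D b (ts ! k)"
    "\<And>k l. k < length ts \<Longrightarrow> l < length ts \<Longrightarrow>
       Comp D (ts ! l) b (ts ! k) (prj' k) (inc' l) = (if k = l then Ident D (ts ! k) else 0)"
    "(\<Sum>k<length ts. Comp D b (ts ! k) b (inc' k) (prj' k)) = Ident D b"
    using \<open>direct_sum D b ts\<close> unfolding direct_sum_def by blast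
  have obj: "ss ! k \<in> Obj D" if "k < length ss" for k using that ss(1) by auto
  have obj': "ts ! k \<in> Obj D" if "k < length ts" for k using that ts(1) by auto
  note [simp] = Hom_intros Comp_Ident_left Comp_Ident_right Comp_0_left Comp_0_right obj obj' ss(2-4) ts(2-4)
  define m n where "m = length ss" and "n = length ts"
  define I where "I k = (if k < m then Comp D (ss ! k) a x i (inc k)
    else Comp D (ts ! (k - m)) b x j (inc' (k - m)))" for k
  define P where "P k = (if k < m then Comp D x a (ss ! k) (prj k) g
    else Comp D x b (ts ! (k - m)) (prj' (k - m)) r)" for k
  have 1: "I k \<in> Hom D ((ss @ ts) ! k) x" "P k \<in> Hom D x ((ss @ ts) ! k)" if "k < m + n" for k
    using that by (auto simp: I_def P_def m_def n_def nth_append)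
  \<comment> \<open>Regrouping puts the two middle factors together, so that orthogonality on
    \<open>x\<close> reduces to the relations between \<open>i\<close>, \<open>g\<close>,
    \<open>j\<close> and \<open>r\<close>.\<close>
  have mid: "Comp D c x d (Comp D x e d p u) (Comp D c f x v q) = Comp D c e d p (Comp D c f e (Comp D f x e u v) q)"
    if "c \<in> Obj D" "d \<in> Obj D" "e \<in> Obj D" "f \<in> Obj D" "p \<in> Hom D e d" "u \<in> Hom D x e" "v \<in> Hom D f x" "q \<in> Hom D c f"
    for c d e f p q u v
    using that by (simp add: Comp_assoc_right)
  have 2: "Comp D ((ss @ ts) ! l) x ((ss @ ts) ! k) (P k) (I l) = (if k = l then Ident D ((ss @ ts) ! k) else 0)"
    if "k < m + n" "l < m + n" for k l
    using that by (auto simp: I_def P_def m_def n_def nth_append mid)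
  have 3: "(\<Sum>k<m + n. Comp D x ((ss @ ts) ! k) x (I k) (P k)) = Ident D x"
  proof -
    have "(\<Sum>k<m + n. Comp D x ((ss @ ts) ! k) x (I k) (P k)) =
      (\<Sum>k<m. Comp D x ((ss @ ts) ! k) x (I k) (P k)) + (\<Sum>k<n. Comp D x ((ss @ ts) ! (k + m)) x (I (k + m)) (P (k + m)))"
      by (induction n) (auto simp: algebra_simps)
    also have "(\<Sum>k<m. Comp D x ((ss @ ts) ! k) x (I k) (P k)) =
        (\<Sum>k<m. Comp D x a x i (Comp D x a a (Comp D a (ss ! k) a (inc k) (prj k)) g))"
      by (intro sum.cong) (auto simp: I_def P_def m_def nth_append Comp_assoc_right)
    also have "\<dots> = Comp D x a x i (Comp D x a a (\<Sum>k<m. Comp D a (ss ! k) a (inc k) (prj k)) g)"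
      by (subst Comp_sum_left, simp_all add: m_def) (subst Comp_sum_right, simp_all)
    also have "(\<Sum>k<n. Comp D x ((ss @ ts) ! (k + m)) x (I (k + m)) (P (k + m))) =
        (\<Sum>k<n. Comp D x b x j (Comp D x b b (Comp D b (ts ! k) b (inc' k) (prj' k)) r))"
      by (intro sum.cong) (auto simp: I_def P_def m_def n_def nth_append Comp_assoc_right)
    also have "\<dots> = Comp D x b x j (Comp D x b b (\<Sum>k<n. Comp D b (ts ! k) b (inc' k) (prj' k)) r)"
      by (subst Comp_sum_left, simp_all add: n_def) (subst Comp_sum_right, simp_all)
    finally show ?thesis by (simp add: m_def n_def ss(5) ts(5) sum)
  qed
  show ?thesis
    unfolding direct_sum_def
  proof (intro conjI)
    have len: "length (ss @ ts) = m + n" by (simp add: m_def n_def)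
    show "\<exists>inc prj. (\<forall>k<length (ss @ ts). inc k \<in> Hom D ((ss @ ts) ! k) x \<and> prj k \<in> Hom D x ((ss @ ts) ! k)) \<and>
      (\<forall>k<length (ss @ ts). \<forall>l<length (ss @ ts). Comp D ((ss @ ts) ! l) x ((ss @ ts) ! k) (prj k) (inc l) =
        (if k = l then Ident D ((ss @ ts) ! k) else 0)) \<and>
      (\<Sum>k<length (ss @ ts). Comp D x ((ss @ ts) ! k) x (inc k) (prj k)) = Ident D x"
      unfolding len using 1 2 3 by blast
  qed (use ss(1) ts(1) in simp_all)
qed

text \<open>Conjugation \<open>e \<mapsto> i e g\<close> carries an orthogonal family on the summand
  \<open>a\<close> to one on \<open>x\<close>, and the complement \<open>1 - i g\<close>, which is
  nonzero for a proper summand, is a further member. Hence the count on \<open>a\<close> is strictly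
  smaller.\<close>

lemma orthogonal_idempotents_summand:
  assumes [simp]: "a \<in> Obj D" "x \<in> Obj D" "i \<in> Hom D a x" "g \<in> Hom D x a"
    and gi[simp]: "Comp D a x a g i = Ident D a" and ne: "Comp D x a x i g \<noteq> Ident D x"
    and bound: "\<And>S. orthogonal_idempotents D x S \<Longrightarrow> finite S \<and> card S \<le> n"
    and S: "orthogonal_idempotents D a S"
  shows "finite S \<and> card S < n"
proof -
  note [simp] = Hom_intros Comp_Ident_left Comp_Ident_right Comp_0_left Comp_0_right Comp_diff_left Comp_diff_right
  define \<phi> where "\<phi> e = Comp D x a x i (Comp D x a a e g)" for e
  define E where "E = Ident D x - Comp D x a x i g"
  have "g = Comp D x a a (Comp D a x a g i) g" by simp
  also have "\<dots> = Comp D x x a g (Comp D x a x i g)" by (rule Comp_assoc_right) simp_all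
  finally have gig[simp]: "Comp D x x a g (Comp D x a x i g) = g" by simp
  have SH: "e \<in> Hom D a a" if "e \<in> S" for e using S that unfolding orthogonal_idempotents_def by auto
  have gcancel: "Comp D x x a g (\<phi> e) = Comp D x a a e g" if "e \<in> Hom D a a" for e
  proof -
    have "Comp D x x a g (\<phi> e) = Comp D x a a (Comp D a x a g i) (Comp D x a a e g)"
      unfolding \<phi>_def using that by (intro Comp_assoc) simp_all
    then show ?thesis using that by simp
  qed
  have \<phi>mul: "Comp D x x x (\<phi> e) (\<phi> e') = \<phi> (Comp D a a a e e')" if "e \<in> Hom D a a" "e' \<in> Hom D a a" for e e'
  proof -
    have "\<phi> e' \<in> Hom D x x" using that by (simp add: \<phi>_def)
    then have "Comp D x x x (\<phi> e) (\<phi> e') = Comp D x a x i (Comp D x a a e (Comp D x x a g (\<phi> e')))"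
      using that by (simp add: \<phi>_def[of e] Comp_assoc_right)
    then show ?thesis using that by (simp add: gcancel Comp_assoc) (simp add: \<phi>_def Comp_assoc_right)
  qed
  \<comment> \<open>Composing with \<open>g\<close> and \<open>i\<close> recovers \<open>e\<close>,
    so \<open>\<phi>\<close> is injective and preserves being nonzero.\<close>
  have retract: "Comp D a x a (Comp D x x a g (\<phi> e)) i = e" if e: "e \<in> Hom D a a" for e
    by (simp only: gcancel[OF e]) (simp add: e Comp_assoc_right)
  then have inj: "inj_on \<phi> S" using SH by (metis inj_onI)
  have \<phi>0: "\<phi> 0 = 0" by (simp add: \<phi>_def)
  have E: "E \<in> Hom D x x" "E \<noteq> 0" "Comp D x x x E E = E"
    using ne by (simp_all add: E_def Comp_assoc_right)
  have E\<phi>: "Comp D x x x E (\<phi> e) = 0" "Comp D x x x (\<phi> e) E = 0" if "e \<in> Hom D a a" for e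
  proof -
    have "\<phi> e \<in> Hom D x x" using that by (simp add: \<phi>_def)
    then show "Comp D x x x E (\<phi> e) = 0"
      using that gcancel[OF that] by (simp add: E_def Comp_assoc_right) (simp add: \<phi>_def)
    show "Comp D x x x (\<phi> e) E = 0"
      using that by (simp add: E_def \<phi>_def Comp_assoc_right)
  qed
  have "E \<notin> \<phi> ` S"
  proof
    assume "E \<in> \<phi> ` S"
    then obtain e where "e \<in> S" "E = \<phi> e" by blast
    then show False using E E\<phi>(1)[of e] SH[of e] by simp
  qed
  have "orthogonal_idempotents D x (insert E (\<phi> ` S))"
    unfolding orthogonal_idempotents_def
  proof (intro conjI ballI)
    have "\<phi> e \<noteq> 0" if "e \<in> S" for e
      using retract[OF SH[OF that]] S that unfolding orthogonal_idempotents_def by auto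
    then show "insert E (\<phi> ` S) \<subseteq> Hom D x x - {0}"
      using E SH by (auto simp: \<phi>_def)
  next
    fix u v assume uv: "u \<in> insert E (\<phi> ` S)" "v \<in> insert E (\<phi> ` S)"
    have *: "Comp D x x x (\<phi> e) (\<phi> e') = (if \<phi> e = \<phi> e' then \<phi> e else 0)" if "e \<in> S" "e' \<in> S" for e e'
    proof -
      have "Comp D a a a e e' = (if e = e' then e else 0)"
        using S that unfolding orthogonal_idempotents_def by auto
      then show ?thesis
        using \<phi>mul[OF SH[OF that(1)] SH[OF that(2)]] inj_onD[OF inj _ that] \<phi>0 by auto
    qed
    show "Comp D x x x u v = (if u = v then u else 0)"
      using uv \<open>E \<notin> \<phi> ` S\<close> E E\<phi> SH * by auto
  qed
  then have "finite (insert E (\<phi> ` S)) \<and> card (insert E (\<phi> ` S)) \<le> n" by (rule bound)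
  moreover from this have "card (insert E (\<phi> ` S)) = Suc (card S)"
    using \<open>E \<notin> \<phi> ` S\<close> by (simp add: card_image[OF inj])
  ultimately show ?thesis
    using inj by (auto dest: finite_imageD)
qed

text \<open>Induction on the bound for orthogonal idempotents. If \<open>x\<close> is neither zero
  nor simple, some monomorphism from a nonzero object is not an isomorphism; regularity makes it a
  split inclusion of a proper summand, and both this summand and its complement admit smaller
  bounds.\<close>

lemma ex_simple_decomposition:
  assumes reg: "von_neumann_regular D" and split: "idempotents_split D"
    and "x \<in> Obj D" "\<And>S. orthogonal_idempotents D x S \<Longrightarrow> finite S \<and> card S \<le> n"
  shows "\<exists>ss. (\<forall>s\<in>set ss. simple_object D s) \<and> direct_sum D x ss"
  using assms(3,4)
proof (induction n arbitrary: x rule: less_induct)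
  case (less n x)
  note [simp] = Hom_intros Comp_Ident_left Comp_Ident_right Comp_0_left Comp_0_right Comp_diff_left Comp_diff_right
  have [simp]: "x \<in> Obj D" by fact
  consider "Ident D x = 0" | "simple_object D x" | "Ident D x \<noteq> 0" "\<not> simple_object D x" by blast
  then show ?case
  proof cases
    case 1
    then have "direct_sum D x []" by (simp add: direct_sum_def)
    then show ?thesis by (intro exI[of _ "[]"]) simp
  next
    case 2
    have "direct_sum D x [x]"
      unfolding direct_sum_def by (intro conjI exI[of _ "\<lambda>_. Ident D x"]) auto
    then show ?thesis using 2 by (intro exI[of _ "[x]"]) simp
  next
    case 3
    then obtain a i where a[simp]: "a \<in> Obj D" and mono: "mono_arrow D a x i" and nz: "\<not> zero_object D a" and ni: "\<not> iso_arrow D a x i"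
      unfolding simple_object_def zero_object_iff by auto
    have [simp]: "i \<in> Hom D a x" using mono by (simp add: mono_arrow_def)
    obtain g where [simp]: "g \<in> Hom D x a" and g: "Comp D a a x i (Comp D a x a g i) = i"
      using reg unfolding von_neumann_regular_def by (meson \<open>x \<in> Obj D\<close> a \<open>i \<in> Hom D a x\<close>)
    \<comment> \<open>Cancelling the monomorphism \<open>i\<close> in \<open>i (g i) = i\<close>
      gives \<open>g i = 1\<close>.\<close>
    have gi[simp]: "Comp D a x a g i = Ident D a"
      using mono g unfolding mono_arrow_def by (auto dest!: bspec[of _ _ a])
    let ?E = "Ident D x - Comp D x a x i g"
    have ne: "Comp D x a x i g \<noteq> Ident D x" using ni gi unfolding iso_arrow_def by auto
    have [simp]: "Comp D x x x (Comp D x a x i g) (Comp D x a x i g) = Comp D x a x i g"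
      using Comp_cancel[of a x x a i g g "Ident D a"] by (simp add: Comp_assoc_right)
    obtain b j r where b[simp]: "b \<in> Obj D" "j \<in> Hom D b x" "r \<in> Hom D x b"
      "Comp D b x b r j = Ident D b" and jr: "Comp D x b x j r = ?E"
      using split idempotent_complement[of x "Comp D x a x i g"] unfolding idempotents_split_def
      by (metis \<open>x \<in> Obj D\<close> \<open>i \<in> Hom D a x\<close> \<open>g \<in> Hom D x a\<close> a Comp_in_Hom \<open>Comp D x x x (Comp D x a x i g) (Comp D x a x i g) = Comp D x a x i g\<close>)
    \<comment> \<open>As \<open>r = r (j r)\<close> and \<open>j r = 1 - i g\<close>, the composite
      \<open>r i\<close> contains \<open>(1 - i g) i = 0\<close>. In the same way \<open>g j\<close>
      contains \<open>g (1 - i g) = 0\<close>.\<close>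
    have "r = Comp D x x b r (Comp D x b x j r)" by (simp add: Comp_assoc del: jr)
    then have "Comp D a x b r i = Comp D a x b (Comp D x x b r (Comp D x b x j r)) i" by simp
    also have "\<dots> = Comp D a x b r (Comp D a x x (Comp D x b x j r) i)" by (rule Comp_assoc_right) simp_all
    also have "\<dots> = 0" by (simp add: jr g Comp_assoc_right)
    finally have ri: "Comp D a x b r i = 0" .
    have "j = Comp D b x x (Comp D x b x j r) j" by (simp add: Comp_assoc_right del: jr)
    then have "Comp D b x a g j = Comp D b x a g (Comp D b x x (Comp D x b x j r) j)" by simp
    also have "\<dots> = Comp D b x a (Comp D x x a g (Comp D x b x j r)) j" by (rule Comp_assoc) simp_all
    also have "\<dots> = 0" by (simp add: jr Comp_assoc)
    finally have gj: "Comp D b x a g j = 0" .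
    have "Comp D x a x i g \<noteq> 0"
    proof
      assume "Comp D x a x i g = 0"
      then have "Comp D a x x (Comp D x a x i g) i = 0" by simp
      then have "i = 0" by (simp add: Comp_assoc_right)
      then show False using gi nz by (simp add: zero_object_iff)
    qed
    then have ne': "Comp D x b x j r \<noteq> Ident D x" by (simp add: jr)
    have "finite S \<and> card S < n" if "orthogonal_idempotents D a S" for S
      by (rule orthogonal_idempotents_summand[OF _ _ _ _ gi ne less.prems(2) that]) simp_all
    then have sa: "\<exists>ss. (\<forall>s\<in>set ss. simple_object D s) \<and> direct_sum D a ss" if "n > 0"
      using that by (intro less.IH[of "n - 1"]) fastforce+
    have "finite S \<and> card S < n" if "orthogonal_idempotents D b S" for S
      by (rule orthogonal_idempotents_summand[OF _ _ _ _ b(4) ne' less.prems(2) that]) simp_all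
    then have sb: "\<exists>ss. (\<forall>s\<in>set ss. simple_object D s) \<and> direct_sum D b ss" if "n > 0"
      using that by (intro less.IH[of "n - 1"]) fastforce+
    \<comment> \<open>The identity of a nonzero object is by itself an orthogonal family, so the
      bound is positive and the induction hypothesis applies to \<open>n - 1\<close>.\<close>
    have "n > 0"
      using less.prems(2)[of "{Ident D x}"] 3 by (simp add: orthogonal_idempotents_def)
    obtain ss ts where "\<forall>s\<in>set ss. simple_object D s" "direct_sum D a ss"
        "\<forall>s\<in>set ts. simple_object D s" "direct_sum D b ts"
      using sa[OF \<open>n > 0\<close>] sb[OF \<open>n > 0\<close>] by blast
    moreover have "direct_sum D x (ss @ ts)"
      by (rule direct_sum_append[of a b x i g j r]) (use calculation ri gj jr in simp_all)
    ultimately show ?thesis by (intro exI[of _ "ss @ ts"]) auto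
  qed
qed

text \<open>Schur's lemma. The kernel of \<open>f\<close> is a subobject of the simple
  \<open>s\<close>; it is not all of \<open>s\<close> because \<open>f\<close> is nonzero, so it
  vanishes and \<open>f\<close> is mono. A monomorphism from a nonzero object into the simple
  \<open>s'\<close> is an isomorphism.\<close>

lemma simple_nonzero_iso:
  assumes "abelian_category D" "simple_object D s" "simple_object D s'" "f \<in> Hom D s s'" "f \<noteq> 0"
  shows "iso_arrow D s s' f"
proof -
  interpret ab: abelian_category D by fact
  have [simp]: "s \<in> Obj D" "s' \<in> Obj D" "f \<in> Hom D s s'" using assms by (auto simp: simple_object_def)
  note [simp] = Hom_intros Comp_Ident_left Comp_Ident_right Comp_0_left Comp_0_right Comp_diff_left Comp_diff_right
  obtain k i where ker: "kernel D s s' f k i" using ab.ex_kernel assms \<open>s \<in> Obj D\<close> \<open>s' \<in> Obj D\<close> by blast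
  then have [simp]: "k \<in> Obj D" "i \<in> Hom D k s" "Comp D k s s' f i = 0" by (auto simp: kernel_def)
  have "mono_arrow D k s i"
    unfolding mono_arrow_def
  proof (intro conjI ballI impI)
    fix x u v assume [simp]: "x \<in> Obj D" "u \<in> Hom D x k" "v \<in> Hom D x k" and eq: "Comp D x k s i u = Comp D x k s i v"
    have "Comp D x s s' f (Comp D x k s i u) = 0"
      using Comp_cancel[of k s x s' i f u 0] by simp
    then have "\<exists>!h. h \<in> Hom D x k \<and> Comp D x k s i h = Comp D x k s i u"
      using ker unfolding kernel_def by (auto dest!: bspec[of _ _ x] bspec[of _ _ "Comp D x k s i u"])
    then show "u = v" using eq by (metis \<open>u \<in> Hom D x k\<close> \<open>v \<in> Hom D x k\<close>)
  qed simp
  moreover have "\<not> iso_arrow D k s i"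
  proof
    assume "iso_arrow D k s i"
    then obtain h where [simp]: "h \<in> Hom D s k" and h: "Comp D s k s i h = Ident D s" unfolding iso_arrow_def by blast
    have "f = Comp D s s s' f (Comp D s k s i h)" by (simp add: h)
    also have "\<dots> = Comp D s k s' (Comp D k s s' f i) h" by (rule Comp_assoc) simp_all
    finally show False using \<open>f \<noteq> 0\<close> by simp
  qed
  ultimately have zk: "Ident D k = 0"
    using \<open>simple_object D s\<close> \<open>k \<in> Obj D\<close> unfolding simple_object_def zero_object_iff by auto
  have "i = Comp D k k s i (Ident D k)" by simp
  then have i0: "i = 0" using zk by simp
  have "mono_arrow D s s' f"
    unfolding mono_arrow_def
  proof (intro conjI ballI impI)
    fix x u v assume [simp]: "x \<in> Obj D" "u \<in> Hom D x s" "v \<in> Hom D x s" and eq: "Comp D x s s' f u = Comp D x s s' f v"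
    then obtain h where "h \<in> Hom D x k" "Comp D x k s i h = u - v"
      using ker unfolding kernel_def by (auto dest!: bspec[of _ _ x] bspec[of _ _ "u - v"])
    then show "u = v" using i0 by simp
  qed simp
  moreover have "\<not> zero_object D s" using assms by (simp add: simple_object_def)
  ultimately show ?thesis using \<open>simple_object D s'\<close> \<open>s \<in> Obj D\<close> unfolding simple_object_def by blast
qed

text \<open>A nonzero \<open>f\<close> has a nonzero component between simple summands of
  \<open>a\<close> and \<open>b\<close>, which is invertible by Schur's lemma. Extending its inverse
  by the inclusion and the projection gives \<open>h\<close> for which \<open>h f\<close> restricts
  to the inclusion of a simple summand, hence is not 0.\<close>

theorem semisimple_no_negligible:
  assumes ss: "semisimple D" and [simp]: "a \<in> Obj D" "b \<in> Obj D" "f \<in> Hom D a b"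
    and negl: "\<And>h. h \<in> Hom D b a \<Longrightarrow> Comp D a b a h f = 0"
  shows "f = 0"
proof (rule ccontr)
  assume "f \<noteq> 0"
  note [simp] = Hom_intros Comp_Ident_left Comp_Ident_right Comp_0_left Comp_0_right
  obtain xs where xs: "\<And>s. s \<in> set xs \<Longrightarrow> simple_object D s" "direct_sum D a xs"
    using ss \<open>a \<in> Obj D\<close> unfolding semisimple_def by blast
  obtain ys where ys: "\<And>s. s \<in> set ys \<Longrightarrow> simple_object D s" "direct_sum D b ys"
    using ss \<open>b \<in> Obj D\<close> unfolding semisimple_def by blast
  obtain inc prj where x: "\<And>k. k < length xs \<Longrightarrow> inc k \<in> Hom D (xs ! k) a" "\<And>k. k < length xs \<Longrightarrow> prj k \<in> Hom D a (xs ! k)"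
    "\<And>k l. k < length xs \<Longrightarrow> l < length xs \<Longrightarrow>
       Comp D (xs ! l) a (xs ! k) (prj k) (inc l) = (if k = l then Ident D (xs ! k) else 0)"
    "(\<Sum>k<length xs. Comp D a (xs ! k) a (inc k) (prj k)) = Ident D a"
    using xs(2) unfolding direct_sum_def by blast
  obtain inc' prj' where y: "\<And>k. k < length ys \<Longrightarrow> inc' k \<in> Hom D (ys ! k) b" "\<And>k. k < length ys \<Longrightarrow> prj' k \<in> Hom D b (ys ! k)"
    "(\<Sum>k<length ys. Comp D b (ys ! k) b (inc' k) (prj' k)) = Ident D b"
    using ys(2) unfolding direct_sum_def by blast
  have obj: "xs ! k \<in> Obj D" if "k < length xs" for k using that xs(1)[of "xs ! k"] by (simp add: simple_object_def)
  have obj': "ys ! k \<in> Obj D" if "k < length ys" for k using that ys(1)[of "ys ! k"] by (simp add: simple_object_def)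
  note [simp] = obj obj' x(1,2) y(1,2)
  have "\<exists>j<length xs. Comp D (xs ! j) a b f (inc j) \<noteq> 0"
  proof (rule ccontr)
    assume H: "\<not> (\<exists>j<length xs. Comp D (xs ! j) a b f (inc j) \<noteq> 0)"
    have "f = Comp D a a b f (\<Sum>k<length xs. Comp D a (xs ! k) a (inc k) (prj k))" by (simp add: x(4))
    also have "\<dots> = (\<Sum>k<length xs. Comp D a a b f (Comp D a (xs ! k) a (inc k) (prj k)))"
      by (rule Comp_sum_right) simp_all
    also have "\<dots> = (\<Sum>k<length xs. Comp D a (xs ! k) b (Comp D (xs ! k) a b f (inc k)) (prj k))"
      by (intro sum.cong refl Comp_assoc) simp_all
    also have "\<dots> = 0" using H by (intro sum.neutral) simp
    finally show False using \<open>f \<noteq> 0\<close> by simp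
  qed
  then obtain j where [simp]: "j < length xs" and j: "Comp D (xs ! j) a b f (inc j) \<noteq> 0" by blast
  let ?u = "Comp D (xs ! j) a b f (inc j)"
  have "\<exists>i<length ys. Comp D (xs ! j) b (ys ! i) (prj' i) ?u \<noteq> 0"
  proof (rule ccontr)
    assume H: "\<not> (\<exists>i<length ys. Comp D (xs ! j) b (ys ! i) (prj' i) ?u \<noteq> 0)"
    have "?u = Comp D (xs ! j) b b (\<Sum>k<length ys. Comp D b (ys ! k) b (inc' k) (prj' k)) ?u" by (simp add: y(3))
    also have "\<dots> = (\<Sum>k<length ys. Comp D (xs ! j) b b (Comp D b (ys ! k) b (inc' k) (prj' k)) ?u)"
      by (rule Comp_sum_left) simp_all
    also have "\<dots> = (\<Sum>k<length ys. Comp D (xs ! j) (ys ! k) b (inc' k) (Comp D (xs ! j) b (ys ! k) (prj' k) ?u))"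
      by (intro sum.cong refl Comp_assoc_right) simp_all
    also have "\<dots> = 0" using H by (intro sum.neutral) simp
    finally show False using j by simp
  qed
  then obtain i where [simp]: "i < length ys" and i: "Comp D (xs ! j) b (ys ! i) (prj' i) ?u \<noteq> 0" by blast
  have "simple_object D (xs ! j)" "simple_object D (ys ! i)" using xs(1) ys(1) by simp_all
  then have "iso_arrow D (xs ! j) (ys ! i) (Comp D (xs ! j) b (ys ! i) (prj' i) ?u)"
    using ss i by (intro simple_nonzero_iso) (simp_all add: semisimple_def)
  then obtain g where [simp]: "g \<in> Hom D (ys ! i) (xs ! j)"
    and g: "Comp D (xs ! j) (ys ! i) (xs ! j) g (Comp D (xs ! j) b (ys ! i) (prj' i) ?u) = Ident D (xs ! j)"
    unfolding iso_arrow_def by blast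
  define h where "h = Comp D b (xs ! j) a (inc j) (Comp D b (ys ! i) (xs ! j) g (prj' i))"
  have [simp]: "h \<in> Hom D b a" by (simp add: h_def)
  have "inc j = Comp D (xs ! j) (xs ! j) a (inc j)
     (Comp D (xs ! j) (ys ! i) (xs ! j) g (Comp D (xs ! j) b (ys ! i) (prj' i) ?u))"
    by (simp add: g)
  also have "\<dots> = Comp D (xs ! j) a a (Comp D a b a h f) (inc j)"
    by (simp add: h_def Comp_assoc_right)
  also have "\<dots> = 0" by (simp add: negl)
  finally have "Ident D (xs ! j) = 0" using x(3)[of j j] by simp
  then show False using \<open>simple_object D (xs ! j)\<close> by (simp add: simple_object_def zero_object_iff)
qed
text \<open>Trades the index functions of \<open>direct_sum\<close> for four named morphisms, the
  form in which binary sums are built and taken apart in the completions.\<close>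

lemma direct_sum_pair:
  "direct_sum D x [a, b] \<longleftrightarrow> a \<in> Obj D \<and> b \<in> Obj D \<and> x \<in> Obj D \<and>
     (\<exists>i\<in>Hom D a x. \<exists>g\<in>Hom D x a. \<exists>j\<in>Hom D b x. \<exists>r\<in>Hom D x b.
        Comp D a x a g i = Ident D a \<and> Comp D b x b r j = Ident D b \<and>
        Comp D a x b r i = 0 \<and> Comp D b x a g j = 0 \<and>
        Comp D x a x i g + Comp D x b x j r = Ident D x)"
proof
  assume "direct_sum D x [a, b]"
  moreover have len: "length [a, b] = 2" by simp
  ultimately have *: "x \<in> Obj D" "a \<in> Obj D" "b \<in> Obj D" and
    "\<exists>inc prj. (\<forall>k<2. inc k \<in> Hom D ([a, b] ! k) x \<and> prj k \<in> Hom D x ([a, b] ! k)) \<and>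
      (\<forall>k<2. \<forall>l<2. Comp D ([a, b] ! l) x ([a, b] ! k) (prj k) (inc l) = (if k = l then Ident D ([a, b] ! k) else 0)) \<and>
      (\<Sum>k<2. Comp D x ([a, b] ! k) x (inc k) (prj k)) = Ident D x"
    unfolding direct_sum_def len by auto
  then obtain inc prj where 1: "\<And>k. k < 2 \<Longrightarrow> inc k \<in> Hom D ([a, b] ! k) x" "\<And>k. k < 2 \<Longrightarrow> prj k \<in> Hom D x ([a, b] ! k)"
    and 2: "\<And>k l. k < 2 \<Longrightarrow> l < 2 \<Longrightarrow>
       Comp D ([a, b] ! l) x ([a, b] ! k) (prj k) (inc l) = (if k = l then Ident D ([a, b] ! k) else 0)"
    and 3: "(\<Sum>k<2. Comp D x ([a, b] ! k) x (inc k) (prj k)) = Ident D x"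
    by blast
  from * show "a \<in> Obj D \<and> b \<in> Obj D \<and> x \<in> Obj D \<and>
     (\<exists>i\<in>Hom D a x. \<exists>g\<in>Hom D x a. \<exists>j\<in>Hom D b x. \<exists>r\<in>Hom D x b.
        Comp D a x a g i = Ident D a \<and> Comp D b x b r j = Ident D b \<and>
        Comp D a x b r i = 0 \<and> Comp D b x a g j = 0 \<and>
        Comp D x a x i g + Comp D x b x j r = Ident D x)"
    using 1[of 0] 1[of 1] 2[of 0 0] 2[of 0 1] 2[of 1 0] 2[of 1 1] 3
    by (intro conjI bexI[of _ "inc 0"] bexI[of _ "prj 0"] bexI[of _ "inc 1"] bexI[of _ "prj 1"])
      (simp_all add: numeral_2_eq_2)
next
  have *: "direct_sum D c [c]" if "c \<in> Obj D" for c
    unfolding direct_sum_def using that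
    by (intro conjI exI[of _ "\<lambda>_. Ident D c"]) (auto simp: Comp_Ident_left Ident_in_Hom)
  assume "a \<in> Obj D \<and> b \<in> Obj D \<and> x \<in> Obj D \<and>
     (\<exists>i\<in>Hom D a x. \<exists>g\<in>Hom D x a. \<exists>j\<in>Hom D b x. \<exists>r\<in>Hom D x b.
        Comp D a x a g i = Ident D a \<and> Comp D b x b r j = Ident D b \<and>
        Comp D a x b r i = 0 \<and> Comp D b x a g j = 0 \<and>
        Comp D x a x i g + Comp D x b x j r = Ident D x)"
  then show "direct_sum D x [a, b]"
    using direct_sum_append[of a b x _ _ _ _ "[a]" "[b]"] *[of a] *[of b] by (elim conjE bexE) simp
qed

text \<open>Orthogonal nonzero idempotents are linearly independent: multiplying a linear relation
  by a member \<open>v\<close> leaves only the multiple of \<open>v\<close>.\<close>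

lemma orthogonal_idempotents_bound:
  assumes "a \<in> Obj D" "finite T" "Hom D a a \<subseteq> vs.span T" "orthogonal_idempotents D a S"
  shows "finite S \<and> card S \<le> card T"
proof -
  have S: "v \<in> Hom D a a" "v \<noteq> 0" if "v \<in> S" for v
    using assms(4) that unfolding orthogonal_idempotents_def by auto
  have "vs.independent S"
    unfolding vs.independent_explicit_module
  proof (intro allI impI)
    fix t u v assume t: "finite t" "t \<subseteq> S" "(\<Sum>v\<in>t. Scale D (u v) v) = 0" "v \<in> t"
    have "0 = Comp D a a a v (\<Sum>w\<in>t. Scale D (u w) w)"
      using t S assms(1) by (simp add: Comp_0_right subset_iff)
    also have "\<dots> = (\<Sum>w\<in>t. Comp D a a a v (Scale D (u w) w))"
      using t S assms(1) by (intro Comp_sum_right Scale_in_Hom) auto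
    also have "\<dots> = (\<Sum>w\<in>t. if w = v then Scale D (u v) v else 0)"
    proof (intro sum.cong refl)
      fix w assume "w \<in> t"
      then have "w \<in> S" "v \<in> S" using t by auto
      then have "Comp D a a a v (Scale D (u w) w) = Scale D (u w) (Comp D a a a v w)"
        "Comp D a a a v w = (if v = w then v else 0)"
        using S assms(1,4) by (auto simp: Comp_Scale_right orthogonal_idempotents_def)
      then show "Comp D a a a v (Scale D (u w) w) = (if w = v then Scale D (u v) v else 0)"
        by auto
    qed
    also have "\<dots> = Scale D (u v) v" using t by simp
    finally show "u v = 0" using S(2)[of v] t by auto
  qed
  then show ?thesis
    using vs.independent_span_bound[OF assms(2)] S assms(3) by (meson subset_iff)
qed

end

section \<open>Splitting, regularity and direct sums in the two completions\<close>

lemma idempotent_completion_split: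
  assumes "linear_category D"
  shows "idempotents_split (idempotent_completion D)"
  unfolding idempotents_split_def
proof (intro ballI impI)
  interpret linear_category D by fact
  fix x E assume "x \<in> Obj (idempotent_completion D)" "E \<in> Hom (idempotent_completion D) x x"
    and EE: "Comp (idempotent_completion D) x x x E E = E"
  moreover obtain a e where x: "x = (a, e)" by (cases x)
  ultimately have *: "a \<in> Obj D" "e \<in> Hom D a a" "E \<in> Hom D a a" "Comp D a a a e e = e" "Comp D a a a E E = E"
    "Comp D a a a (Comp D a a a e E) e = E"
    by (auto simp: idempotent_completion_def)
  have "Comp D a a a e E = E" "Comp D a a a E e = E"
    using * by (metis Comp_assoc Comp_in_Hom)+
  \<comment> \<open>The idempotent \<open>E\<close> is itself an object \<open>(a, E)\<close>, and
    \<open>E\<close> serves both as the inclusion and as the retraction.\<close>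
  then show "\<exists>k\<in>Obj (idempotent_completion D). \<exists>i\<in>Hom (idempotent_completion D) k x.
      \<exists>s\<in>Hom (idempotent_completion D) x k.
        Comp (idempotent_completion D) k x k s i = Ident (idempotent_completion D) k \<and>
        Comp (idempotent_completion D) x k x i s = E"
    using * by (intro bexI[of _ "(a, E)"] bexI[of _ E]) (auto simp: x idempotent_completion_def)
qed

lemma idempotent_completion_regular:
  assumes "linear_category D" "von_neumann_regular D"
  shows "von_neumann_regular (idempotent_completion D)"
  unfolding von_neumann_regular_def
proof (intro ballI)
  interpret linear_category D by fact
  fix x y f assume "x \<in> Obj (idempotent_completion D)" "y \<in> Obj (idempotent_completion D)"
    "f \<in> Hom (idempotent_completion D) x y"
  moreover obtain a e b e' where xy: "x = (a, e)" "y = (b, e')" by (cases x, cases y)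
  ultimately have [simp]: "a \<in> Obj D" "b \<in> Obj D" "e \<in> Hom D a a" "e' \<in> Hom D b b" "f \<in> Hom D a b"
    and ee: "Comp D a a a e e = e" "Comp D b b b e' e' = e'"
    and f: "Comp D a a b (Comp D a b b e' f) e = f"
    by (auto simp: idempotent_completion_def)
  have ef: "Comp D a b b e' f = f" "Comp D a a b f e = f"
    using ee f by (metis Comp_assoc Comp_in_Hom \<open>a \<in> Obj D\<close> \<open>b \<in> Obj D\<close> \<open>e \<in> Hom D a a\<close> \<open>e' \<in> Hom D b b\<close> \<open>f \<in> Hom D a b\<close>)+
  obtain g where [simp]: "g \<in> Hom D b a" and g: "Comp D a a b f (Comp D a b a g f) = f"
    using assms(2) unfolding von_neumann_regular_def by (meson \<open>a \<in> Obj D\<close> \<open>b \<in> Obj D\<close> \<open>f \<in> Hom D a b\<close>)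
  \<comment> \<open>Compressing \<open>g\<close> by the two idempotents keeps it a pseudo-inverse,
    because \<open>f\<close> is fixed by both of them.\<close>
  define h where "h = Comp D b a a e (Comp D b b a g e')"
  have [simp]: "h \<in> Hom D b a" by (simp add: h_def Hom_intros)
  have eh: "Comp D b a a e h = h"
    unfolding h_def by (subst Comp_cancel) (simp_all add: ee Hom_intros)
  have he: "Comp D b b a h e' = h"
    unfolding h_def by (simp add: Comp_assoc_right Hom_intros ee)
  have "Comp D a b a h f = Comp D a a a e (Comp D a b a g f)"
    unfolding h_def by (simp add: Comp_assoc_right Hom_intros ef)
  then have "Comp D a a b f (Comp D a b a h f) = f"
    using Comp_cancel[of a a a b e f "Comp D a b a g f" f] by (simp add: Hom_intros ef g)
  then show "\<exists>g\<in>Hom (idempotent_completion D) y x. Comp (idempotent_completion D) x x y f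
      (Comp (idempotent_completion D) x y x g f) = f"
    by (intro bexI[of _ h]) (simp_all add: xy idempotent_completion_def eh he)
qed

lemma idempotent_completion_zero:
  assumes "linear_category D" "zero_object D z"
  shows "zero_object (idempotent_completion D) (z, 0)"
proof -
  interpret linear_category D by fact
  interpret K: linear_category "idempotent_completion D"
    by (rule linear_category_idempotent_completion) fact
  show ?thesis
    using assms(2) Comp_0_left[of z z z 0] zero_in_Hom[of z z] unfolding K.zero_object_iff
    by (auto simp: idempotent_completion_def zero_object_def)
qed

lemma idempotent_completion_direct_sum:
  assumes "linear_category D"
    and sums: "\<And>a b. \<lbrakk>a \<in> Obj D; b \<in> Obj D\<rbrakk> \<Longrightarrow> \<exists>s. direct_sum D s [a, b]"
    and "x \<in> Obj (idempotent_completion D)" "y \<in> Obj (idempotent_completion D)"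
  shows "\<exists>s. direct_sum (idempotent_completion D) s [x, y]"
proof -
  interpret linear_category D by fact
  interpret K: linear_category "idempotent_completion D"
    by (rule linear_category_idempotent_completion) fact
  obtain a e b e' where xy: "x = (a, e)" "y = (b, e')" by (cases x, cases y)
  then have [simp]: "a \<in> Obj D" "b \<in> Obj D" "e \<in> Hom D a a" "e' \<in> Hom D b b"
    and ee[simp]: "Comp D a a a e e = e" "Comp D b b b e' e' = e'"
    using assms(3,4) by (auto simp: idempotent_completion_def)
  obtain s i g j r where [simp]: "s \<in> Obj D" "i \<in> Hom D a s" "g \<in> Hom D s a" "j \<in> Hom D b s" "r \<in> Hom D s b"
    "Comp D a s a g i = Ident D a" "Comp D b s b r j = Ident D b"
    "Comp D a s b r i = 0" "Comp D b s a g j = 0"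
    using sums[of a b] unfolding direct_sum_pair by (auto)
  have [simp]: "Comp D c s a g (Comp D c a s i p) = p" "Comp D c s b r (Comp D c a s i p) = 0"
    if "c \<in> Obj D" "p \<in> Hom D c a" for c p
    using that by (simp_all add: Comp_cancel[of a s c] Comp_Ident_left Comp_0_left)
  have [simp]: "Comp D c s b r (Comp D c b s j p) = p" "Comp D c s a g (Comp D c b s j p) = 0"
    if "c \<in> Obj D" "p \<in> Hom D c b" for c p
    using that by (simp_all add: Comp_cancel[of b s c] Comp_Ident_left Comp_0_left)
  have [simp]: "Comp D c a a e (Comp D c a a e p) = Comp D c a a e p" if "c \<in> Obj D" "p \<in> Hom D c a" for c p
    using that by (simp add: Comp_cancel[of a a c])
  have [simp]: "Comp D c b b e' (Comp D c b b e' p) = Comp D c b b e' p" if "c \<in> Obj D" "p \<in> Hom D c b" for c p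
    using that by (simp add: Comp_cancel[of b b c])
  \<comment> \<open>The block diagonal idempotent with blocks \<open>e\<close> and
    \<open>e'\<close>; the inclusions and projections of the sum are compressed by \<open>e\<close>
    and \<open>e'\<close> accordingly.\<close>
  define E where "E = Comp D s a s i (Comp D s a a e g) + Comp D s b s j (Comp D s b b e' r)"
  note [simp] = Hom_intros Comp_assoc_right Comp_add_left Comp_add_right Comp_Ident_left Comp_Ident_right Comp_0_left Comp_0_right
  let ?i = "Comp D a a s i e" and ?g = "Comp D s a a e g" and ?j = "Comp D b b s j e'" and ?r = "Comp D s b b e' r"
  have E: "E \<in> Hom D s s" "Comp D s s s E E = E" "Comp D a s s E ?i = ?i" "Comp D s s a ?g E = ?g"
    "Comp D b s s E ?j = ?j" "Comp D s s b ?r E = ?r"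
    by (simp_all add: E_def)
  have i: "?i \<in> Hom (idempotent_completion D) x (s, E)" "?g \<in> Hom (idempotent_completion D) (s, E) x"
    "?j \<in> Hom (idempotent_completion D) y (s, E)" "?r \<in> Hom (idempotent_completion D) (s, E) y"
    using E by (simp_all add: idempotent_completion_def xy)
  have "direct_sum (idempotent_completion D) (s, E) [x, y]"
    unfolding K.direct_sum_pair
    by (intro conjI bexI[OF _ i(1)] bexI[OF _ i(2)] bexI[OF _ i(3)] bexI[OF _ i(4)])
      (use assms(3,4) E in \<open>simp_all add: xy idempotent_completion_def E_def\<close>)
  then show ?thesis by blast
qed

lemma additive_completion_zero:
  assumes "linear_category D"
  shows "zero_object (additive_completion D) []"
proof -
  interpret A: linear_category "additive_completion D"
    by (rule linear_category_additive_completion) fact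
  show ?thesis
    unfolding A.zero_object_iff by (auto simp: additive_completion_def fun_eq_iff)
qed

lemma additive_completion_direct_sum:
  assumes "linear_category D" "xs \<in> Obj (additive_completion D)" "ys \<in> Obj (additive_completion D)"
  shows "direct_sum (additive_completion D) (xs @ ys) [xs, ys]"
proof -
  interpret linear_category D by fact
  interpret A: linear_category "additive_completion D"
    by (rule linear_category_additive_completion) fact
  have obj: "xs ! k \<in> Obj D" if "k < length xs" for k
    using that assms(2) by (auto simp: additive_completion_def)
  have obj': "ys ! k \<in> Obj D" if "k < length ys" for k
    using that assms(3) by (auto simp: additive_completion_def)
  note [simp] = obj obj' Ident_in_Hom zero_in_Hom Comp_0_left Comp_0_right Comp_Ident_left
  let ?m = "length xs" and ?n = "length ys"
  \<comment> \<open>One matrix does two jobs: the inclusion of \<open>xs\<close> and the projection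
    onto \<open>xs\<close> are both the identity in the upper left block padded by zeros, because
    \<open>xs\<close> stands first in the concatenation. For \<open>ys\<close> the offset makes them
    different, hence \<open>j\<close> and \<open>r\<close>.\<close>
  define i where "i k l = (if l < ?m \<and> k = l then Ident D (xs ! l) else 0)" for k l
  define j where "j k l = (if l < ?n \<and> k = ?m + l then Ident D (ys ! l) else 0)" for k l
  define r where "r k l = (if k < ?n \<and> l = ?m + k then Ident D (ys ! k) else 0)" for k l
  have H: "i \<in> Hom (additive_completion D) xs (xs @ ys)" "i \<in> Hom (additive_completion D) (xs @ ys) xs"
    "j \<in> Hom (additive_completion D) ys (xs @ ys)" "r \<in> Hom (additive_completion D) (xs @ ys) ys"
    by (auto simp: additive_completion_def i_def j_def r_def nth_append)
  \<comment> \<open>Evaluates a sum whose terms vanish except possibly at \<open>c\<close>; the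
    index \<open>c\<close> may lie outside the range, and then the sum is 0.\<close>
  have pick: "(\<Sum>l<N. F l) = v" if "\<And>l. l < N \<Longrightarrow> l \<noteq> c \<Longrightarrow> F l = 0" "(if c < N then F c else 0) = v"
    for F :: "nat \<Rightarrow> 'b" and N c v
  proof -
    have "(\<Sum>l<N. F l) = (\<Sum>l<N. if l = c then F c else 0)"
      using that(1) by (intro sum.cong) auto
    then show ?thesis using that(2) by simp
  qed
  have C: "Comp (additive_completion D) us vs ws N M k l = (if k < length ws \<and> l < length us
     then \<Sum>p<length vs. Comp D (us ! l) (vs ! p) (ws ! k) (N k p) (M p l) else 0)" for us vs ws N M k l
    by (simp add: additive_completion_def)
  have Id: "Ident (additive_completion D) us k l = (if k < length us \<and> k = l then Ident D (us ! k) else 0)" for us k l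
    by (simp add: additive_completion_def)
  have "Comp (additive_completion D) xs (xs @ ys) xs i i = Ident (additive_completion D) xs"
  proof (intro ext)
    fix k l
    have "(\<Sum>p<length (xs @ ys). Comp D (xs ! l) ((xs @ ys) ! p) (xs ! k) (i k p) (i p l)) =
      (if k = l then Ident D (xs ! k) else 0)" if "k < ?m" "l < ?m"
      using that by (intro pick[where c = k]) (auto simp: i_def nth_append)
    then show "Comp (additive_completion D) xs (xs @ ys) xs i i k l = Ident (additive_completion D) xs k l"
      unfolding C Id by auto
  qed
  moreover have "Comp (additive_completion D) ys (xs @ ys) ys r j = Ident (additive_completion D) ys"
  proof (intro ext)
    fix k l
    have "(\<Sum>p<length (xs @ ys). Comp D (ys ! l) ((xs @ ys) ! p) (ys ! k) (r k p) (j p l)) =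
      (if k = l then Ident D (ys ! k) else 0)" if "k < ?n" "l < ?n"
      using that by (intro pick[where c = "?m + k"]) (auto simp: r_def j_def nth_append)
    then show "Comp (additive_completion D) ys (xs @ ys) ys r j k l = Ident (additive_completion D) ys k l"
      unfolding C Id by auto
  qed
  moreover have "Comp (additive_completion D) xs (xs @ ys) ys r i = 0"
    by (intro ext) (auto simp: C i_def r_def nth_append intro!: sum.neutral)
  moreover have "Comp (additive_completion D) ys (xs @ ys) xs i j = 0"
    by (intro ext) (auto simp: C i_def j_def nth_append intro!: sum.neutral)
  moreover have "Comp (additive_completion D) (xs @ ys) xs (xs @ ys) i i +
      Comp (additive_completion D) (xs @ ys) ys (xs @ ys) j r = Ident (additive_completion D) (xs @ ys)"
  proof (intro ext)
    fix k l
    have "(\<Sum>p<?m. Comp D ((xs @ ys) ! l) (xs ! p) ((xs @ ys) ! k) (i k p) (i p l)) =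
      (if k < ?m \<and> k = l then Ident D (xs ! k) else 0)"
      if "k < length (xs @ ys)" "l < length (xs @ ys)"
      using that by (intro pick[where c = k]) (auto simp: i_def nth_append)
    moreover have "(\<Sum>p<?n. Comp D ((xs @ ys) ! l) (ys ! p) ((xs @ ys) ! k) (j k p) (r p l)) =
      (if \<not> k < ?m \<and> k = l then Ident D (ys ! (k - ?m)) else 0)"
      if "k < length (xs @ ys)" "l < length (xs @ ys)"
      using that by (intro pick[where c = "k - ?m"]) (auto simp: r_def j_def nth_append)
    ultimately show "(Comp (additive_completion D) (xs @ ys) xs (xs @ ys) i i +
      Comp (additive_completion D) (xs @ ys) ys (xs @ ys) j r) k l = Ident (additive_completion D) (xs @ ys) k l"
      unfolding C Id plus_fun_apply by (auto simp: nth_append)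
  qed
  ultimately show ?thesis
    unfolding A.direct_sum_pair using assms(2,3) H
    by (intro conjI bexI[OF _ H(1)] bexI[OF _ H(2)] bexI[OF _ H(3)] bexI[OF _ H(4)])
      (auto simp: additive_completion_def)
qed

text \<open>Orthogonal idempotents of \<open>(a, e)\<close> are orthogonal idempotents of
  \<open>a\<close>, so finite dimension of the endomorphisms in the additive completion bounds the
  number of summands of every object of the envelope.\<close>

theorem semisimple_karoubi_envelope:
  assumes "linear_category D" "von_neumann_regular (additive_completion D)"
    and fin: "\<And>xs. xs \<in> Obj (additive_completion D) \<Longrightarrow>
      \<exists>T. finite T \<and> Hom (additive_completion D) xs xs \<subseteq> module.span (Scale (additive_completion D)) T"
  shows "semisimple (karoubi_envelope D)"
proof -
  let ?A = "additive_completion D" and ?K = "idempotent_completion (additive_completion D)"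
  note A = linear_category_additive_completion[OF assms(1)]
  interpret A: linear_category ?A by (rule A)
  interpret K: linear_category ?K by (rule linear_category_idempotent_completion[OF A])
  note reg = idempotent_completion_regular[OF A assms(2)] and split = idempotent_completion_split[OF A]
  have "abelian_category ?K"
  proof (rule K.abelian_if_regular[OF reg split])
    show "\<exists>z. zero_object ?K z"
      using idempotent_completion_zero[OF A additive_completion_zero[OF assms(1)]] by blast
    show "\<exists>s. direct_sum ?K s [x, y]" if "x \<in> Obj ?K" "y \<in> Obj ?K" for x y
      using idempotent_completion_direct_sum[OF A _ that] additive_completion_direct_sum[OF assms(1)] by blast
  qed
  moreover have "\<exists>ss. (\<forall>s\<in>set ss. simple_object ?K s) \<and> direct_sum ?K x ss" if x: "x \<in> Obj ?K" for x
  proof -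
    obtain a e where ae: "x = (a, e)" by (cases x)
    then have a: "a \<in> Obj ?A" using x by (auto simp: idempotent_completion_def)
    then obtain T where T: "finite T" "Hom ?A a a \<subseteq> A.vs.span T" using fin by blast
    show ?thesis
    proof (rule K.ex_simple_decomposition[OF reg split x])
      fix S assume "orthogonal_idempotents ?K x S"
      then have "orthogonal_idempotents ?A a S"
        by (auto simp: orthogonal_idempotents_def ae idempotent_completion_def)
      then show "finite S \<and> card S \<le> card T"
        using A.orthogonal_idempotents_bound[OF a T] by blast
    qed
  qed
  ultimately show ?thesis by (simp add: semisimple_def karoubi_envelope_def)
qed

section \<open>Averaging operators\<close>

lemma sum_fun_apply: "sum F I x = (\<Sum>i\<in>I. F i x)"
  by (induction I rule: infinite_finite_induct) auto

text \<open>No compatibility between different \<open>c\<close> is imposed: the pseudo-inverses that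
  will be averaged are chosen for each \<open>c\<close> separately.\<close>

definition linear_family :: "('o, 'm::ab_group_add) lincat \<Rightarrow> 'o \<Rightarrow> 'o \<Rightarrow> ('o \<Rightarrow> 'm \<Rightarrow> 'm) \<Rightarrow> bool" where
  "linear_family D a x \<Phi> \<longleftrightarrow> (\<forall>c\<in>Obj D.
     (\<forall>u\<in>Hom D c a. \<Phi> c u \<in> Hom D c x) \<and>
     (\<forall>u\<in>Hom D c a. \<forall>v\<in>Hom D c a. \<Phi> c (u + v) = \<Phi> c u + \<Phi> c v) \<and>
     (\<forall>u\<in>Hom D c a. \<forall>r. \<Phi> c (Scale D r u) = Scale D r (\<Phi> c u)))"

definition average_id :: "('o \<Rightarrow> 'o \<Rightarrow> ('o \<Rightarrow> 'm \<Rightarrow> 'm) \<Rightarrow> 'm) \<Rightarrow> 'o \<Rightarrow> 'm" where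
  "average_id av a = av a a (\<lambda>_ u. u)"

text \<open>An averaging operator is a coordinate-free version of a separability idempotent
  \<open>\<Sum>\<^sub>i u\<^sub>i \<otimes> v\<^sub>i\<close>, acting by \<open>\<Phi> \<mapsto> \<Sum>\<^sub>i \<Phi> u\<^sub>i \<cdot> v\<^sub>i\<close>; the two naturality conditions express that it is
  central, and \<open>average_id\<close> is its image under multiplication.\<close>

definition averaging ::
    "('o, 'm::ab_group_add) lincat \<Rightarrow> ('o \<Rightarrow> 'o \<Rightarrow> ('o \<Rightarrow> 'm \<Rightarrow> 'm) \<Rightarrow> 'm) \<Rightarrow> bool" where
  "averaging D av \<longleftrightarrow>
     (\<forall>a\<in>Obj D. \<forall>x\<in>Obj D. \<forall>\<Phi>. linear_family D a x \<Phi> \<longrightarrow> av a x \<Phi> \<in> Hom D a x) \<and>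
     (\<forall>a\<in>Obj D. \<forall>x\<in>Obj D. \<forall>\<Phi> \<Psi>. linear_family D a x \<Phi> \<longrightarrow> linear_family D a x \<Psi> \<longrightarrow>
        av a x (\<lambda>c u. \<Phi> c u + \<Psi> c u) = av a x \<Phi> + av a x \<Psi>) \<and>
     (\<forall>a\<in>Obj D. \<forall>x\<in>Obj D. \<forall>\<Phi> \<Psi>. linear_family D a x \<Phi> \<longrightarrow>
        (\<forall>c\<in>Obj D. \<forall>u\<in>Hom D c a. \<Phi> c u = \<Psi> c u) \<longrightarrow> av a x \<Phi> = av a x \<Psi>) \<and>
     (\<forall>a\<in>Obj D. \<forall>b\<in>Obj D. \<forall>x\<in>Obj D. \<forall>\<Phi>. \<forall>g\<in>Hom D a b. linear_family D b x \<Phi> \<longrightarrow>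
        Comp D a b x (av b x \<Phi>) g = av a x (\<lambda>c u. \<Phi> c (Comp D c a b g u))) \<and>
     (\<forall>a\<in>Obj D. \<forall>x\<in>Obj D. \<forall>y\<in>Obj D. \<forall>\<Phi>. \<forall>h\<in>Hom D x y. linear_family D a x \<Phi> \<longrightarrow>
        Comp D a x y h (av a x \<Phi>) = av a y (\<lambda>c u. Comp D c x y h (\<Phi> c u))) \<and>
     (\<forall>a\<in>Obj D. Comp D a a a (average_id av a) (average_id av a) = average_id av a)"

section \<open>Calculus of averaging operators\<close>

context linear_category
begin

lemma linear_family_id: "a \<in> Obj D \<Longrightarrow> linear_family D a a (\<lambda>_ u. u)"
  by (simp add: linear_family_def)

lemma linear_family_precomp:
  assumes "linear_family D b x \<Phi>" "a \<in> Obj D" "b \<in> Obj D" "g \<in> Hom D a b"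
  shows "linear_family D a x (\<lambda>c u. \<Phi> c (Comp D c a b g u))"
  using assms by (auto simp: linear_family_def Comp_in_Hom Comp_add_right Comp_Scale_right)

lemma linear_family_postcomp:
  assumes "linear_family D a x \<Phi>" "x \<in> Obj D" "y \<in> Obj D" "h \<in> Hom D x y"
  shows "linear_family D a y (\<lambda>c u. Comp D c x y h (\<Phi> c u))"
  using assms by (auto simp: linear_family_def Comp_in_Hom Comp_add_right Comp_Scale_right)

lemma linear_family_sum:
  assumes "\<And>i. i \<in> I \<Longrightarrow> linear_family D a x (\<Phi> i)" "a \<in> Obj D" "x \<in> Obj D"
  shows "linear_family D a x (\<lambda>c u. \<Sum>i\<in>I. \<Phi> i c u)"
  using assms by (auto simp: linear_family_def sum.distrib vs.scale_sum_right intro!: sum_in_Hom)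

lemma linear_family_0:
  assumes "linear_family D a x \<Phi>" "a \<in> Obj D" "c \<in> Obj D"
  shows "\<Phi> c 0 = 0"
  using assms zero_in_Hom[of c a] unfolding linear_family_def by (metis add_cancel_right_right)

lemma linear_family_apply_sum:
  assumes "linear_family D a x \<Phi>" "a \<in> Obj D" "c \<in> Obj D" "\<And>i. i \<in> I \<Longrightarrow> u i \<in> Hom D c a"
  shows "\<Phi> c (\<Sum>i\<in>I. Scale D (r i) (u i)) = (\<Sum>i\<in>I. Scale D (r i) (\<Phi> c (u i)))"
  using assms(4)
proof (induction I rule: infinite_finite_induct)
  case (insert i I)
  have "\<Phi> c (Scale D (r i) (u i) + (\<Sum>i\<in>I. Scale D (r i) (u i))) =
      \<Phi> c (Scale D (r i) (u i)) + \<Phi> c (\<Sum>i\<in>I. Scale D (r i) (u i))"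
    using assms insert.prems Scale_in_Hom[of c a "u i" "r i"] sum_in_Hom[of c a I "\<lambda>i. Scale D (r i) (u i)"]
    unfolding linear_family_def by (simp add: Scale_in_Hom)
  then show ?case using insert assms(1,2,3) unfolding linear_family_def by simp
qed (use linear_family_0[OF assms(1-3)] in auto)

lemma average_in_Hom:
  "\<lbrakk>averaging D av; a \<in> Obj D; x \<in> Obj D; linear_family D a x \<Phi>\<rbrakk> \<Longrightarrow> av a x \<Phi> \<in> Hom D a x"
  unfolding averaging_def by simp

lemma average_add:
  "\<lbrakk>averaging D av; a \<in> Obj D; x \<in> Obj D; linear_family D a x \<Phi>; linear_family D a x \<Psi>\<rbrakk>
    \<Longrightarrow> av a x (\<lambda>c u. \<Phi> c u + \<Psi> c u) = av a x \<Phi> + av a x \<Psi>"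
  unfolding averaging_def by simp

lemma average_cong:
  "\<lbrakk>averaging D av; a \<in> Obj D; x \<in> Obj D; linear_family D a x \<Phi>;
    \<And>c u. c \<in> Obj D \<Longrightarrow> u \<in> Hom D c a \<Longrightarrow> \<Phi> c u = \<Psi> c u\<rbrakk> \<Longrightarrow> av a x \<Phi> = av a x \<Psi>"
  unfolding averaging_def by simp

lemma average_precomp:
  "\<lbrakk>averaging D av; a \<in> Obj D; b \<in> Obj D; x \<in> Obj D; g \<in> Hom D a b; linear_family D b x \<Phi>\<rbrakk>
    \<Longrightarrow> Comp D a b x (av b x \<Phi>) g = av a x (\<lambda>c u. \<Phi> c (Comp D c a b g u))"
  unfolding averaging_def by simp

lemma average_postcomp:
  "\<lbrakk>averaging D av; a \<in> Obj D; x \<in> Obj D; y \<in> Obj D; h \<in> Hom D x y; linear_family D a x \<Phi>\<rbrakk>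
    \<Longrightarrow> Comp D a x y h (av a x \<Phi>) = av a y (\<lambda>c u. Comp D c x y h (\<Phi> c u))"
  unfolding averaging_def by simp

lemma average_sum:
  assumes "averaging D av" "a \<in> Obj D" "x \<in> Obj D" "finite I" "\<And>i. i \<in> I \<Longrightarrow> linear_family D a x (\<Phi> i)"
  shows "av a x (\<lambda>c u. \<Sum>i\<in>I. \<Phi> i c u) = (\<Sum>i\<in>I. av a x (\<Phi> i))"
  using assms(4,5)
proof (induction I)
  case empty
  have "linear_family D a x (\<lambda>_ _. 0)" using assms(2,3) by (simp add: linear_family_def zero_in_Hom)
  from average_add[OF assms(1-3) this this] show ?case by simp
next
  case (insert i I)
  then show ?case
    using average_add[OF assms(1-3), of "\<Phi> i" "\<lambda>c u. \<Sum>i\<in>I. \<Phi> i c u"] assms(2,3)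
    by (simp add: linear_family_sum)
qed

lemma average_id_in_Hom: "\<lbrakk>averaging D av; a \<in> Obj D\<rbrakk> \<Longrightarrow> average_id av a \<in> Hom D a a"
  unfolding average_id_def using average_in_Hom[OF _ _ _ linear_family_id] by blast

lemma average_id_natural:
  assumes "averaging D av" "a \<in> Obj D" "b \<in> Obj D" "g \<in> Hom D a b"
  shows "Comp D a b b (average_id av b) g = Comp D a a b g (average_id av a)"
  using assms average_precomp[OF assms(1-3) assms(3,4) linear_family_id]
    average_postcomp[OF assms(1,2,2) assms(3,4) linear_family_id]
  by (simp add: average_id_def)

text \<open>The end of every averaging argument: where \<open>average_id\<close> is the identity,
  averaging the family of compositions with \<open>g\<close> returns \<open>g\<close>.\<close>

lemma average_by_id:
  assumes "averaging D av" "a \<in> Obj D" "b \<in> Obj D" "g \<in> Hom D a b"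
  shows "av a b (\<lambda>c u. Comp D c a b g u) = Comp D a a b g (average_id av a)"
  using average_postcomp[OF assms(1,2,2) assms(3,4) linear_family_id] assms by (simp add: average_id_def)

lemma average_id_idempotent:
  "\<lbrakk>averaging D av; a \<in> Obj D\<rbrakk> \<Longrightarrow> Comp D a a a (average_id av a) (average_id av a) = average_id av a"
  unfolding averaging_def by simp

text \<open>The join \<open>E1 + E2 (1 - E1)\<close> of two commuting idempotents, lifted to
  averaging operators. Since \<open>1 - E1\<close> commutes with all morphisms, composing with it
  preserves both naturality conditions.\<close>

lemma averaging_join:
  assumes "averaging D av1" "averaging D av2"
  defines "av \<equiv> \<lambda>a x \<Phi>. av1 a x \<Phi> + Comp D a a x (av2 a x \<Phi>) (Ident D a - average_id av1 a)"
  shows "averaging D av"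
    and "\<And>a. a \<in> Obj D \<Longrightarrow> average_id av a = average_id av1 a + Comp D a a a (average_id av2 a) (Ident D a - average_id av1 a)"
proof -
  show E: "a \<in> Obj D \<Longrightarrow> average_id av a = average_id av1 a + Comp D a a a (average_id av2 a) (Ident D a - average_id av1 a)" for a
    by (simp add: av_def average_id_def)
  have F: "Ident D a - average_id av1 a \<in> Hom D a a" if "a \<in> Obj D" for a
    using that assms(1) by (intro Hom_intros average_id_in_Hom)
  have FN: "Comp D a b b (Ident D b - average_id av1 b) g = Comp D a a b g (Ident D a - average_id av1 a)"
    if "a \<in> Obj D" "b \<in> Obj D" "g \<in> Hom D a b" for a b g
    using that assms(1) by (simp add: Comp_diff_left Comp_diff_right average_id_in_Hom Hom_intros
        Comp_Ident_left Comp_Ident_right average_id_natural)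
  show "averaging D av"
    unfolding averaging_def
  proof (intro conjI ballI allI impI)
    fix a x \<Phi> assume "a \<in> Obj D" "x \<in> Obj D" "linear_family D a x \<Phi>"
    then show "av a x \<Phi> \<in> Hom D a x"
      unfolding av_def by (intro add_in_Hom Comp_in_Hom F average_in_Hom[OF assms(1)] average_in_Hom[OF assms(2)])
  next
    fix a x \<Phi> \<Psi> assume "a \<in> Obj D" "x \<in> Obj D" "linear_family D a x \<Phi>" "linear_family D a x \<Psi>"
    then show "av a x (\<lambda>c u. \<Phi> c u + \<Psi> c u) = av a x \<Phi> + av a x \<Psi>"
      using assms(1,2) by (simp add: av_def average_add Comp_add_left F average_in_Hom)
  next
    fix a x \<Phi> \<Psi> assume A: "a \<in> Obj D" "x \<in> Obj D" "linear_family D a x \<Phi>"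
      "\<forall>c\<in>Obj D. \<forall>u\<in>Hom D c a. \<Phi> c u = \<Psi> c u"
    then show "av a x \<Phi> = av a x \<Psi>"
      using average_cong[OF assms(1) A(1-3), of \<Psi>] average_cong[OF assms(2) A(1-3), of \<Psi>] by (simp add: av_def)
  next
    fix a b x \<Phi> g assume A: "a \<in> Obj D" "b \<in> Obj D" "x \<in> Obj D" "g \<in> Hom D a b" "linear_family D b x \<Phi>"
    have "Comp D a b x (Comp D b b x (av2 b x \<Phi>) (Ident D b - average_id av1 b)) g =
        Comp D a b x (av2 b x \<Phi>) (Comp D a b b (Ident D b - average_id av1 b) g)"
      using A by (intro Comp_assoc_right average_in_Hom[OF assms(2)] F)
    also have "\<dots> = Comp D a a x (Comp D a b x (av2 b x \<Phi>) g) (Ident D a - average_id av1 a)"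
      unfolding FN[OF A(1,2,4)] using A by (intro Comp_assoc average_in_Hom[OF assms(2)] F)
    finally show "Comp D a b x (av b x \<Phi>) g = av a x (\<lambda>c u. \<Phi> c (Comp D c a b g u))"
      unfolding av_def average_precomp[OF assms(1) A, symmetric] average_precomp[OF assms(2) A, symmetric]
      using A by (subst Comp_add_left) (auto intro!: Comp_in_Hom F average_in_Hom[OF assms(1)] average_in_Hom[OF assms(2)])
  next
    fix a x y \<Phi> h assume A: "a \<in> Obj D" "x \<in> Obj D" "y \<in> Obj D" "h \<in> Hom D x y" "linear_family D a x \<Phi>"
    have "Comp D a x y h (Comp D a a x (av2 a x \<Phi>) (Ident D a - average_id av1 a)) =
        Comp D a a y (Comp D a x y h (av2 a x \<Phi>)) (Ident D a - average_id av1 a)"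
      using A by (intro Comp_assoc average_in_Hom[OF assms(2)] F)
    then show "Comp D a x y h (av a x \<Phi>) = av a y (\<lambda>c u. Comp D c x y h (\<Phi> c u))"
      unfolding av_def average_postcomp[OF assms(1) A, symmetric] average_postcomp[OF assms(2) A, symmetric]
      using A by (subst Comp_add_right) (auto intro!: Comp_in_Hom F average_in_Hom[OF assms(1)] average_in_Hom[OF assms(2)])
  next
    fix a assume a[simp]: "a \<in> Obj D"
    let ?E1 = "average_id av1 a" and ?E2 = "average_id av2 a"
    have H[simp]: "?E1 \<in> Hom D a a" "?E2 \<in> Hom D a a" using assms(1,2) by (simp_all add: average_id_in_Hom)
    have idem[simp]: "Comp D a a a ?E1 ?E1 = ?E1" "Comp D a a a ?E2 ?E2 = ?E2"
      using assms(1,2) by (simp_all add: average_id_idempotent)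
    have comm[simp]: "Comp D a a a ?E1 ?E2 = Comp D a a a ?E2 ?E1"
      using average_id_natural[OF assms(1), of a a ?E2] by simp
    have [simp]: "Comp D a a a ?E1 (Comp D a a a ?E2 ?E1) = Comp D a a a ?E2 ?E1"
      by (metis Comp_assoc a H idem(1) comm)
    have [simp]: "Comp D a a a ?E2 (Comp D a a a ?E2 ?E1) = Comp D a a a ?E2 ?E1"
      by (metis Comp_assoc a H idem(2))
    show "Comp D a a a (average_id av a) (average_id av a) = average_id av a"
      by (simp add: E Hom_intros Comp_add_left Comp_add_right Comp_diff_left Comp_diff_right
          Comp_Ident_left Comp_Ident_right Comp_assoc_right)
  qed
qed

text \<open>The morphism is bundled with its source and target so that one finite set can contain
  morphisms between different objects.\<close>

definition absorbs :: "('o \<Rightarrow> 'o \<Rightarrow> ('o \<Rightarrow> 'm \<Rightarrow> 'm) \<Rightarrow> 'm) \<Rightarrow> 'o \<times> 'o \<times> 'm \<Rightarrow> bool" where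
  "absorbs av = (\<lambda>(a, b, f). Comp D a b b (average_id av b) f = f)"

text \<open>With \<open>E = E1 + E2 (1 - E1)\<close>, a morphism fixed by \<open>E1\<close> is
  killed by \<open>1 - E1\<close> and so fixed by \<open>E\<close>; for a morphism fixed by
  \<open>E2\<close> the terms \<open>E1 f\<close> and \<open>E2 E1 f = E1 E2 f\<close>
  cancel.\<close>

lemma ex_averaging_absorbs_both:
  assumes "averaging D av1" "averaging D av2"
  shows "\<exists>av. averaging D av \<and> (\<forall>a\<in>Obj D. \<forall>b\<in>Obj D. \<forall>f\<in>Hom D a b.
    absorbs av1 (a, b, f) \<or> absorbs av2 (a, b, f) \<longrightarrow> absorbs av (a, b, f))"
proof (intro exI conjI ballI impI)
  fix a b f assume [simp]: "a \<in> Obj D" "b \<in> Obj D" "f \<in> Hom D a b"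
  let ?E1 = "average_id av1 b" and ?E2 = "average_id av2 b"
  have [simp]: "?E1 \<in> Hom D b b" "?E2 \<in> Hom D b b" using assms by (simp_all add: average_id_in_Hom)
  note [simp] = Hom_intros Comp_add_left Comp_diff_left Comp_diff_right Comp_Ident_left Comp_Ident_right Comp_assoc_right Comp_0_right
  assume "absorbs av1 (a, b, f) \<or> absorbs av2 (a, b, f)"
  moreover have "Comp D b b b ?E2 ?E1 = Comp D b b b ?E1 ?E2"
    using average_id_natural[OF assms(2), of b b ?E1] by simp
  then have "Comp D a b b ?E2 (Comp D a b b ?E1 f) = Comp D a b b ?E1 (Comp D a b b ?E2 f)"
    by (metis Comp_assoc \<open>a \<in> Obj D\<close> \<open>b \<in> Obj D\<close> \<open>f \<in> Hom D a b\<close> \<open>?E1 \<in> Hom D b b\<close> \<open>?E2 \<in> Hom D b b\<close>)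
  ultimately show "absorbs (\<lambda>a x \<Phi>. av1 a x \<Phi> + Comp D a a x (av2 a x \<Phi>) (Ident D a - average_id av1 a)) (a, b, f)"
    unfolding absorbs_def by (auto simp: averaging_join(2)[OF assms])
qed (rule averaging_join[OF assms])

lemma ex_averaging_absorbs_finite:
  assumes "finite X" "\<And>a b f. (a, b, f) \<in> X \<Longrightarrow> a \<in> Obj D \<and> b \<in> Obj D \<and> f \<in> Hom D a b"
    and "\<And>y. y \<in> X \<Longrightarrow> \<exists>av. averaging D av \<and> absorbs av y"
  shows "\<exists>av. averaging D av \<and> (\<forall>y\<in>X. absorbs av y)"
  using assms
proof (induction X)
  case empty
  \<comment> \<open>The zero operator is the neutral element of the join.\<close>
  have "averaging D (\<lambda>_ _ _. 0)"
    by (auto simp: averaging_def average_id_def zero_in_Hom Comp_0_left Comp_0_right)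
  then show ?case by blast
next
  case (insert y X)
  obtain av1 where av1: "averaging D av1" "absorbs av1 y" using insert.prems(2)[of y] by blast
  have "\<exists>av. averaging D av \<and> (\<forall>y\<in>X. absorbs av y)"
    using insert.prems by (intro insert.IH) auto
  then obtain av2 where av2: "averaging D av2" "\<forall>y\<in>X. absorbs av2 y" by blast
  obtain av where av: "averaging D av" "\<forall>a\<in>Obj D. \<forall>b\<in>Obj D. \<forall>f\<in>Hom D a b.
    absorbs av1 (a, b, f) \<or> absorbs av2 (a, b, f) \<longrightarrow> absorbs av (a, b, f)"
    using ex_averaging_absorbs_both[OF av1(1) av2(1)] by blast
  have "absorbs av z" if "z \<in> insert y X" for z
  proof -
    obtain a b f where "z = (a, b, f)" by (cases z)
    then show ?thesis using insert.prems(1)[of a b f] that av(2) av1(2) av2(2) by auto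
  qed
  then show ?case using av(1) by blast
qed

text \<open>A linear section is prescribed by preimages on a basis of the image. It is extended to
  the whole ambient space with range in the span of these preimages, so its values stay in
  \<open>Hom D x a\<close> also off the image.\<close>

lemma ex_linear_pseudo_inverse:
  assumes "x \<in> Obj D" "a \<in> Obj D" "b \<in> Obj D" "f \<in> Hom D a b"
  shows "\<exists>S. Vector_Spaces.linear (Scale D) (Scale D) S \<and> (\<forall>v. S v \<in> Hom D x a) \<and>
    (\<forall>u\<in>Hom D x a. Comp D x a b f (S (Comp D x a b f u)) = Comp D x a b f u)"
proof -
  interpret vsp: vector_space_pair "Scale D" "Scale D" by unfold_locales
  let ?W = "Comp D x a b f ` Hom D x a"
  obtain B where B: "B \<subseteq> ?W" "vs.independent B" "?W \<subseteq> vs.span B"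
    using vs.maximal_independent_subset by blast
  then have "\<forall>w\<in>B. \<exists>u. u \<in> Hom D x a \<and> Comp D x a b f u = w" by auto
  then obtain h where h: "\<And>w. w \<in> B \<Longrightarrow> h w \<in> Hom D x a" "\<And>w. w \<in> B \<Longrightarrow> Comp D x a b f (h w) = w"
    by metis
  obtain S where S: "Vector_Spaces.linear (Scale D) (Scale D) S" "\<And>w. w \<in> B \<Longrightarrow> S w = h w" "range S = vs.span (h ` B)"
    using vsp.linear_independent_extend_subspace[OF B(2), of h] by blast
  interpret S: Vector_Spaces.linear "Scale D" "Scale D" S by (rule S(1))
  have "vs.span (h ` B) \<subseteq> Hom D x a"
    using h(1) assms by (intro vs.span_minimal Hom_subspace) auto
  then have SH: "S v \<in> Hom D x a" for v using S(3) by auto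
  have "Comp D x a b f (S w) = w" if "w \<in> vs.span B" for w
    using that
  proof (induction rule: vs.span_induct)
    case base
    show ?case
      unfolding vs.subspace_def using assms SH
      by (auto simp: S.add S.scale S.zero Comp_0_right Comp_add_right Comp_Scale_right)
  qed (use S(2) h(2) in simp)
  then show ?thesis using S(1) SH B(3) by (intro exI[of _ S]) auto
qed

end

text \<open>The matrix entries of linear pseudo-inverses of composition with \<open>f\<close> are
  averaged into morphisms forming \<open>g\<close>. By the two naturality conditions the outer
  factors of \<open>f g f\<close> can be moved inside the average. There the defining equation of
  the pseudo-inverses turns the family into composition with an entry of \<open>f\<close>, and this
  averages to that entry.\<close>

theorem regular_additive_completion:
  assumes "linear_category D"
    and avg: "\<And>a. a \<in> Obj D \<Longrightarrow> \<exists>av. averaging D av \<and> average_id av a = Ident D a"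
  shows "von_neumann_regular (additive_completion D)"
  unfolding von_neumann_regular_def
proof (intro ballI)
  interpret linear_category D by fact
  interpret A: linear_category "additive_completion D"
    by (rule linear_category_additive_completion) fact
  fix xs ys f assume xs: "xs \<in> Obj (additive_completion D)" and ys: "ys \<in> Obj (additive_completion D)"
    and f: "f \<in> Hom (additive_completion D) xs ys"
  have obj[simp]: "xs ! k \<in> Obj D" if "k < length xs" for k
    using that xs by (auto simp: additive_completion_def)
  have obj'[simp]: "ys ! k \<in> Obj D" if "k < length ys" for k
    using that ys by (auto simp: additive_completion_def)
  have fH[simp]: "f i j \<in> Hom D (xs ! j) (ys ! i)" if "i < length ys" "j < length xs" for i j
    using that f by (auto simp: additive_completion_def)
  \<comment> \<open>One operator has to serve all entries of \<open>xs\<close> at once, so those for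
    the single entries are joined.\<close>
  have "\<exists>av. averaging D av \<and> (\<forall>y\<in>(\<lambda>a. (a, a, Ident D a)) ` set xs. absorbs av y)"
  proof (rule ex_averaging_absorbs_finite)
    fix y assume "y \<in> (\<lambda>a. (a, a, Ident D a)) ` set xs"
    then obtain a where a: "a \<in> Obj D" "y = (a, a, Ident D a)" using xs by (auto simp: additive_completion_def)
    then obtain av where "averaging D av" "average_id av a = Ident D a" using avg by blast
    then show "\<exists>av. averaging D av \<and> absorbs av y"
      using a by (intro exI[of _ av]) (simp add: absorbs_def Comp_Ident_left Ident_in_Hom)
  qed (use xs in \<open>auto simp: additive_completion_def Ident_in_Hom\<close>)
  then obtain av where av: "averaging D av" and "\<And>a. a \<in> set xs \<Longrightarrow> absorbs av (a, a, Ident D a)" by blast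
  then have av_id: "average_id av (xs ! j) = Ident D (xs ! j)" if "j < length xs" for j
    using that \<open>\<And>a. a \<in> set xs \<Longrightarrow> absorbs av (a, a, Ident D a)\<close>[OF nth_mem[OF that]]
    by (simp add: absorbs_def Comp_Ident_right average_id_in_Hom[OF av])
  have c: "[c] \<in> Obj (additive_completion D)" if "c \<in> Obj D" for c
    using that by (simp add: additive_completion_def)
  have "\<forall>c\<in>Obj D. \<exists>S. Vector_Spaces.linear (Scale (additive_completion D)) (Scale (additive_completion D)) S \<and>
     (\<forall>v. S v \<in> Hom (additive_completion D) [c] xs) \<and>
     (\<forall>u\<in>Hom (additive_completion D) [c] xs. Comp (additive_completion D) [c] xs ys f
        (S (Comp (additive_completion D) [c] xs ys f u)) = Comp (additive_completion D) [c] xs ys f u)"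
    using A.ex_linear_pseudo_inverse[OF c xs ys f] by blast
  then obtain S where S: "\<And>c. c \<in> Obj D \<Longrightarrow> Vector_Spaces.linear (Scale (additive_completion D)) (Scale (additive_completion D)) (S c)"
    and SH: "\<And>c v. c \<in> Obj D \<Longrightarrow> S c v \<in> Hom (additive_completion D) [c] xs"
    and fSf: "\<And>c u. c \<in> Obj D \<Longrightarrow> u \<in> Hom (additive_completion D) [c] xs \<Longrightarrow> Comp (additive_completion D) [c] xs ys f
        (S c (Comp (additive_completion D) [c] xs ys f u)) = Comp (additive_completion D) [c] xs ys f u"
    by metis
  \<comment> \<open>\<open>col l u\<close> is the column with the single entry \<open>u\<close> in
    row \<open>l\<close>. Hence \<open>G m l c\<close> is the entry of the linear map
    \<open>S c\<close> leading from summand \<open>l\<close> of \<open>ys\<close> to summand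
    \<open>m\<close> of \<open>xs\<close>.\<close>
  define col :: "nat \<Rightarrow> 'b \<Rightarrow> nat \<Rightarrow> nat \<Rightarrow> 'b" where "col l u = (\<lambda>i j. if i = l \<and> j = 0 then u else 0)" for l u
  define G where "G m l c u = S c (col l u) m 0" for m l c u
  have G: "linear_family D (ys ! l) (xs ! m) (G m l)" if "l < length ys" "m < length xs" for l m
    unfolding linear_family_def
  proof (intro ballI conjI allI)
    fix c u v r assume c: "c \<in> Obj D"
    interpret S: Vector_Spaces.linear "Scale (additive_completion D)" "Scale (additive_completion D)" "S c"
      using S[OF c] .
    show "G m l c u \<in> Hom D c (xs ! m)"
      using SH[OF c, of "col l u"] that
      by (simp add: G_def additive_completion_def, elim allE[of _ m] allE[of _ 0]) simp
    have "col l (u + v) = col l u + col l v" by (auto simp: col_def fun_eq_iff)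
    then show "G m l c (u + v) = G m l c u + G m l c v" by (simp add: G_def S.add)
    have "col l (Scale D r u) = Scale (additive_completion D) r (col l u)"
      by (auto simp: col_def fun_eq_iff additive_completion_def)
    then show "G m l c (Scale D r u) = Scale D r (G m l c u)" by (simp add: G_def S.scale) (simp add: additive_completion_def)
  qed
  define g where "g m l = (if m < length xs \<and> l < length ys then av (ys ! l) (xs ! m) (G m l) else 0)" for m l
  have gH: "g \<in> Hom (additive_completion D) ys xs"
    using average_in_Hom[OF av _ _ G] by (auto simp: additive_completion_def g_def)
  \<comment> \<open>The equation \<open>f (S (f v)) = f v\<close> for a column \<open>v\<close>
    concentrated in row \<open>j\<close>, read off in row \<open>i\<close>.\<close>
  have key: "(\<Sum>m<length xs. \<Sum>l<length ys. Comp D c (xs ! m) (ys ! i) (f i m)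
      (G m l c (Comp D c (xs ! j) (ys ! l) (f l j) u))) = Comp D c (xs ! j) (ys ! i) (f i j) u"
    if c: "c \<in> Obj D" and u: "u \<in> Hom D c (xs ! j)" and ij: "i < length ys" "j < length xs" for c u i j
  proof -
    interpret S: Vector_Spaces.linear "Scale (additive_completion D)" "Scale (additive_completion D)" "S c"
      using S[OF c] .
    have col: "col j u \<in> Hom (additive_completion D) [c] xs"
      using c u ij by (auto simp: additive_completion_def col_def zero_in_Hom)
    have F: "Comp (additive_completion D) [c] xs ys f (col j u) = (\<Sum>l<length ys. col l (Comp D c (xs ! j) (ys ! l) (f l j) u))"
    proof (intro ext)
      fix k n
      have "(\<Sum>p<length xs. Comp D c (xs ! p) (ys ! k) (f k p) (if p = j then u else 0)) =
         (\<Sum>p<length xs. if p = j then Comp D c (xs ! j) (ys ! k) (f k j) u else 0)" if "k < length ys"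
        using that c by (intro sum.cong) (auto simp: Comp_0_right)
      then show "Comp (additive_completion D) [c] xs ys f (col j u) k n =
          (\<Sum>l<length ys. col l (Comp D c (xs ! j) (ys ! l) (f l j) u)) k n"
        using ij by (cases "n = 0") (auto simp: additive_completion_def sum_fun_apply col_def)
    qed
    have "Comp D c (xs ! j) (ys ! i) (f i j) u = Comp (additive_completion D) [c] xs ys f (col j u) i 0"
      unfolding F using ij by (simp add: sum_fun_apply col_def)
    also have "\<dots> = Comp (additive_completion D) [c] xs ys f (S c (Comp (additive_completion D) [c] xs ys f (col j u))) i 0"
      using fSf[OF c col] by simp
    also have "\<dots> = (\<Sum>m<length xs. Comp D c (xs ! m) (ys ! i) (f i m) (\<Sum>l<length ys. G m l c (Comp D c (xs ! j) (ys ! l) (f l j) u)))"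
      unfolding F S.sum using ij by (simp add: additive_completion_def G_def sum_fun_apply)
    also have "\<dots> = (\<Sum>m<length xs. \<Sum>l<length ys. Comp D c (xs ! m) (ys ! i) (f i m)
      (G m l c (Comp D c (xs ! j) (ys ! l) (f l j) u)))"
    proof (intro sum.cong refl Comp_sum_right)
      fix m l assume "m \<in> {..<length xs}" "l \<in> {..<length ys}"
      then show "G m l c (Comp D c (xs ! j) (ys ! l) (f l j) u) \<in> Hom D c (xs ! m)"
        using G[of l m] c u ij unfolding linear_family_def by (simp add: Comp_in_Hom)
    qed (use c ij in auto)
    finally show ?thesis by simp
  qed
  have "Comp (additive_completion D) xs xs ys f (Comp (additive_completion D) xs ys xs g f) = f"
  proof (intro ext)
    fix i j
    show "Comp (additive_completion D) xs xs ys f (Comp (additive_completion D) xs ys xs g f) i j = f i j"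
    proof (cases "i < length ys \<and> j < length xs")
      case True
      then have i[simp]: "i < length ys" and j[simp]: "j < length xs" by auto
      let ?H = "\<lambda>m l c u. Comp D c (xs ! m) (ys ! i) (f i m) (G m l c (Comp D c (xs ! j) (ys ! l) (f l j) u))"
      have pre: "linear_family D (xs ! j) (xs ! m) (\<lambda>c u. G m l c (Comp D c (xs ! j) (ys ! l) (f l j) u))"
        if "m < length xs" "l < length ys" for m l
        using that by (intro linear_family_precomp[of "ys ! l"] G) auto
      have H: "linear_family D (xs ! j) (ys ! i) (?H m l)" if "m < length xs" "l < length ys" for m l
        using that by (intro linear_family_postcomp pre) auto
      have avH: "Comp D (xs ! j) (xs ! m) (ys ! i) (f i m) (Comp D (xs ! j) (ys ! l) (xs ! m) (g m l) (f l j)) =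
          av (xs ! j) (ys ! i) (?H m l)" if "m < length xs" "l < length ys" for m l
        using that average_precomp[OF av _ _ _ _ G, of "xs ! j" l m "f l j"] average_postcomp[OF av _ _ _ _ pre]
        by (simp add: g_def)
      have "(\<Sum>m<length xs. Comp D (xs ! j) (xs ! m) (ys ! i) (f i m)
          (\<Sum>l<length ys. Comp D (xs ! j) (ys ! l) (xs ! m) (g m l) (f l j))) =
          (\<Sum>m<length xs. \<Sum>l<length ys. Comp D (xs ! j) (xs ! m) (ys ! i) (f i m)
            (Comp D (xs ! j) (ys ! l) (xs ! m) (g m l) (f l j)))"
        using gH by (intro sum.cong refl Comp_sum_right Comp_in_Hom) (auto simp: additive_completion_def)
      also have "\<dots> = (\<Sum>m<length xs. \<Sum>l<length ys. av (xs ! j) (ys ! i) (?H m l))"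
        by (intro sum.cong refl avH) auto
      also have "\<dots> = (\<Sum>m<length xs. av (xs ! j) (ys ! i) (\<lambda>c u. \<Sum>l<length ys. ?H m l c u))"
        using H by (intro sum.cong refl average_sum[symmetric] av) auto
      also have "\<dots> = av (xs ! j) (ys ! i) (\<lambda>c u. \<Sum>m<length xs. \<Sum>l<length ys. ?H m l c u)"
        using H by (intro average_sum[symmetric] av linear_family_sum) auto
      also have "\<dots> = av (xs ! j) (ys ! i) (\<lambda>c u. Comp D c (xs ! j) (ys ! i) (f i j) u)"
        using H by (intro average_cong[OF av] linear_family_sum key) auto
      also have "\<dots> = f i j"
        by (simp add: average_by_id[OF av] av_id Comp_Ident_right)
      finally show ?thesis by (simp add: additive_completion_def)
    next
      case False
      then show ?thesis using f by (auto simp: additive_completion_def)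
    qed
  qed
  then show "\<exists>g\<in>Hom (additive_completion D) ys xs.
      Comp (additive_completion D) xs xs ys f (Comp (additive_completion D) xs ys xs g f) = f"
    using gH by blast
qed

section \<open>Dual bases and trace forms\<close>

text \<open>A dual system of maximal length is a pair of dual bases: after subtracting the
  components along it, the remainders pair to 0 by maximality and vanish by nondegeneracy. The form
  is required to be bilinear on \<open>M\<close> and \<open>N\<close> only, because composition is
  controlled only on the morphism spaces.\<close>

lemma (in vector_space) ex_dual_bases:
  fixes \<beta> :: "'b \<Rightarrow> 'b \<Rightarrow> 'a"
  assumes M: "subspace M" and N: "subspace N" and T: "finite T" "M \<subseteq> span T"
    and add_left: "\<And>m m' n. \<lbrakk>m \<in> M; m' \<in> M; n \<in> N\<rbrakk> \<Longrightarrow> \<beta> (m + m') n = \<beta> m n + \<beta> m' n"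
    and scale_left: "\<And>r m n. \<lbrakk>m \<in> M; n \<in> N\<rbrakk> \<Longrightarrow> \<beta> (scale r m) n = r * \<beta> m n"
    and add_right: "\<And>m n n'. \<lbrakk>m \<in> M; n \<in> N; n' \<in> N\<rbrakk> \<Longrightarrow> \<beta> m (n + n') = \<beta> m n + \<beta> m n'"
    and scale_right: "\<And>r m n. \<lbrakk>m \<in> M; n \<in> N\<rbrakk> \<Longrightarrow> \<beta> m (scale r n) = r * \<beta> m n"
    and nondeg_left: "\<And>m. \<lbrakk>m \<in> M; m \<noteq> 0\<rbrakk> \<Longrightarrow> \<exists>n\<in>N. \<beta> m n \<noteq> 0"
    and nondeg_right: "\<And>n. \<lbrakk>n \<in> N; n \<noteq> 0\<rbrakk> \<Longrightarrow> \<exists>m\<in>M. \<beta> m n \<noteq> 0"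
  shows "\<exists>(k::nat) b b'. (\<forall>i<k. b i \<in> M \<and> b' i \<in> N) \<and>
    (\<forall>m\<in>M. m = (\<Sum>i<k. scale (\<beta> m (b' i)) (b i))) \<and>
    (\<forall>n\<in>N. n = (\<Sum>i<k. scale (\<beta> (b i) n) (b' i)))"
proof -
  have M_sum: "(\<Sum>i\<in>I. scale (r i) (m i)) \<in> M" if "\<And>i. i \<in> I \<Longrightarrow> m i \<in> M" for I :: "'i set" and r m
    using that by (intro subspace_sum[OF M] subspace_scale[OF M]) auto
  have N_sum: "(\<Sum>i\<in>I. scale (r i) (m i)) \<in> N" if "\<And>i. i \<in> I \<Longrightarrow> m i \<in> N" for I :: "'i set" and r m
    using that by (intro subspace_sum[OF N] subspace_scale[OF N]) auto
  have \<beta>0: "\<beta> 0 n = 0" if "n \<in> N" for n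
    using scale_left[OF subspace_0[OF M] that, of 0] by simp
  have \<beta>0': "\<beta> m 0 = 0" if "m \<in> M" for m
    using scale_right[OF that subspace_0[OF N], of 0] by simp
  have sum_left: "\<beta> (\<Sum>i\<in>I. scale (r i) (m i)) n = (\<Sum>i\<in>I. r i * \<beta> (m i) n)"
    if "n \<in> N" "\<And>i. i \<in> I \<Longrightarrow> m i \<in> M" for I :: "'i set" and r m n
    using that(2)
  proof (induction I rule: infinite_finite_induct)
    case (insert i I)
    then show ?case using that(1) M_sum[of I m r] subspace_scale[OF M] by (simp add: add_left scale_left)
  qed (use \<beta>0 that(1) in auto)
  have sum_right: "\<beta> m (\<Sum>i\<in>I. scale (r i) (n i)) = (\<Sum>i\<in>I. r i * \<beta> m (n i))"
    if "m \<in> M" "\<And>i. i \<in> I \<Longrightarrow> n i \<in> N" for I :: "'i set" and r m n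
    using that(2)
  proof (induction I rule: infinite_finite_induct)
    case (insert i I)
    then show ?case using that(1) N_sum[of I n r] subspace_scale[OF N] by (simp add: add_right scale_right)
  qed (use \<beta>0' that(1) in auto)
  define dual where "dual k b b' \<longleftrightarrow> (\<forall>i<k. b i \<in> M \<and> b' i \<in> N) \<and>
    (\<forall>i<k. \<forall>j<k. \<beta> (b i) (b' j) = (if i = j then 1 else 0))" for k :: nat and b b'
  \<comment> \<open>The first halves of a dual system are linearly independent, since pairing a
    relation with \<open>b' j\<close> isolates the coefficient of \<open>b j\<close>; so the lengths
    are bounded and a maximum exists.\<close>
  have bound: "k \<le> card T" if d: "dual k b b'" for k b b'
  proof -
    have inj: "inj_on b {..<k}"
      using d unfolding dual_def inj_on_def by (metis lessThan_iff zero_neq_one)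
    have "independent (b ` {..<k})"
      unfolding independent_explicit_module
    proof (intro allI impI)
      fix t u v assume t: "finite t" "t \<subseteq> b ` {..<k}" "(\<Sum>v\<in>t. scale (u v) v) = 0" "v \<in> t"
      then obtain j where j: "j < k" "v = b j" by auto
      have "0 = \<beta> (\<Sum>v\<in>t. scale (u v) v) (b' j)" using t(3) j d \<beta>0 by (simp add: dual_def)
      also have "\<dots> = (\<Sum>w\<in>t. u w * \<beta> w (b' j))"
        using t j d by (intro sum_left) (auto simp: dual_def)
      also have "\<dots> = (\<Sum>w\<in>t. if w = v then u v else 0)"
      proof (intro sum.cong refl)
        fix w assume "w \<in> t"
        then obtain i where "i < k" "w = b i" using t by auto
        then show "u w * \<beta> w (b' j) = (if w = v then u v else 0)"
          using d j inj_onD[OF inj, of i j] by (auto simp: dual_def)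
      qed
      finally show "u v = 0" using t by simp
    qed
    moreover have "b ` {..<k} \<subseteq> span T" using d T(2) by (auto simp: dual_def)
    ultimately have "card (b ` {..<k}) \<le> card T" using independent_span_bound[OF T(1)] by blast
    then show ?thesis by (simp add: card_image[OF inj])
  qed
  have "dual 0 b b'" for b b' by (simp add: dual_def)
  then have "\<exists>k. (\<exists>b b'. dual k b b') \<and> (\<forall>k'. (\<exists>b b'. dual k' b b') \<longrightarrow> k' \<le> k)"
    using bound by (intro Nat.ex_has_greatest_nat[of _ 0 "card T"]) blast+
  then obtain k b b' where d: "dual k b b'" and max: "\<And>k' c c'. dual k' c c' \<Longrightarrow> k' \<le> k" by blast
  \<comment> \<open>Otherwise \<open>m\<close> together with \<open>n\<close>, rescaled to pair to 1
    with \<open>m\<close>, would lengthen the system.\<close>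
  have maximal: "\<beta> m n = 0" if "m \<in> M" "n \<in> N" "\<And>i. i < k \<Longrightarrow> \<beta> m (b' i) = 0" "\<And>i. i < k \<Longrightarrow> \<beta> (b i) n = 0" for m n
  proof (rule ccontr)
    assume "\<beta> m n \<noteq> 0"
    let ?n = "scale (1 / \<beta> m n) n"
    have "dual (Suc k) (b(k := m)) (b'(k := ?n))"
      using d that \<open>\<beta> m n \<noteq> 0\<close> subspace_scale[OF N]
      by (auto simp: dual_def less_Suc_eq scale_right)
    then show False using max by fastforce
  qed
  define pM where "pM m = m - (\<Sum>i<k. scale (\<beta> m (b' i)) (b i))" for m
  define pN where "pN n = n - (\<Sum>i<k. scale (\<beta> (b i) n) (b' i))" for n
  have b: "b i \<in> M" "b' i \<in> N" if "i < k" for i using d that by (auto simp: dual_def)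
  have diff_left: "\<beta> (m - m') n = \<beta> m n - \<beta> m' n" if "m \<in> M" "m' \<in> M" "n \<in> N" for m m' n
    using add_left[of "m - m'" m' n] that subspace_diff[OF M] by simp
  have diff_right: "\<beta> m (n - n') = \<beta> m n - \<beta> m n'" if "m \<in> M" "n \<in> N" "n' \<in> N" for m n n'
    using add_right[of m "n - n'" n'] that subspace_diff[OF N] by simp
  have pM: "pM m \<in> M" "\<And>j. j < k \<Longrightarrow> \<beta> (pM m) (b' j) = 0" if "m \<in> M" for m
  proof -
    show "pM m \<in> M" unfolding pM_def using that b by (intro subspace_diff[OF M] M_sum) auto
    fix j assume "j < k"
    have "\<beta> (pM m) (b' j) = \<beta> m (b' j) - \<beta> (\<Sum>i<k. scale (\<beta> m (b' i)) (b i)) (b' j)"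
      unfolding pM_def using that b \<open>j < k\<close> by (intro diff_left M_sum) auto
    also have "\<beta> (\<Sum>i<k. scale (\<beta> m (b' i)) (b i)) (b' j) = (\<Sum>i<k. \<beta> m (b' i) * \<beta> (b i) (b' j))"
      using b \<open>j < k\<close> by (intro sum_left) auto
    also have "\<dots> = (\<Sum>i<k. if i = j then \<beta> m (b' j) else 0)"
      using d \<open>j < k\<close> by (intro sum.cong) (auto simp: dual_def)
    finally show "\<beta> (pM m) (b' j) = 0" using \<open>j < k\<close> by simp
  qed
  have pN: "pN n \<in> N" "\<And>j. j < k \<Longrightarrow> \<beta> (b j) (pN n) = 0" if "n \<in> N" for n
  proof -
    show "pN n \<in> N" unfolding pN_def using that b by (intro subspace_diff[OF N] N_sum) auto
    fix j assume "j < k"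
    have "\<beta> (b j) (pN n) = \<beta> (b j) n - \<beta> (b j) (\<Sum>i<k. scale (\<beta> (b i) n) (b' i))"
      unfolding pN_def using that b \<open>j < k\<close> by (intro diff_right N_sum) auto
    also have "\<beta> (b j) (\<Sum>i<k. scale (\<beta> (b i) n) (b' i)) = (\<Sum>i<k. \<beta> (b i) n * \<beta> (b j) (b' i))"
      using b \<open>j < k\<close> by (intro sum_right) auto
    also have "\<dots> = (\<Sum>i<k. if i = j then \<beta> (b j) n else 0)"
      using d \<open>j < k\<close> by (intro sum.cong) (auto simp: dual_def)
    finally show "\<beta> (b j) (pN n) = 0" using \<open>j < k\<close> by simp
  qed
  have "\<beta> (pM m) (pN n) = 0" if "m \<in> M" "n \<in> N" for m n
    by (rule maximal[OF pM(1)[OF that(1)] pN(1)[OF that(2)] pM(2)[OF that(1)] pN(2)[OF that(2)]])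
  moreover have "\<beta> (pM m) (pN n) = \<beta> (pM m) n" if "m \<in> M" "n \<in> N" for m n
  proof -
    have "\<beta> (pM m) (\<Sum>i<k. scale (\<beta> (b i) n) (b' i)) = (\<Sum>i<k. \<beta> (b i) n * \<beta> (pM m) (b' i))"
      using b pM(1)[OF that(1)] by (intro sum_right) auto
    also have "\<dots> = 0" using pM(2)[OF that(1)] by (intro sum.neutral) simp
    finally show ?thesis
      using pM(1)[OF that(1)] that(2) b unfolding pN_def[of n] by (subst diff_right) (auto intro!: N_sum)
  qed
  moreover have "\<beta> (pM m) (pN n) = \<beta> m (pN n)" if "m \<in> M" "n \<in> N" for m n
  proof -
    have "\<beta> (\<Sum>i<k. scale (\<beta> m (b' i)) (b i)) (pN n) = (\<Sum>i<k. \<beta> m (b' i) * \<beta> (b i) (pN n))"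
      using b pN(1)[OF that(2)] by (intro sum_left) auto
    also have "\<dots> = 0" using pN(2)[OF that(2)] by (intro sum.neutral) simp
    finally show ?thesis
      using pN(1)[OF that(2)] that(1) b unfolding pM_def[of m] by (subst diff_left) (auto intro!: M_sum)
  qed
  \<comment> \<open>The remainder \<open>pM m\<close> pairs with \<open>n\<close> as it does with
    \<open>pN n\<close>, that is, to 0 for every \<open>n\<close>; symmetrically for
    \<open>pN n\<close>.\<close>
  ultimately have "pM m = 0" "pN n = 0" if "m \<in> M" "n \<in> N" for m n
    using that nondeg_left[OF pM(1)[OF that(1)]] nondeg_right[OF pN(1)[OF that(2)]] by (metis, metis)
  then have exp: "\<forall>m\<in>M. m = (\<Sum>i<k. scale (\<beta> m (b' i)) (b i))" "\<forall>n\<in>N. n = (\<Sum>i<k. scale (\<beta> (b i) n) (b' i))"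
    using subspace_0[OF M] subspace_0[OF N] unfolding pM_def pN_def by (auto simp: right_minus_eq)
  show ?thesis
    by (rule exI[of _ k], rule exI[of _ b], rule exI[of _ b']) (use b exp in blast)
qed

text \<open>Nondegeneracy is required against every object \<open>a\<close>, not just on the
  endomorphisms of \<open>k\<close>: it puts \<open>Hom D k a\<close> and \<open>Hom D a k\<close>
  in duality, so that one trace on \<open>k\<close> yields an averaging operator on the whole
  category.\<close>

locale traced_object = linear_category D for D :: "('o, 'm::ab_group_add) lincat" +
  fixes k :: 'o and \<tau> :: "'m \<Rightarrow> complex"
  assumes k[simp]: "k \<in> Obj D"
    and trace_add: "\<lbrakk>x \<in> Hom D k k; y \<in> Hom D k k\<rbrakk> \<Longrightarrow> \<tau> (x + y) = \<tau> x + \<tau> y"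
    and trace_Scale: "x \<in> Hom D k k \<Longrightarrow> \<tau> (Scale D r x) = r * \<tau> x"
    and trace_comm: "\<lbrakk>x \<in> Hom D k k; y \<in> Hom D k k\<rbrakk> \<Longrightarrow> \<tau> (Comp D k k k x y) = \<tau> (Comp D k k k y x)"
    and trace_nondeg_left: "\<lbrakk>a \<in> Obj D; m \<in> Hom D k a; m \<noteq> 0\<rbrakk> \<Longrightarrow> \<exists>n\<in>Hom D a k. \<tau> (Comp D k a k n m) \<noteq> 0"
    and trace_nondeg_right: "\<lbrakk>a \<in> Obj D; n \<in> Hom D a k; n \<noteq> 0\<rbrakk> \<Longrightarrow> \<exists>m\<in>Hom D k a. \<tau> (Comp D k a k n m) \<noteq> 0"
    and Hom_finite_dim: "a \<in> Obj D \<Longrightarrow> \<exists>T. finite T \<and> Hom D k a \<subseteq> vs.span T"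
begin

text \<open>The corner at \<open>e\<close>, cut by \<open>1 - average_id av1\<close>, is spanned by
  the images of the \<open>q g\<close>, which multiply like a group up to the scalars
  \<open>c g h\<close>; it is a quotient of a twisted group algebra. The Casimir element of the
  trace form, corrected by a factor \<open>w\<close>, acts on it like the average of
  \<open>q g \<otimes> q' g\<close> over \<open>G\<close>, and this average multiplies to the
  unit.\<close>

lemma ex_averaging_absorbs_corner:
  fixes q q' :: "'g \<Rightarrow> 'm"
  assumes av1: "averaging D av1"
    and e[simp]: "e \<in> Hom D k k" and ee[simp]: "Comp D k k k e e = e"
    and G: "finite G" "G \<noteq> {}"
    and q: "\<And>g. g \<in> G \<Longrightarrow> q g \<in> Hom D k k" "\<And>g. g \<in> G \<Longrightarrow> q' g \<in> Hom D k k"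
      "\<And>g. g \<in> G \<Longrightarrow> Comp D k k k e (q g) = q g" "\<And>g. g \<in> G \<Longrightarrow> Comp D k k k (q g) e = q g"
      "\<And>g. g \<in> G \<Longrightarrow> Comp D k k k e (q' g) = q' g" "\<And>g. g \<in> G \<Longrightarrow> Comp D k k k (q' g) e = q' g"
      "\<And>g. g \<in> G \<Longrightarrow> Comp D k k k (q g) (q' g) = e" "\<And>g. g \<in> G \<Longrightarrow> Comp D k k k (q' g) (q g) = e"
    and mul: "\<And>g h. g \<in> G \<Longrightarrow> h \<in> G \<Longrightarrow> mul g h \<in> G"
      "\<And>g h. g \<in> G \<Longrightarrow> h \<in> G \<Longrightarrow> Comp D k k k (q g) (q h) = Scale D (c g h) (q (mul g h))"
      "\<And>g. g \<in> G \<Longrightarrow> inj_on (mul g) G"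
    and span: "\<And>x. x \<in> Hom D k k \<Longrightarrow>
      Comp D k k k (Ident D k - average_id av1 k) (Comp D k k k e (Comp D k k k x e)) \<in>
        vs.span ((\<lambda>g. Comp D k k k (Ident D k - average_id av1 k) (q g)) ` G)"
  shows "\<exists>av. averaging D av \<and> absorbs av (k, k, e)"
proof -
  define F where "F a = Ident D a - average_id av1 a" for a
  note [simp] = Hom_intros Comp_Ident_left Comp_Ident_right Comp_0_left Comp_0_right
    Comp_diff_left Comp_diff_right Comp_add_left Comp_add_right Comp_Scale_left Comp_Scale_right
    average_id_in_Hom[OF av1] average_id_idempotent[OF av1]
    q trace_add trace_Scale
  have F[simp]: "F a \<in> Hom D a a" "Comp D a a a (F a) (F a) = F a" if "a \<in> Obj D" for a
    using that by (simp_all add: F_def)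
  have FN: "Comp D a b b (F b) g = Comp D a a b g (F a)" if "a \<in> Obj D" "b \<in> Obj D" "g \<in> Hom D a b" for a b g
    using that by (simp add: F_def average_id_natural[OF av1])
  have FF: "Comp D k k k (F k) (Comp D k k k (F k) u) = Comp D k k k (F k) u" if "u \<in> Hom D k k" for u
    using Comp_cancel[of k k k k "F k" "F k" u "F k"] that by simp
  \<comment> \<open>The part of \<open>e\<close> not yet absorbed by \<open>av1\<close>. It is
    idempotent because \<open>F k\<close> is a central idempotent.\<close>
  define \<epsilon> where "\<epsilon> = Comp D k k k (F k) e"
  have \<epsilon>H[simp]: "\<epsilon> \<in> Hom D k k" by (simp add: \<epsilon>_def)
  have \<epsilon>\<epsilon>: "Comp D k k k \<epsilon> \<epsilon> = \<epsilon>"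
  proof -
    have "Comp D k k k \<epsilon> \<epsilon> = Comp D k k k (Comp D k k k (F k) (F k)) (Comp D k k k e e)"
      unfolding \<epsilon>_def using FN[of k k e] by (metis Comp_assoc F(1) Comp_in_Hom e k)
    then show ?thesis by (simp add: \<epsilon>_def)
  qed
  define M where "M a = {m \<in> Hom D k a. Comp D k k a m \<epsilon> = m}" for a
  define N where "N a = {n \<in> Hom D a k. Comp D a k k \<epsilon> n = n}" for a
  define \<beta> where "\<beta> a m n = \<tau> (Comp D k a k n m)" for a m n
  have "\<exists>n b b'. (\<forall>i<(n::nat). b i \<in> M a \<and> b' i \<in> N a) \<and>
    (\<forall>m\<in>M a. m = (\<Sum>i<n. Scale D (\<beta> a m (b' i)) (b i))) \<and>
    (\<forall>m\<in>N a. m = (\<Sum>i<n. Scale D (\<beta> a (b i) m) (b' i)))" if [simp]: "a \<in> Obj D" for a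
  proof -
    obtain T where T: "finite T" "Hom D k a \<subseteq> vs.span T" using Hom_finite_dim[OF \<open>a \<in> Obj D\<close>] by blast
    show ?thesis
    proof (rule vs.ex_dual_bases[OF _ _ T(1)])
      show "vs.subspace (M a)" "vs.subspace (N a)" by (auto simp: vs.subspace_def M_def N_def)
      show "M a \<subseteq> vs.span T" using T(2) by (auto simp: M_def)
    next
      fix m assume m: "m \<in> M a" "m \<noteq> 0"
      then obtain n where n[simp]: "n \<in> Hom D a k" and "\<tau> (Comp D k a k n m) \<noteq> 0"
        using trace_nondeg_left[of a m] by (auto simp: M_def)
      have [simp]: "m \<in> Hom D k a" and m\<epsilon>: "Comp D k k a m \<epsilon> = m" using m by (auto simp: M_def)
      have "\<tau> (Comp D k a k (Comp D a k k \<epsilon> n) m) = \<tau> (Comp D k k k \<epsilon> (Comp D k a k n m))"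
        by (simp add: Comp_assoc_right)
      also have "\<dots> = \<tau> (Comp D k k k (Comp D k a k n m) \<epsilon>)" by (simp add: trace_comm)
      also have "\<dots> = \<tau> (Comp D k a k n m)" by (simp add: Comp_assoc_right m\<epsilon>)
      finally show "\<exists>n\<in>N a. \<beta> a m n \<noteq> 0"
        using \<open>\<tau> (Comp D k a k n m) \<noteq> 0\<close> \<epsilon>\<epsilon>
        by (intro bexI[of _ "Comp D a k k \<epsilon> n"]) (auto simp: \<beta>_def N_def Comp_assoc)
    next
      fix n assume n: "n \<in> N a" "n \<noteq> 0"
      then obtain m where m[simp]: "m \<in> Hom D k a" and "\<tau> (Comp D k a k n m) \<noteq> 0"
        using trace_nondeg_right[of a n] by (auto simp: N_def)
      have [simp]: "n \<in> Hom D a k" and n\<epsilon>: "Comp D a k k \<epsilon> n = n" using n by (auto simp: N_def)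
      have "\<tau> (Comp D k a k n (Comp D k k a m \<epsilon>)) = \<tau> (Comp D k k k (Comp D k a k n m) \<epsilon>)"
        by (simp add: Comp_assoc_right)
      also have "\<dots> = \<tau> (Comp D k k k \<epsilon> (Comp D k a k n m))" by (simp add: trace_comm)
      also have "\<dots> = \<tau> (Comp D k a k n m)" by (simp add: Comp_assoc n\<epsilon>)
      finally show "\<exists>m\<in>M a. \<beta> a m n \<noteq> 0"
        using \<open>\<tau> (Comp D k a k n m) \<noteq> 0\<close> \<epsilon>\<epsilon>
        by (intro bexI[of _ "Comp D k k a m \<epsilon>"]) (auto simp: \<beta>_def M_def Comp_assoc_right)
    qed (auto simp: M_def N_def \<beta>_def)
  qed
  then have "\<forall>a\<in>Obj D. \<exists>t. case t of (n, b, b') \<Rightarrow> (\<forall>i<(n::nat). b i \<in> M a \<and> b' i \<in> N a) \<and>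
    (\<forall>m\<in>M a. m = (\<Sum>i<n. Scale D (\<beta> a m (b' i)) (b i))) \<and>
    (\<forall>m\<in>N a. m = (\<Sum>i<n. Scale D (\<beta> a (b i) m) (b' i)))" by simp
  from bchoice[OF this] obtain t where t: "\<forall>a\<in>Obj D.
    case t a of (n, b, b') \<Rightarrow> (\<forall>i<(n::nat). b i \<in> M a \<and> b' i \<in> N a) \<and>
    (\<forall>m\<in>M a. m = (\<Sum>i<n. Scale D (\<beta> a m (b' i)) (b i))) \<and>
    (\<forall>m\<in>N a. m = (\<Sum>i<n. Scale D (\<beta> a (b i) m) (b' i)))" ..
  define d where "d a = fst (t a)" for a
  define b where "b a = fst (snd (t a))" for a
  define b' where "b' a = snd (snd (t a))" for a
  note t' = bspec[OF t, unfolded case_prod_beta, folded d_def b_def b'_def]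
  have bM: "\<And>a i. a \<in> Obj D \<Longrightarrow> i < d a \<Longrightarrow> b a i \<in> M a"
    and bN: "\<And>a i. a \<in> Obj D \<Longrightarrow> i < d a \<Longrightarrow> b' a i \<in> N a"
    and expM: "\<And>a m. a \<in> Obj D \<Longrightarrow> m \<in> M a \<Longrightarrow> m = (\<Sum>i<d a. Scale D (\<beta> a m (b' a i)) (b a i))"
    and expN: "\<And>a m. a \<in> Obj D \<Longrightarrow> m \<in> N a \<Longrightarrow> m = (\<Sum>i<d a. Scale D (\<beta> a (b a i) m) (b' a i))"
    using t' by blast+
  have bH[simp]: "b a i \<in> Hom D k a" "b' a i \<in> Hom D a k" if "a \<in> Obj D" "i < d a" for a i
    using bM[OF that] bN[OF that] by (auto simp: M_def N_def)
  \<comment> \<open>Dual bases of the trace form replace the group average only up to a factor in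
    the corner. This \<open>w\<close> is that factor: the group average with the trace applied to
    its second leg, which is made precise by \<open>sw\<close>.\<close>
  define w where "w = Scale D (1 / of_nat (card G)) (\<Sum>g\<in>G. Scale D (\<tau> (Comp D k k k (F k) (q' g))) (Comp D k k k (F k) (q g)))"
  have wH[simp]: "w \<in> Hom D k k" unfolding w_def by (intro Scale_in_Hom sum_in_Hom Comp_in_Hom) simp_all
  \<comment> \<open>The Casimir element \<open>\<Sum> b i \<otimes> b' i\<close>, formed for each
    object \<open>a\<close> separately, with \<open>w\<close> inserted between the two legs.\<close>
  define av where "av a x \<Phi> = (\<Sum>i<d a. Comp D a k x (\<Phi> k (Comp D k k a (b a i) w)) (b' a i))" for a x \<Phi>

  \<comment> \<open>Multiplication by \<open>w\<close> converts \<open>s\<close> into a sum over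
    \<open>G\<close> with the traces of \<open>q' g s\<close> as coefficients. By linearity
    \<open>s\<close> may be taken to be the image of \<open>q h\<close>; then the twist
    \<open>c h g\<close> appears in both the product and the trace, and reindexing by
    \<open>mul h\<close> proves the formula.\<close>
  have sw: "s \<in> Hom D k k \<and> Comp D k k k s w = Scale D (1 / of_nat (card G))
      (\<Sum>g\<in>G. Scale D (\<tau> (Comp D k k k (q' g) s)) (Comp D k k k (F k) (q g)))"
    if "s \<in> vs.span ((\<lambda>g. Comp D k k k (F k) (q g)) ` G)" for s
    using that
  proof (induction rule: vs.span_induct)
    case base
    show ?case
      unfolding vs.subspace_def
    proof (intro conjI ballI allI CollectI)
      have [simp]: "\<tau> 0 = 0" using trace_Scale[of 0 0] zero_in_Hom[of k k] by simp
      show "Comp D k k k 0 w = Scale D (1 / of_nat (card G)) (\<Sum>g\<in>G. Scale D (\<tau> (Comp D k k k (q' g) 0)) (Comp D k k k (F k) (q g)))"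
        by simp
    qed (auto simp: vs.scale_left_distrib sum.distrib vs.scale_right_distrib vs.scale_sum_right mult_ac)
  next
    case (step s)
    then obtain h where h: "h \<in> G" and s: "s = Comp D k k k (F k) (q h)" by blast
    have summand: "Comp D k k k s (Scale D (\<tau> (Comp D k k k (F k) (q' g))) (Comp D k k k (F k) (q g))) =
        Scale D (\<tau> (Comp D k k k (q' (mul h g)) s)) (Comp D k k k (F k) (q (mul h g)))" if g: "g \<in> G" for g
    proof -
      have "Comp D k k k s (Comp D k k k (F k) (q g)) = Comp D k k k (F k) (Comp D k k k (q h) (q g))"
      proof -
        have "Comp D k k k s (Comp D k k k (F k) (q g)) = Comp D k k k (Comp D k k k (F k) (F k)) (Comp D k k k (q h) (q g))"
          unfolding s using FN[of k k "q h"] h g by (metis Comp_assoc F(1) Comp_in_Hom q(1) k)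
        then show ?thesis by simp
      qed
      also have "\<dots> = Scale D (c h g) (Comp D k k k (F k) (q (mul h g)))"
        using h g by (simp add: mul)
      finally have 1: "Comp D k k k s (Comp D k k k (F k) (q g)) = Scale D (c h g) (Comp D k k k (F k) (q (mul h g)))" .
      have "Comp D k k k (q' (mul h g)) (q h) = Comp D k k k (q' (mul h g)) (Comp D k k k (Comp D k k k (q h) (q g)) (q' g))"
        using h g mul(1)[OF h g] by (simp add: Comp_assoc_right)
      also have "\<dots> = Scale D (c h g) (Comp D k k k (Comp D k k k (q' (mul h g)) (q (mul h g))) (q' g))"
        using h g mul(1)[OF h g] by (simp add: mul(2) Comp_assoc del: q(7,8))
      also have "\<dots> = Scale D (c h g) (q' g)"
        using h g mul(1)[OF h g] by simp
      finally have 2: "Comp D k k k (q' (mul h g)) (q h) = Scale D (c h g) (q' g)" .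
      have "Comp D k k k (q' (mul h g)) s = Comp D k k k (F k) (Comp D k k k (q' (mul h g)) (q h))"
        unfolding s using FN[of k k "q' (mul h g)"] h g mul(1)[OF h g] by (metis Comp_assoc F(1) q(1,2) k)
      then have 3: "\<tau> (Comp D k k k (q' (mul h g)) s) = c h g * \<tau> (Comp D k k k (F k) (q' g))"
        using h g by (simp add: 2)
      have "s \<in> Hom D k k" using h by (simp add: s)
      then show ?thesis using h g by (simp add: 1 3 mult_ac)
    qed
    have "s \<in> Hom D k k" using h by (simp add: s)
    then have "Comp D k k k s w = Scale D (1 / of_nat (card G))
        (\<Sum>g\<in>G. Comp D k k k s (Scale D (\<tau> (Comp D k k k (F k) (q' g))) (Comp D k k k (F k) (q g))))"
      unfolding w_def by (subst Comp_Scale_right) (simp_all add: Comp_sum_right)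
    also have "\<dots> = Scale D (1 / of_nat (card G))
        (\<Sum>g\<in>G. Scale D (\<tau> (Comp D k k k (q' (mul h g)) s)) (Comp D k k k (F k) (q (mul h g))))"
      using summand by simp
    \<comment> \<open>An injective left multiplication permutes the finite set
      \<open>G\<close>.\<close>
    also have "(\<Sum>g\<in>G. Scale D (\<tau> (Comp D k k k (q' (mul h g)) s)) (Comp D k k k (F k) (q (mul h g)))) =
        (\<Sum>g\<in>G. Scale D (\<tau> (Comp D k k k (q' g) s)) (Comp D k k k (F k) (q g)))"
      using endo_inj_surj[OF G(1) _ mul(3)[OF h]] mul(1,3) h
      by (intro sum.reindex_bij_betw) (auto simp: bij_betw_def)
    finally show ?case using \<open>s \<in> Hom D k k\<close> by simp
  qed

  \<comment> \<open>Centrality of a Casimir element: expanding \<open>b' j\<close> after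
    \<open>g\<close> in one dual basis and \<open>g\<close> after \<open>b i\<close> in the other
    gives the same coefficients, both being the trace of \<open>b' j\<close> after \<open>g\<close>
    after \<open>b i\<close>.\<close>
  have nat: "(\<Sum>j<d b0. Comp D a k x (\<Phi> k (Comp D k k b0 (b b0 j) w)) (Comp D a b0 k (b' b0 j) g)) =
      (\<Sum>i<d a. Comp D a k x (\<Phi> k (Comp D k a b0 g (Comp D k k a (b a i) w))) (b' a i))"
    if [simp]: "a \<in> Obj D" "b0 \<in> Obj D" "x \<in> Obj D" "g \<in> Hom D a b0" and \<Phi>: "linear_family D b0 x \<Phi>" for a b0 x g \<Phi>
  proof -
    have \<Phi>H: "\<Phi> k u \<in> Hom D k x" if "u \<in> Hom D k b0" for u using \<Phi> that by (simp add: linear_family_def)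
    have 1: "(\<Sum>j<d b0. Comp D a k x (\<Phi> k (Comp D k k b0 (b b0 j) w)) (Comp D a b0 k (b' b0 j) g)) =
      (\<Sum>j<d b0. \<Sum>i<d a. Scale D (\<beta> a (b a i) (Comp D a b0 k (b' b0 j) g)) (Comp D a k x (\<Phi> k (Comp D k k b0 (b b0 j) w)) (b' a i)))"
    proof (intro sum.cong refl)
      fix j assume j: "j \<in> {..<d b0}"
      then have "Comp D a b0 k (b' b0 j) g \<in> N a"
        using bN[of b0 j] by (simp add: N_def Comp_assoc)
      then have "Comp D a k x (\<Phi> k (Comp D k k b0 (b b0 j) w)) (Comp D a b0 k (b' b0 j) g) =
        Comp D a k x (\<Phi> k (Comp D k k b0 (b b0 j) w)) (\<Sum>i<d a. Scale D (\<beta> a (b a i) (Comp D a b0 k (b' b0 j) g)) (b' a i))"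
        using expN[of a] by simp
      then show "Comp D a k x (\<Phi> k (Comp D k k b0 (b b0 j) w)) (Comp D a b0 k (b' b0 j) g) =
        (\<Sum>i<d a. Scale D (\<beta> a (b a i) (Comp D a b0 k (b' b0 j) g)) (Comp D a k x (\<Phi> k (Comp D k k b0 (b b0 j) w)) (b' a i)))"
        using j by (subst (asm) Comp_sum_right) (auto simp: \<Phi>H)
    qed
    have 2: "(\<Sum>i<d a. Comp D a k x (\<Phi> k (Comp D k a b0 g (Comp D k k a (b a i) w))) (b' a i)) =
      (\<Sum>i<d a. \<Sum>j<d b0. Scale D (\<beta> a (b a i) (Comp D a b0 k (b' b0 j) g)) (Comp D a k x (\<Phi> k (Comp D k k b0 (b b0 j) w)) (b' a i)))"
    proof (intro sum.cong refl)
      fix i assume i: "i \<in> {..<d a}"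
      then have "Comp D k a b0 g (b a i) \<in> M b0"
        using bM[of a i] by (simp add: M_def Comp_assoc_right)
      then have gb: "Comp D k a b0 g (b a i) = (\<Sum>j<d b0. Scale D (\<beta> a (b a i) (Comp D a b0 k (b' b0 j) g)) (b b0 j))"
      proof -
        have "\<beta> b0 (Comp D k a b0 g (b a i)) (b' b0 j) = \<beta> a (b a i) (Comp D a b0 k (b' b0 j) g)" if "j < d b0" for j
          using i that by (simp add: \<beta>_def Comp_assoc)
        then have "(\<Sum>j<d b0. Scale D (\<beta> b0 (Comp D k a b0 g (b a i)) (b' b0 j)) (b b0 j)) =
            (\<Sum>j<d b0. Scale D (\<beta> a (b a i) (Comp D a b0 k (b' b0 j) g)) (b b0 j))"
          by (intro sum.cong refl) simp
        then show ?thesis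
          using expM[OF \<open>b0 \<in> Obj D\<close> \<open>Comp D k a b0 g (b a i) \<in> M b0\<close>] by (rule trans[rotated])
      qed
      have "Comp D k a b0 g (Comp D k k a (b a i) w) = Comp D k k b0 (Comp D k a b0 g (b a i)) w"
        using i by (intro Comp_assoc) simp_all
      also have "\<dots> = (\<Sum>j<d b0. Scale D (\<beta> a (b a i) (Comp D a b0 k (b' b0 j) g)) (Comp D k k b0 (b b0 j) w))"
        unfolding gb by (subst Comp_sum_left) auto
      finally have "\<Phi> k (Comp D k a b0 g (Comp D k k a (b a i) w)) =
         (\<Sum>j<d b0. Scale D (\<beta> a (b a i) (Comp D a b0 k (b' b0 j) g)) (\<Phi> k (Comp D k k b0 (b b0 j) w)))"
        using linear_family_apply_sum[OF \<Phi>, where c = k and I = "{..<d b0}" and u = "\<lambda>j. Comp D k k b0 (b b0 j) w"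
          and r = "\<lambda>j. \<beta> a (b a i) (Comp D a b0 k (b' b0 j) g)"] by simp
      then show "Comp D a k x (\<Phi> k (Comp D k a b0 g (Comp D k k a (b a i) w))) (b' a i) =
        (\<Sum>j<d b0. Scale D (\<beta> a (b a i) (Comp D a b0 k (b' b0 j) g)) (Comp D a k x (\<Phi> k (Comp D k k b0 (b b0 j) w)) (b' a i)))"
        using i by simp (subst Comp_sum_left, auto simp: \<Phi>H)
    qed
    show ?thesis unfolding 1 2 by (rule sum.swap)
  qed
  have E_in: "average_id av a \<in> Hom D a a" if "a \<in> Obj D" for a
    unfolding average_id_def av_def using that by (intro sum_in_Hom) auto
  have E_nat: "Comp D a b0 b0 (average_id av b0) g = Comp D a a b0 g (average_id av a)"
    if [simp]: "a \<in> Obj D" "b0 \<in> Obj D" "g \<in> Hom D a b0" for a b0 g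
  proof -
    have "Comp D a b0 b0 (average_id av b0) g =
        (\<Sum>j<d b0. Comp D a k b0 (Comp D k k b0 (b b0 j) w) (Comp D a b0 k (b' b0 j) g))"
      unfolding average_id_def av_def by (subst Comp_sum_left) (simp_all add: Comp_assoc_right)
    also have "\<dots> = (\<Sum>i<d a. Comp D a k b0 (Comp D k a b0 g (Comp D k k a (b a i) w)) (b' a i))"
      by (rule nat) (simp_all add: linear_family_id)
    also have "\<dots> = Comp D a a b0 g (average_id av a)"
      unfolding average_id_def av_def by (subst Comp_sum_right) (simp_all add: Comp_assoc_right)
    finally show ?thesis .
  qed
  have q'\<epsilon>: "Comp D k k k (q' g) \<epsilon> = Comp D k k k (F k) (q' g)" "Comp D k k k \<epsilon> (q' g) = Comp D k k k (F k) (q' g)"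
    if g: "g \<in> G" for g
  proof -
    have "Comp D k k k (q' g) \<epsilon> = Comp D k k k (Comp D k k k (F k) (q' g)) e"
      unfolding \<epsilon>_def using g Comp_assoc[of k k k k e "F k" "q' g"] FN[of k k "q' g"] by simp
    then show "Comp D k k k (q' g) \<epsilon> = Comp D k k k (F k) (q' g)" using g by (simp add: Comp_assoc_right)
    show "Comp D k k k \<epsilon> (q' g) = Comp D k k k (F k) (q' g)" using g by (simp add: \<epsilon>_def Comp_assoc_right)
  qed
  \<comment> \<open>By \<open>sw\<close> the left side is an average over \<open>G\<close> whose
    inner sums over \<open>i\<close> are expansions in dual bases; summing these leaves
    \<open>F q g q' g\<close> for each \<open>g\<close>, which is \<open>\<epsilon>\<close>.\<close>
  have \<epsilon>E: "Comp D k k k \<epsilon> (average_id av k) = \<epsilon>"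
  proof -
    have s: "Comp D k k k \<epsilon> (b k i) \<in> vs.span ((\<lambda>g. Comp D k k k (F k) (q g)) ` G)" if "i < d k" for i
    proof -
      have bi[simp]: "b k i \<in> Hom D k k" using that by simp
      have "b k i = Comp D k k k (b k i) \<epsilon>" using bM[OF k that] by (simp add: M_def)
      also have "\<dots> = Comp D k k k (Comp D k k k (F k) (b k i)) e"
        unfolding \<epsilon>_def using Comp_assoc[of k k k k e "F k" "b k i"] FN[of k k "b k i"] by simp
      finally have "Comp D k k k \<epsilon> (b k i) = Comp D k k k \<epsilon> (Comp D k k k (F k) (Comp D k k k (b k i) e))"
        by (simp add: Comp_assoc_right)
      also have "\<dots> = Comp D k k k (F k) (Comp D k k k (Comp D k k k e (F k)) (Comp D k k k (b k i) e))"
        by (simp add: \<epsilon>_def Comp_assoc_right)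
      also have "Comp D k k k e (F k) = Comp D k k k (F k) e" using FN[of k k e] by simp
      also have "Comp D k k k (F k) (Comp D k k k (Comp D k k k (F k) e) (Comp D k k k (b k i) e)) =
          Comp D k k k (F k) (Comp D k k k e (Comp D k k k (b k i) e))"
        by (simp add: Comp_assoc_right FF)
      finally show ?thesis using span[OF bi] by (simp add: F_def)
    qed
    have "Comp D k k k \<epsilon> (average_id av k) = (\<Sum>i<d k. Comp D k k k (Comp D k k k (Comp D k k k \<epsilon> (b k i)) w) (b' k i))"
      unfolding average_id_def av_def by (subst Comp_sum_right) (simp_all add: Comp_assoc_right)
    also have "\<dots> = (\<Sum>i<d k. Scale D (1 / of_nat (card G)) (\<Sum>g\<in>G. Comp D k k k (Comp D k k k (F k) (q g))
        (Scale D (\<beta> k (b k i) (Comp D k k k \<epsilon> (q' g))) (b' k i))))"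
    proof (intro sum.cong refl)
      fix i assume i: "i \<in> {..<d k}"
      have \<tau>: "\<tau> (Comp D k k k (q' g) (Comp D k k k \<epsilon> (b k i))) = \<beta> k (b k i) (Comp D k k k \<epsilon> (q' g))" if "g \<in> G" for g
        using i that q'\<epsilon>[OF that] by (simp add: \<beta>_def Comp_assoc)
      show "Comp D k k k (Comp D k k k (Comp D k k k \<epsilon> (b k i)) w) (b' k i) = Scale D (1 / of_nat (card G))
        (\<Sum>g\<in>G. Comp D k k k (Comp D k k k (F k) (q g)) (Scale D (\<beta> k (b k i) (Comp D k k k \<epsilon> (q' g))) (b' k i)))"
      proof -
        have "Comp D k k k (\<Sum>g\<in>G. Scale D (\<tau> (Comp D k k k (q' g) (Comp D k k k \<epsilon> (b k i)))) (Comp D k k k (F k) (q g))) (b' k i) =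
          (\<Sum>g\<in>G. Comp D k k k (Comp D k k k (F k) (q g)) (Scale D (\<beta> k (b k i) (Comp D k k k \<epsilon> (q' g))) (b' k i)))"
          using i by (subst Comp_sum_left) (auto simp: \<tau> intro!: sum.cong)
        moreover have "(\<Sum>g\<in>G. Scale D (\<tau> (Comp D k k k (q' g) (Comp D k k k \<epsilon> (b k i)))) (Comp D k k k (F k) (q g))) \<in> Hom D k k"
          using i by (intro sum_in_Hom) auto
        ultimately show ?thesis
          using i sw[OF s[of i]] by simp
      qed
    qed
    also have "\<dots> = Scale D (1 / of_nat (card G)) (\<Sum>g\<in>G. \<Sum>i<d k. Comp D k k k (Comp D k k k (F k) (q g))
        (Scale D (\<beta> k (b k i) (Comp D k k k \<epsilon> (q' g))) (b' k i)))"
      by (subst sum.swap) (simp only: vs.scale_sum_right)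
    also have "(\<Sum>g\<in>G. \<Sum>i<d k. Comp D k k k (Comp D k k k (F k) (q g))
        (Scale D (\<beta> k (b k i) (Comp D k k k \<epsilon> (q' g))) (b' k i))) = (\<Sum>g\<in>G. \<epsilon>)"
    proof (intro sum.cong refl)
      fix g assume g: "g \<in> G"
      have "Comp D k k k \<epsilon> (q' g) \<in> N k" using g \<epsilon>\<epsilon> by (simp add: N_def Comp_assoc)
      then have "(\<Sum>i<d k. Scale D (\<beta> k (b k i) (Comp D k k k \<epsilon> (q' g))) (b' k i)) = Comp D k k k (F k) (q' g)"
        using expN[of k "Comp D k k k \<epsilon> (q' g)"] q'\<epsilon>[OF g] by simp
      then have "(\<Sum>i<d k. Comp D k k k (Comp D k k k (F k) (q g)) (Scale D (\<beta> k (b k i) (Comp D k k k \<epsilon> (q' g))) (b' k i))) =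
          Comp D k k k (Comp D k k k (F k) (q g)) (Comp D k k k (F k) (q' g))"
        using g by (subst Comp_sum_right[symmetric]) simp_all
      also have "\<dots> = Comp D k k k (F k) (Comp D k k k (Comp D k k k (q g) (F k)) (q' g))"
        using g by (simp add: Comp_assoc_right)
      also have "Comp D k k k (q g) (F k) = Comp D k k k (F k) (q g)" using g FN[of k k "q g"] by simp
      also have "Comp D k k k (F k) (Comp D k k k (Comp D k k k (F k) (q g)) (q' g)) =
          Comp D k k k (F k) (Comp D k k k (q g) (q' g))"
        using g by (simp add: Comp_assoc_right FF)
      also have "\<dots> = \<epsilon>" using g by (simp add: \<epsilon>_def)
      finally show "(\<Sum>i<d k. Comp D k k k (Comp D k k k (F k) (q g)) (Scale D (\<beta> k (b k i) (Comp D k k k \<epsilon> (q' g))) (b' k i))) = \<epsilon>" .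
    qed
    also have "\<dots> = Scale D (of_nat (card G)) \<epsilon>" by (simp add: vs.sum_constant_scale)
    finally show ?thesis using G by simp
  qed
  \<comment> \<open>By naturality \<open>average_id\<close> can be moved from \<open>a\<close> to
    the right of \<open>m = m \<epsilon>\<close>, where \<open>\<epsilon>\<close> absorbs it. This
    also makes \<open>average_id\<close> idempotent, since its left legs \<open>b a i\<close> lie in
    \<open>M a\<close>.\<close>
  have EM: "Comp D k a a (average_id av a) m = m" if [simp]: "a \<in> Obj D" and m: "m \<in> M a" for a m
  proof -
    have mH[simp]: "m \<in> Hom D k a" and m\<epsilon>: "Comp D k k a m \<epsilon> = m" using m by (auto simp: M_def)
    have "Comp D k a a (average_id av a) m = Comp D k k a (Comp D k k a m \<epsilon>) (average_id av k)"
      by (simp add: E_nat m\<epsilon>)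
    also have "\<dots> = Comp D k k a m (Comp D k k k \<epsilon> (average_id av k))"
      using E_in by (intro Comp_assoc_right) simp_all
    finally show ?thesis by (simp add: \<epsilon>E m\<epsilon>)
  qed
  have avg: "averaging D av"
    unfolding averaging_def
  proof (intro conjI ballI allI impI)
    fix a x \<Phi> assume [simp]: "a \<in> Obj D" "x \<in> Obj D" and \<Phi>: "linear_family D a x \<Phi>"
    have [simp]: "\<Phi> k u \<in> Hom D k x" if "u \<in> Hom D k a" for u using \<Phi> that by (simp add: linear_family_def)
    show "av a x \<Phi> \<in> Hom D a x" unfolding av_def by (intro sum_in_Hom) auto
  next
    fix a x \<Phi> \<Psi> assume [simp]: "a \<in> Obj D" "x \<in> Obj D" and \<Phi>: "linear_family D a x \<Phi>" and \<Psi>: "linear_family D a x \<Psi>"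
    have [simp]: "\<Phi> k u \<in> Hom D k x" "\<Psi> k u \<in> Hom D k x" if "u \<in> Hom D k a" for u
      using \<Phi> \<Psi> that by (simp_all add: linear_family_def)
    show "av a x (\<lambda>c u. \<Phi> c u + \<Psi> c u) = av a x \<Phi> + av a x \<Psi>"
      unfolding av_def by (simp add: sum.distrib[symmetric])
  next
    fix a x \<Phi> \<Psi> assume "a \<in> Obj D" "x \<in> Obj D" "linear_family D a x \<Phi>" "\<forall>c\<in>Obj D. \<forall>u\<in>Hom D c a. \<Phi> c u = \<Psi> c u"
    then show "av a x \<Phi> = av a x \<Psi>" unfolding av_def by (intro sum.cong) simp_all
  next
    fix a b0 x \<Phi> g assume [simp]: "a \<in> Obj D" "b0 \<in> Obj D" "x \<in> Obj D" "g \<in> Hom D a b0" and \<Phi>: "linear_family D b0 x \<Phi>"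
    have [simp]: "\<Phi> k u \<in> Hom D k x" if "u \<in> Hom D k b0" for u using \<Phi> that by (simp add: linear_family_def)
    have "Comp D a b0 x (av b0 x \<Phi>) g = (\<Sum>j<d b0. Comp D a k x (\<Phi> k (Comp D k k b0 (b b0 j) w)) (Comp D a b0 k (b' b0 j) g))"
      unfolding av_def by (subst Comp_sum_left) (simp_all add: Comp_assoc_right)
    then show "Comp D a b0 x (av b0 x \<Phi>) g = av a x (\<lambda>c u. \<Phi> c (Comp D c a b0 g u))"
      using nat[OF _ _ _ _ \<Phi>, of a g] by (simp add: av_def)
  next
    fix a x y \<Phi> h assume [simp]: "a \<in> Obj D" "x \<in> Obj D" "y \<in> Obj D" "h \<in> Hom D x y" and \<Phi>: "linear_family D a x \<Phi>"
    have [simp]: "\<Phi> k u \<in> Hom D k x" if "u \<in> Hom D k a" for u using \<Phi> that by (simp add: linear_family_def)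
    show "Comp D a x y h (av a x \<Phi>) = av a y (\<lambda>c u. Comp D c x y h (\<Phi> c u))"
      unfolding av_def by (subst Comp_sum_right) (simp_all add: Comp_assoc_right)
  next
    fix a assume a[simp]: "a \<in> Obj D"
    have E: "average_id av a = (\<Sum>i<d a. Comp D a k a (Comp D k k a (b a i) w) (b' a i))"
      by (simp add: average_id_def av_def)
    have "Comp D a a a (average_id av a) (average_id av a) =
        (\<Sum>i<d a. Comp D a a a (average_id av a) (Comp D a k a (Comp D k k a (b a i) w) (b' a i)))"
      by (subst (2) E, rule Comp_sum_right) (simp_all add: E_in)
    also have "\<dots> = (\<Sum>i<d a. Comp D a k a (Comp D k k a (Comp D k a a (average_id av a) (b a i)) w) (b' a i))"
      by (intro sum.cong refl) (simp add: E_in Comp_assoc_right)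
    also have "\<dots> = average_id av a"
      unfolding E by (intro sum.cong refl) (use EM[OF a bM[OF a]] E in simp)
    finally show "Comp D a a a (average_id av a) (average_id av a) = average_id av a" .
  qed
  \<comment> \<open>The new operator absorbs \<open>F e\<close>, and \<open>e\<close> is the sum of
    \<open>F e\<close> and the part \<open>average_id av1\<close> after \<open>e\<close>; so the
    join with \<open>av1\<close> absorbs \<open>e\<close>.\<close>
  have "\<epsilon> \<in> M k" by (simp add: M_def \<epsilon>\<epsilon>)
  then have "Comp D k k k (average_id av k) (Comp D k k k (F k) e) = Comp D k k k (F k) e"
    using EM[of k \<epsilon>] by (simp add: \<epsilon>_def)
  then have "Comp D k k k (Comp D k k k (average_id av k) (F k)) e = e - Comp D k k k (average_id av1 k) e"
    using E_in by (simp add: Comp_assoc_right) (simp add: F_def)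
  then show ?thesis
    using averaging_join[OF av1 avg] E_in[of k]
    by (intro exI[of _ "\<lambda>a x \<Phi>. av1 a x \<Phi> + Comp D a a x (av a x \<Phi>) (Ident D a - average_id av1 a)"])
      (simp add: absorbs_def F_def[symmetric])
qed

end

section \<open>Partitions as relations between words\<close>

text \<open>Points are numbered from 1 and list positions from 0, hence the shift.\<close>

fun label :: "nat list \<Rightarrow> nat list \<Rightarrow> point \<Rightarrow> nat" where
  "label xs ys (Upper i) = xs ! (i - 1)"
| "label xs ys (Lower j) = ys ! (j - 1)"

text \<open>The relation whose indicator is the matrix commonly attached to a partition acting on
  tensor powers of a space with a basis of letters.\<close>

definition compatible :: "partition \<Rightarrow> nat list \<Rightarrow> nat list \<Rightarrow> bool" where
  "compatible p xs ys \<longleftrightarrow> (\<forall>B\<in>p. \<forall>a\<in>B. \<forall>b\<in>B. label xs ys a = label xs ys b)"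

definition words :: "nat \<Rightarrow> nat \<Rightarrow> nat list set" where
  "words N n = {xs. set xs \<subseteq> {..<N} \<and> length xs = n}"

lemma finite_words[simp]: "finite (words N n)"
  unfolding words_def by (rule finite_lists_length_eq) simp

lemma words_length: "xs \<in> words N n \<Longrightarrow> length xs = n"
  by (simp add: words_def)

lemma words_nth: "xs \<in> words N n \<Longrightarrow> i < n \<Longrightarrow> xs ! i < N"
  using nth_mem[of i xs] by (auto simp: words_def simp del: nth_mem)

lemma replicate_in_words: "0 < N \<Longrightarrow> replicate n 0 \<in> words N n"
  by (auto simp: words_def)

lemma words_0[simp]: "words N 0 = {[]}"
  by (auto simp: words_def)

lemma finite_partitions[simp]: "finite (partitions k l)"
proof -
  have "finite (points k l)" by (simp add: points_def)
  moreover have "partitions k l \<subseteq> Pow (Pow (points k l))"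
    by (auto simp: partitions_def partition_on_def)
  ultimately show ?thesis by (meson finite_Pow_iff finite_subset)
qed

lemma partitions_Union: "p \<in> partitions k l \<Longrightarrow> \<Union>p = points k l"
  by (simp add: partitions_def partition_on_def)

lemma partitions_same_block: "\<lbrakk>p \<in> partitions k l; B \<in> p; B' \<in> p; a \<in> B; a \<in> B'\<rbrakk> \<Longrightarrow> B = B'"
  by (metis disjointD disjoint_iff mem_Collect_eq partition_onD2 partitions_def)

lemma partitions_nonempty: "\<lbrakk>p \<in> partitions k l; B \<in> p\<rbrakk> \<Longrightarrow> \<exists>a. a \<in> B"
  by (cases "B = {}") (auto simp: partitions_def partition_on_def)

lemma label_map:
  assumes "a \<in> points k l"
  shows "label (map (\<lambda>i. f (Upper (Suc i))) [0..<k]) (map (\<lambda>j. f (Lower (Suc j))) [0..<l]) a = f a"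
  using assms by (auto simp: points_def)

lemma label_less:
  "\<lbrakk>xs \<in> words N k; ys \<in> words N l; a \<in> points k l\<rbrakk> \<Longrightarrow> label xs ys a < N"
  by (auto simp: points_def words_nth)

lemma compatible_replicate:
  assumes "p \<in> partitions k l"
  shows "compatible p (replicate k c) (replicate l c)"
proof -
  have "label (replicate k c) (replicate l c) a = c" if "a \<in> points k l" for a
    using that by (auto simp: points_def)
  then show ?thesis
    unfolding compatible_def using partitions_Union[OF assms] by (metis UnionI)
qed

text \<open>Two letters are enough: the indicator function of a block \<open>B'\<close> of
  \<open>p\<close> is compatible with \<open>p\<close>, hence constant on each block of
  \<open>q\<close>, so a block of \<open>q\<close> that meets \<open>B'\<close> lies inside
  it.\<close>

lemma refines_if_compatible:
  assumes p: "p \<in> partitions k l" and q: "q \<in> partitions k l"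
    and imp: "\<And>xs ys. \<lbrakk>xs \<in> words 2 k; ys \<in> words 2 l; compatible p xs ys\<rbrakk> \<Longrightarrow> compatible q xs ys"
  shows "refines (points k l) q p"
  unfolding refines_def
proof (intro conjI ballI)
  show "partition_on (points k l) q" "partition_on (points k l) p" using p q by (simp_all add: partitions_def)
next
  fix B assume B: "B \<in> q"
  then obtain a where a: "a \<in> B" using partitions_nonempty[OF q] by blast
  then obtain B' where B': "B' \<in> p" "a \<in> B'"
    using partitions_Union[OF p] partitions_Union[OF q] B by blast
  let ?f = "\<lambda>b. if b \<in> B' then 1 else 0 :: nat"
  let ?xs = "map (\<lambda>i. ?f (Upper (Suc i))) [0..<k]" and ?ys = "map (\<lambda>j. ?f (Lower (Suc j))) [0..<l]"
  have f: "label ?xs ?ys b = ?f b" if "b \<in> points k l" for b by (rule label_map[OF that])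
  have "compatible p ?xs ?ys"
    unfolding compatible_def
  proof (intro ballI)
    fix A x y assume A: "A \<in> p" "x \<in> A" "y \<in> A"
    then have "x \<in> points k l" "y \<in> points k l" using partitions_Union[OF p] by auto
    moreover have "x \<in> B' \<longleftrightarrow> y \<in> B'" using partitions_same_block[OF p A(1) B'(1)] A by blast
    ultimately show "label ?xs ?ys x = label ?xs ?ys y" by (simp add: f)
  qed
  then have "compatible q ?xs ?ys" by (intro imp) (auto simp: words_def)
  have "b \<in> B'" if b: "b \<in> B" for b
  proof -
    have "a \<in> points k l" "b \<in> points k l" using a b B partitions_Union[OF q] by auto
    moreover have "label ?xs ?ys b = label ?xs ?ys a"
      using \<open>compatible q ?xs ?ys\<close> a b B unfolding compatible_def by blast
    ultimately have "?f b = ?f a" by (simp only: f)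
    then show ?thesis using B' by (simp split: if_splits)
  qed
  then have "B \<subseteq> B'" by blast
  then show "\<exists>B'\<in>p. B \<subseteq> B'" using B' by blast
qed

lemma partition_eqI:
  assumes "p \<in> partitions k l" "q \<in> partitions k l"
    and "\<And>xs ys. \<lbrakk>xs \<in> words 2 k; ys \<in> words 2 l\<rbrakk> \<Longrightarrow> compatible p xs ys \<longleftrightarrow> compatible q xs ys"
  shows "p = q"
proof (rule refines_asym)
  show "refines (points k l) p q" by (rule refines_if_compatible[OF assms(2,1)]) (use assms(3) in simp)
  show "refines (points k l) q p" by (rule refines_if_compatible[OF assms(1,2)]) (use assms(3) in simp)
qed

lemma compatible_refines:
  assumes "refines A p q" "compatible q xs ys"
  shows "compatible p xs ys"
  using assms unfolding compatible_def refines_def by (meson subsetD)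

lemma compatible_involution: "compatible (involution p) xs ys \<longleftrightarrow> compatible p ys xs"
proof -
  have "label xs ys (flip a) = label ys xs a" for a by (cases a) auto
  then show ?thesis by (auto simp: compatible_def involution_def)
qed

lemma compatible_tensor:
  assumes p: "p \<in> partitions k l" and q: "q \<in> partitions k' l'"
    and len: "length xs = k" "length ys = l"
  shows "compatible (tensor k l p q) (xs @ xs') (ys @ ys') \<longleftrightarrow> compatible p xs ys \<and> compatible q xs' ys'"
proof -
  have 1: "label (xs @ xs') (ys @ ys') a = label xs ys a" if "a \<in> B" "B \<in> p" for a B
  proof -
    have "a \<in> points k l" using that partitions_Union[OF p] by blast
    then show ?thesis using len by (auto simp: points_def nth_append)
  qed
  have 2: "label (xs @ xs') (ys @ ys') (shift k l a) = label xs' ys' a" if "a \<in> B" "B \<in> q" for a B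
  proof -
    have "a \<in> points k' l'" using that partitions_Union[OF q] by blast
    then show ?thesis using len by (auto simp: points_def nth_append)
  qed
  have "compatible (tensor k l p q) (xs @ xs') (ys @ ys') \<longleftrightarrow>
      compatible p (xs @ xs') (ys @ ys') \<and> compatible ((\<lambda>B. shift k l ` B) ` q) (xs @ xs') (ys @ ys')"
    by (simp only: tensor_def compatible_def ball_Un)
  also have "compatible p (xs @ xs') (ys @ ys') \<longleftrightarrow> compatible p xs ys"
    unfolding compatible_def using 1 by simp
  also have "compatible ((\<lambda>B. shift k l ` B) ` q) (xs @ xs') (ys @ ys') \<longleftrightarrow> compatible q xs' ys'"
    unfolding compatible_def using 2 by simp
  finally show ?thesis .
qed

section \<open>Stacking of partitions and the words on the middle row\<close>

fun row_label :: "nat list \<Rightarrow> nat list \<Rightarrow> nat list \<Rightarrow> row_point \<Rightarrow> nat" where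
  "row_label xs ys zs (Top i) = xs ! (i - 1)"
| "row_label xs ys zs (Mid i) = ys ! (i - 1)"
| "row_label xs ys zs (Bot i) = zs ! (i - 1)"

lemma row_label_in:
  "row_label xs ys zs (in_top a) = label xs ys a"
  "row_label xs ys zs (in_bottom a) = label ys zs a"
  "row_label xs ys zs (in_outer a) = label xs zs a"
  by (cases a; simp)+

lemma compatible_stacked:
  "compatible p xs ys \<and> compatible q ys zs \<longleftrightarrow>
    (\<forall>B\<in>stacked q p. \<forall>a\<in>B. \<forall>b\<in>B. row_label xs ys zs a = row_label xs ys zs b)"
  unfolding stacked_def ball_Un compatible_def by (simp add: row_label_in)

lemma Union_stacked:
  assumes "p \<in> partitions k l" "q \<in> partitions l m"
  shows "\<Union>(stacked q p) = Top ` {1..k} \<union> Mid ` {1..l} \<union> Bot ` {1..m}"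
proof -
  have "\<Union>(stacked q p) = in_top ` \<Union>p \<union> in_bottom ` \<Union>q" by (auto simp: stacked_def)
  also have "\<dots> = Top ` {1..k} \<union> Mid ` {1..l} \<union> Bot ` {1..m}"
    unfolding partitions_Union[OF assms(1)] partitions_Union[OF assms(2)] points_def by (auto simp: image_Un image_image)
  finally show ?thesis .
qed

lemma in_outer_cases:
  assumes "b \<notin> range Mid"
  obtains u where "b = in_outer u"
proof (cases b)
  case (Top i)
  then show thesis using that[of "Upper i"] by simp
next
  case (Bot i)
  then show thesis using that[of "Lower i"] by simp
qed (use assms in auto)

text \<open>Fixing the labels of the outer rows, a labelling of the middle row is free exactly on the loops.\<close>

lemma card_middle_words:
  assumes p: "p \<in> partitions k l" and q: "q \<in> partitions l m"
    and xs: "xs \<in> words N k" and zs: "zs \<in> words N m"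
  shows "card {ys \<in> words N l. compatible p xs ys \<and> compatible q ys zs} =
    (if compatible (compose q p) xs zs then N ^ loops q p else 0)"
proof -
  define V where "V = \<Union>(stacked q p)"
  define r where "r = (\<Union>B\<in>stacked q p. B \<times> B)\<^sup>+"
  define L where "L = {K \<in> components q p. K \<subseteq> range Mid}"
  have V: "V = Top ` {1..k} \<union> Mid ` {1..l} \<union> Bot ` {1..m}"
    unfolding V_def by (rule Union_stacked[OF p q])
  have comp: "components q p = V // r" by (simp add: components_def V_def r_def)
  have "equiv V r"
  proof (rule equivI)
    show "r \<subseteq> V \<times> V" unfolding r_def V_def by (rule trancl_subset_Sigma) auto
    show "refl_on V r"
      unfolding r_def V_def by (rule refl_onI) auto
    show "sym r" unfolding r_def by (rule sym_trancl) (auto simp: sym_def)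
    show "trans r" unfolding r_def by simp
  qed
  note r = this
  have const: "row_label xs ys zs a = row_label xs ys zs b"
    if "compatible p xs ys \<and> compatible q ys zs" "(a, b) \<in> r" for ys a b
    using that(2) unfolding r_def
  proof (induction rule: trancl_induct)
    case (base b)
    then show ?case using that(1)[unfolded compatible_stacked] by blast
  next
    case (step b c)
    then have "row_label xs ys zs b = row_label xs ys zs c"
      using that(1)[unfolded compatible_stacked] by blast
    then show ?case using step by simp
  qed
  have cls: "K = r `` {a}" if K: "K \<in> components q p" and a: "a \<in> K" for K a
  proof -
    obtain b where "b \<in> V" "K = r `` {b}" using K unfolding comp by (blast elim: quotientE)
    then show ?thesis using a equiv_class_eq[OF r, of b a] by auto
  qed
  have cls_in: "r `` {a} \<in> components q p" "a \<in> r `` {a}" if "a \<in> V" for a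
    using quotientI[OF that] equiv_class_self[OF r that] unfolding comp by auto
  have KV: "K \<subseteq> V" if "K \<in> components q p" for K
    using that equiv_type[OF r] unfolding comp quotient_def by blast
  have nonempty: "(SOME a. a \<in> K) \<in> K" if "K \<in> components q p" for K
    using in_quotient_imp_non_empty[OF r] that unfolding comp by (simp add: some_in_eq)
  have compat: "compatible (compose q p) xs zs \<longleftrightarrow>
    (\<forall>K\<in>components q p. \<forall>a b. in_outer a \<in> K \<longrightarrow> in_outer b \<in> K \<longrightarrow> label xs zs a = label xs zs b)"
  proof -
    have h: "(\<forall>B\<in>X - {{}}. \<forall>a\<in>B. \<forall>b\<in>B. P a b) \<longleftrightarrow> (\<forall>B\<in>X. \<forall>a\<in>B. \<forall>b\<in>B. P a b)" for X :: partition and P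
      by blast
    show ?thesis unfolding compatible_def compose_def h by auto
  qed
  show ?thesis
  proof (cases "compatible (compose q p) xs zs")
    case False
    have "{ys \<in> words N l. compatible p xs ys \<and> compatible q ys zs} = {}"
    proof (rule ccontr)
      assume "{ys \<in> words N l. compatible p xs ys \<and> compatible q ys zs} \<noteq> {}"
      then obtain ys where ys: "compatible p xs ys \<and> compatible q ys zs" by blast
      have "compatible (compose q p) xs zs"
        unfolding compat
      proof (intro ballI allI impI)
        fix K a b assume "K \<in> components q p" "in_outer a \<in> K" "in_outer b \<in> K"
        then have "(in_outer a, in_outer b) \<in> r" using cls by blast
        from const[OF ys this] show "label xs zs a = label xs zs b" by (simp add: row_label_in)
      qed
      then show False using False by simp
    qed
    then show ?thesis using False by (simp only: card.empty if_False)
  next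
    case True
    \<comment> \<open>An admissible middle word is recorded by its labels on the loops, one for
      each; the count then becomes that of all functions from the loops to the letters.\<close>
    define F where "F ys = restrict (\<lambda>K. row_label xs ys zs (SOME a. a \<in> K)) L" for ys
    let ?A = "{ys \<in> words N l. compatible p xs ys \<and> compatible q ys zs}"
    have rl_less: "row_label xs ys zs a < N" if "ys \<in> words N l" "a \<in> V" for ys a
      using that xs zs by (auto simp: V words_nth)
    have inj: "inj_on F ?A"
    proof (rule inj_onI)
      fix ys ys' assume ys: "ys \<in> ?A" and ys': "ys' \<in> ?A" and eq: "F ys = F ys'"
      show "ys = ys'"
      proof (rule nth_equalityI)
        show "length ys = length ys'" using ys ys' by (simp add: words_def)
        fix j assume "j < length ys"
        then have "Mid (Suc j) \<in> V" using ys by (auto simp: V words_def)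
        define K where "K = r `` {Mid (Suc j)}"
        have K: "K \<in> components q p" "Mid (Suc j) \<in> K"
          using cls_in[OF \<open>Mid (Suc j) \<in> V\<close>] by (simp_all add: K_def)
        \<comment> \<open>Two words with the same record agree somewhere on each component: on a
          loop at the chosen representative, otherwise at an outer point, whose label is
          fixed.\<close>
        have "\<exists>b\<in>K. row_label xs ys zs b = row_label xs ys' zs b"
        proof (cases "K \<in> L")
          case True
          then show ?thesis
            using fun_cong[OF eq, of K] nonempty[OF K(1)] by (auto simp: F_def)
        next
          case False
          then obtain b where "b \<in> K" "b \<notin> range Mid" using K by (auto simp: L_def)
          then show ?thesis by (intro bexI[of _ b]) (cases b; auto)
        qed
        then obtain b where b: "b \<in> K" "row_label xs ys zs b = row_label xs ys' zs b" by blast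
        then have "(Mid (Suc j), b) \<in> r" by (simp add: K_def)
        then have "row_label xs ys zs (Mid (Suc j)) = row_label xs ys' zs (Mid (Suc j))"
          using const[of ys "Mid (Suc j)" b] const[of ys' "Mid (Suc j)" b] ys ys' b(2) by auto
        then show "ys ! j = ys' ! j" by simp
      qed
    qed
    have img: "F ` ?A = L \<rightarrow>\<^sub>E {..<N}"
    proof
      show "F ` ?A \<subseteq> L \<rightarrow>\<^sub>E {..<N}"
      proof (rule image_subsetI)
        fix ys assume "ys \<in> ?A"
        then have "row_label xs ys zs (SOME a. a \<in> K) < N" if "K \<in> L" for K
          using that nonempty[of K] KV[of K] rl_less[of ys] by (auto simp: L_def)
        then show "F ys \<in> L \<rightarrow>\<^sub>E {..<N}" by (simp add: F_def restrict_PiE_iff)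
      qed
    next
      show "L \<rightarrow>\<^sub>E {..<N} \<subseteq> F ` ?A"
      proof
        fix f assume f: "f \<in> L \<rightarrow>\<^sub>E {..<N}"
        \<comment> \<open>The labelling reconstructed from \<open>f\<close>: prescribed on loops,
          and on every other component copied from an arbitrary outer point. The choice of the outer
          point is immaterial because \<open>xs\<close> and \<open>zs\<close> are compatible with
          the composite.\<close>
        define g where "g a = (if r `` {a} \<in> L then f (r `` {a}) else label xs zs (SOME u. in_outer u \<in> r `` {a}))" for a
        define ys where "ys = map (\<lambda>j. g (Mid (Suc j))) [0..<l]"
        have outer: "in_outer (SOME u. in_outer u \<in> r `` {a}) \<in> r `` {a}" if a: "a \<in> V" and nL: "r `` {a} \<notin> L" for a
        proof -
          have "\<not> r `` {a} \<subseteq> range Mid" using cls_in(1)[OF a] nL by (simp add: L_def)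
          then obtain b where b: "b \<in> r `` {a}" "b \<notin> range Mid" by blast
          then have "\<exists>u. in_outer u \<in> r `` {a}" using in_outer_cases by blast
          then show ?thesis by (rule someI_ex)
        qed
        have rl: "row_label xs ys zs a = g a" if "a \<in> V" for a
        proof (cases "a \<in> range Mid")
          case True
          then show ?thesis using that by (auto simp: V ys_def)
        next
          case False
          then obtain u where u: "a = in_outer u" using in_outer_cases by blast
          have nL: "r `` {a} \<notin> L" using False cls_in(2)[OF that] by (auto simp: L_def)
          have "label xs zs u = label xs zs (SOME u. in_outer u \<in> r `` {a})"
            using True[unfolded compat] cls_in[OF that] outer[OF that nL] u by blast
          then show ?thesis using nL u by (simp add: g_def row_label_in)
        qed
        have gr: "g a = g b" if "(a, b) \<in> r" for a b
          using equiv_class_eq[OF r that] by (simp add: g_def)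
        have "g a < N" if "a \<in> V" for a
        proof (cases "r `` {a} \<in> L")
          case True
          then show ?thesis using f by (auto simp: g_def)
        next
          case False
          let ?u = "SOME u. in_outer u \<in> r `` {a}"
          have "in_outer ?u \<in> V" using outer[OF that False] KV[OF cls_in(1)[OF that]] by blast
          then have "label xs zs ?u < N" using xs zs by (cases ?u) (auto simp: V words_nth)
          then show ?thesis using False by (simp add: g_def)
        qed
        then have ysw: "ys \<in> words N l" by (auto simp: ys_def words_def V)
        have "compatible p xs ys \<and> compatible q ys zs"
          unfolding compatible_stacked
        proof (intro ballI)
          fix B a b assume "B \<in> stacked q p" "a \<in> B" "b \<in> B"
          then have "a \<in> V" "b \<in> V" "(a, b) \<in> r" unfolding V_def r_def by blast+
          then show "row_label xs ys zs a = row_label xs ys zs b" using gr rl by simp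
        qed
        moreover have "F ys = f"
        proof
          fix K show "F ys K = f K"
          proof (cases "K \<in> L")
            case True
            then have K: "K \<in> components q p" by (simp add: L_def)
            have "r `` {SOME a. a \<in> K} = K" using cls[OF K nonempty[OF K]] by simp
            moreover have "(SOME a. a \<in> K) \<in> V" using nonempty[OF K] KV[OF K] by blast
            ultimately show ?thesis using True rl by (simp add: F_def g_def)
          next
            case False
            then show ?thesis using f by (auto simp: F_def PiE_def extensional_def)
          qed
        qed
        ultimately show "f \<in> F ` ?A" using ysw by (intro image_eqI[of _ F ys]) auto
      qed
    qed
    have "card ?A = card (L \<rightarrow>\<^sub>E {..<N})" using card_image[OF inj] unfolding img by simp
    moreover have "finite V" by (simp add: V)
    then have "finite (components q p)"
      unfolding comp by (rule finite_quotient) (rule equiv_type[OF r])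
    then have "finite L" by (simp add: L_def)
    ultimately show ?thesis using True by (simp add: card_PiE loops_def L_def)
  qed
qed

section \<open>Categories of partitions\<close>

locale partition_category =
  fixes C :: "nat \<Rightarrow> nat \<Rightarrow> partition set"
  assumes category: "category_of_partitions C"
begin

lemma C_subset: "p \<in> C k l \<Longrightarrow> p \<in> partitions k l"
  using category unfolding category_of_partitions_def by blast

lemma finite_C[simp]: "finite (C k l)"
  using finite_subset[OF _ finite_partitions[of k l]] C_subset by blast

lemma cap_in_C: "{{Upper 1, Upper 2}} \<in> C 2 0"
  using category unfolding category_of_partitions_def by blast

lemma strand_in_C: "{{Upper 1, Lower 1}} \<in> C 1 1"
  using category unfolding category_of_partitions_def by blast

lemma tensor_in_C: "p \<in> C k l \<Longrightarrow> q \<in> C k' l' \<Longrightarrow> tensor k l p q \<in> C (k + k') (l + l')"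
  using category unfolding category_of_partitions_def by blast

lemma involution_in_C: "p \<in> C k l \<Longrightarrow> involution p \<in> C l k"
  using category unfolding category_of_partitions_def by blast

lemma compose_in_C: "p \<in> C k l \<Longrightarrow> q \<in> C l m \<Longrightarrow> compose q p \<in> C k m"
  using category unfolding category_of_partitions_def by blast

definition tensor_entry :: "partition \<Rightarrow> nat list \<Rightarrow> nat list \<Rightarrow> nat" where
  "tensor_entry p xs ys = of_bool (compatible p xs ys)"

text \<open>Functoriality of the matrices over an alphabet of size \<open>N\<close>: the summation
  over middle words is the matrix product, and each loop contributes a free choice of a
  letter.\<close>

lemma sum_tensor_entry:
  assumes "p \<in> C k l" "q \<in> C l m" "xs \<in> words N k" "zs \<in> words N m"
  shows "(\<Sum>ys\<in>words N l. tensor_entry p xs ys * tensor_entry q ys zs) =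
    N ^ loops q p * tensor_entry (compose q p) xs zs"
proof -
  have "(\<Sum>ys\<in>words N l. tensor_entry p xs ys * tensor_entry q ys zs) =
      (\<Sum>ys\<in>words N l. of_bool (compatible p xs ys \<and> compatible q ys zs))"
    by (simp add: tensor_entry_def of_bool_conj)
  also have "\<dots> = card {ys \<in> words N l. compatible p xs ys \<and> compatible q ys zs}"
    by (subst sum_of_bool_eq) (auto intro!: arg_cong[where f = card])
  finally show ?thesis
    using card_middle_words[OF C_subset[OF assms(1)] C_subset[OF assms(2)] assms(3,4)]
    by (simp add: tensor_entry_def)
qed

text \<open>Two labels suffice to tell partitions and numbers of loops apart, which reduces identities
  between partitions to identities between matrices.\<close>

lemma eq_if_tensor_entries_eq:
  assumes "p \<in> C k l" "q \<in> C k l"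
    and "\<And>xs ys. xs \<in> words 2 k \<Longrightarrow> ys \<in> words 2 l \<Longrightarrow> 2 ^ m * tensor_entry p xs ys = 2 ^ n * tensor_entry q xs ys"
  shows "m = n" "p = q"
proof -
  \<comment> \<open>Constant words are compatible with every partition, so both entries are 1 there
    and the powers of 2 can be compared.\<close>
  show "m = n"
    using assms(3)[of "replicate k 0" "replicate l 0"] compatible_replicate[OF C_subset[OF assms(1)], of 0]
      compatible_replicate[OF C_subset[OF assms(2)], of 0]
    by (simp add: replicate_in_words tensor_entry_def)
  show "p = q"
    using assms(3) \<open>m = n\<close>
    by (intro partition_eqI[OF C_subset[OF assms(1)] C_subset[OF assms(2)]]) (auto simp: tensor_entry_def of_bool_eq_iff)
qed

text \<open>Both bracketings evaluate the same double sum of products of three matrix entries over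
  two letters, so associativity of matrix multiplication yields the partition and the loop count at
  once.\<close>

lemma compose_assoc:
  assumes "p \<in> C k l" "q \<in> C l m" "r \<in> C m n"
  shows "loops q p + loops r (compose q p) = loops r q + loops (compose r q) p"
    "compose r (compose q p) = compose (compose r q) p"
proof -
  have "2 ^ (loops q p + loops r (compose q p)) * tensor_entry (compose r (compose q p)) xs ys =
      2 ^ (loops r q + loops (compose r q) p) * tensor_entry (compose (compose r q) p) xs ys"
    if "xs \<in> words 2 k" "ys \<in> words 2 n" for xs ys
  proof -
    have "2 ^ (loops q p + loops r (compose q p)) * tensor_entry (compose r (compose q p)) xs ys =
      2 ^ loops q p * (\<Sum>v\<in>words 2 m. tensor_entry (compose q p) xs v * tensor_entry r v ys)"
      using sum_tensor_entry[OF compose_in_C[OF assms(1,2)] assms(3) that] by (simp add: power_add)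
    also have "\<dots> = (\<Sum>v\<in>words 2 m. (2 ^ loops q p * tensor_entry (compose q p) xs v) * tensor_entry r v ys)"
      by (simp add: sum_distrib_left mult_ac)
    also have "\<dots> = (\<Sum>v\<in>words 2 m. \<Sum>u\<in>words 2 l. tensor_entry p xs u * tensor_entry q u v * tensor_entry r v ys)"
      using sum_tensor_entry[OF assms(1,2) that(1)] by (intro sum.cong) (simp_all add: sum_distrib_right[symmetric])
    also have "\<dots> = (\<Sum>u\<in>words 2 l. \<Sum>v\<in>words 2 m. tensor_entry p xs u * (tensor_entry q u v * tensor_entry r v ys))"
      by (subst sum.swap) (simp add: mult_ac)
    also have "\<dots> = (\<Sum>u\<in>words 2 l. tensor_entry p xs u * (2 ^ loops r q * tensor_entry (compose r q) u ys))"
      using sum_tensor_entry[OF assms(2,3) _ that(2)] by (intro sum.cong) (simp_all add: sum_distrib_left[symmetric])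
    also have "\<dots> = 2 ^ loops r q * (\<Sum>u\<in>words 2 l. tensor_entry p xs u * tensor_entry (compose r q) u ys)"
      by (simp add: sum_distrib_left mult_ac)
    also have "\<dots> = 2 ^ (loops r q + loops (compose r q) p) * tensor_entry (compose (compose r q) p) xs ys"
      using sum_tensor_entry[OF assms(1) compose_in_C[OF assms(2,3)] that] by (simp add: power_add)
    finally show ?thesis .
  qed
  note * = eq_if_tensor_entries_eq[OF compose_in_C[OF compose_in_C[OF assms(1,2)] assms(3)]
      compose_in_C[OF assms(1) compose_in_C[OF assms(2,3)]] this]
  show "loops q p + loops r (compose q p) = loops r q + loops (compose r q) p" by (rule *(1))
  show "compose r (compose q p) = compose (compose r q) p" by (rule *(2))
qed

text \<open>Composition of partitions is composition of relations, provided that there is a letter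
  with which loops can be labelled.\<close>

lemma compatible_compose:
  assumes "p \<in> C k l" "q \<in> C l m" "xs \<in> words N k" "zs \<in> words N m" "0 < N"
  shows "compatible (compose q p) xs zs \<longleftrightarrow> (\<exists>ys\<in>words N l. compatible p xs ys \<and> compatible q ys zs)"
proof -
  have "(\<exists>ys\<in>words N l. compatible p xs ys \<and> compatible q ys zs) \<longleftrightarrow>
      card {ys \<in> words N l. compatible p xs ys \<and> compatible q ys zs} \<noteq> 0"
    by auto
  then show ?thesis
    using card_middle_words[OF C_subset[OF assms(1)] C_subset[OF assms(2)] assms(3,4)] assms(5) by simp
qed

lemma involution_involution:
  assumes "p \<in> C k l"
  shows "involution (involution p) = p"
  using C_subset[OF involution_in_C[OF involution_in_C[OF assms]]] C_subset[OF assms]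
  by (rule partition_eqI) (simp add: compatible_involution)

lemma involution_compose:
  assumes "p \<in> C k l" "q \<in> C l m"
  shows "involution (compose q p) = compose (involution p) (involution q)"
proof (rule partition_eqI[of _ m k])
  fix xs ys assume "xs \<in> words 2 m" "ys \<in> words 2 k"
  then show "compatible (involution (compose q p)) xs ys \<longleftrightarrow> compatible (compose (involution p) (involution q)) xs ys"
    using compatible_compose[OF assms, of ys 2 xs]
      compatible_compose[OF involution_in_C[OF assms(2)] involution_in_C[OF assms(1)], of xs 2 ys]
    by (auto simp: compatible_involution)
qed (intro C_subset involution_in_C compose_in_C[OF assms] compose_in_C[OF involution_in_C[OF assms(2)] involution_in_C[OF assms(1)]])+

text \<open>As relations between labellings of the rows, partitions are difunctional.\<close>

lemma compose_regular:
  assumes p: "p \<in> C k l"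
  shows "compose p (compose (involution p) p) = p"
proof (rule partition_eqI[of _ k l])
  note ip = involution_in_C[OF p]
  fix xs ys assume xs: "xs \<in> words 2 k" and ys: "ys \<in> words 2 l"
  have label: "label u v a = label u' v a" if "a \<in> range Lower" for u u' v a using that by auto
  have label': "label u v a = label u v' a" if "a \<in> range Upper" for u v v' a using that by auto
  have UL: "a \<in> range Lower \<or> a \<in> range Upper" for a by (cases a) auto
  \<comment> \<open>For an upper point \<open>a\<close> and a lower point \<open>b\<close> of one
    block the equality is chained through \<open>v\<close> at \<open>b\<close> and \<open>u\<close>
    at \<open>a\<close>; two points in the same row are handled by a single hypothesis.\<close>
  have difunctional: "compatible p xs ys" if c: "compatible p xs v" "compatible p u v" "compatible p u ys" for u v
    unfolding compatible_def
  proof (intro ballI)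
    fix B a b assume B: "B \<in> p" "a \<in> B" "b \<in> B"
    have e: "label xs v a = label xs v b" "label u v a = label u v b" "label u ys a = label u ys b"
      using c[unfolded compatible_def, rule_format, OF B] by simp_all
    show "label xs ys a = label xs ys b"
    proof (cases a; cases b)
    qed (use e in auto)
  qed
  show "compatible (compose p (compose (involution p) p)) xs ys \<longleftrightarrow> compatible p xs ys"
  proof -
    have "compatible (compose p (compose (involution p) p)) xs ys \<longleftrightarrow>
        (\<exists>u\<in>words 2 k. compatible (compose (involution p) p) xs u \<and> compatible p u ys)"
      using compatible_compose[OF compose_in_C[OF p ip] p xs ys] by simp
    also have "\<dots> \<longleftrightarrow> (\<exists>u\<in>words 2 k. (\<exists>v\<in>words 2 l. compatible p xs v \<and> compatible p u v) \<and> compatible p u ys)"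
      using compatible_compose[OF p ip xs] by (simp add: compatible_involution)
    also have "\<dots> \<longleftrightarrow> compatible p xs ys"
      using difunctional xs ys by blast
    finally show ?thesis .
  qed
qed (intro C_subset p compose_in_C[OF compose_in_C[OF p involution_in_C[OF p]] p])+

text \<open>Closing a pair with its involution lands among the partitions of no points, of which the
  empty one is the only one.\<close>

lemma empty_in_C: "{} \<in> C 0 0"
proof -
  have "compose {{Upper 1, Upper 2}} (involution {{Upper 1, Upper 2}}) \<in> C 0 0"
    using compose_in_C involution_in_C cap_in_C by blast
  from C_subset[OF this] have "partition_on {} (compose {{Upper 1, Upper 2}} (involution {{Upper 1, Upper 2}}))"
    by (simp add: partitions_def points_def)
  then have "compose {{Upper 1, Upper 2}} (involution {{Upper 1, Upper 2}}) = {}"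
    by (simp add: partition_on_empty)
  then show ?thesis using \<open>compose _ _ \<in> C 0 0\<close> by simp
qed

lemma identity_partition_in_partitions: "identity_partition k \<in> partitions k k"
  unfolding partitions_def partition_on_def disjoint_def identity_partition_def points_def by auto

lemma compatible_identity:
  assumes "length xs = k" "length ys = k"
  shows "compatible (identity_partition k) xs ys \<longleftrightarrow> xs = ys"
proof -
  have "compatible (identity_partition k) xs ys \<longleftrightarrow> (\<forall>i\<in>{1..k}. xs ! (i - 1) = ys ! (i - 1))"
    unfolding compatible_def identity_partition_def by auto
  also have "\<dots> \<longleftrightarrow> (\<forall>i<k. xs ! i = ys ! i)"
    unfolding image_Suc_lessThan[symmetric] by auto
  also have "\<dots> \<longleftrightarrow> xs = ys" using assms by (auto simp: list_eq_iff_nth_eq)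
  finally show ?thesis .
qed

lemma identity_partition_in_C: "identity_partition k \<in> C k k"
proof (induction k)
  case 0
  then show ?case using empty_in_C by (simp add: identity_partition_def)
next
  case (Suc k)
  let ?t = "tensor k k (identity_partition k) {{Upper 1, Lower 1}}"
  have t: "?t \<in> C (Suc k) (Suc k)" using tensor_in_C[OF Suc strand_in_C] by simp
  have "?t = identity_partition (Suc k)"
  proof (rule partition_eqI[OF C_subset[OF t] identity_partition_in_partitions])
    fix xs ys assume "xs \<in> words 2 (Suc k)" "ys \<in> words 2 (Suc k)"
    then have len: "length xs = Suc k" "length ys = Suc k" by (simp_all add: words_def)
    then obtain x xs' y ys' where s: "xs = xs' @ [x]" "ys = ys' @ [y]"
      by (metis length_Suc_conv_rev)
    have "compatible ?t (xs' @ [x]) (ys' @ [y]) \<longleftrightarrow> compatible (identity_partition k) xs' ys' \<and> compatible {{Upper 1, Lower 1}} [x] [y]"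
      using len s by (intro compatible_tensor[OF identity_partition_in_partitions C_subset[OF strand_in_C]]) auto
    also have "\<dots> \<longleftrightarrow> xs = ys"
      using len s compatible_identity[of xs' k ys'] by (auto simp: compatible_def[of "{_}"])
    also have "\<dots> \<longleftrightarrow> compatible (identity_partition (Suc k)) xs ys"
      by (rule compatible_identity[OF len, symmetric])
    finally show "compatible ?t xs ys \<longleftrightarrow> compatible (identity_partition (Suc k)) xs ys" by (simp add: s)
  qed
  then show ?case using t by simp
qed

lemma tensor_entry_identity:
  "xs \<in> words N k \<Longrightarrow> ys \<in> words N k \<Longrightarrow> tensor_entry (identity_partition k) xs ys = of_bool (xs = ys)"
  by (simp add: tensor_entry_def compatible_identity words_def)

lemma compose_identity:
  assumes p: "p \<in> C k l"
  shows "loops p (identity_partition k) = 0" "compose p (identity_partition k) = p"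
    "loops (identity_partition l) p = 0" "compose (identity_partition l) p = p"
proof -
  note ic = identity_partition_in_C
  have "2 ^ loops p (identity_partition k) * tensor_entry (compose p (identity_partition k)) xs ys = 2 ^ 0 * tensor_entry p xs ys"
    if "xs \<in> words 2 k" "ys \<in> words 2 l" for xs ys
  proof -
    have "(\<Sum>u\<in>words 2 k. tensor_entry (identity_partition k) xs u * tensor_entry p u ys) =
        (\<Sum>u\<in>words 2 k. if u = xs then tensor_entry p xs ys else 0)"
      using that(1) by (intro sum.cong) (auto simp: tensor_entry_identity)
    then show ?thesis using sum_tensor_entry[OF ic p that] that(1) by simp
  qed
  then show "loops p (identity_partition k) = 0" "compose p (identity_partition k) = p"
    using eq_if_tensor_entries_eq[OF compose_in_C[OF ic p] p] by blast+
  have "2 ^ loops (identity_partition l) p * tensor_entry (compose (identity_partition l) p) xs ys = 2 ^ 0 * tensor_entry p xs ys"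
    if "xs \<in> words 2 k" "ys \<in> words 2 l" for xs ys
  proof -
    have "(\<Sum>u\<in>words 2 l. tensor_entry p xs u * tensor_entry (identity_partition l) u ys) =
        (\<Sum>u\<in>words 2 l. if u = ys then tensor_entry p xs ys else 0)"
      using that(2) by (intro sum.cong) (auto simp: tensor_entry_identity)
    then show ?thesis using sum_tensor_entry[OF p ic that] that(2) by simp
  qed
  then show "loops (identity_partition l) p = 0" "compose (identity_partition l) p = p"
    using eq_if_tensor_entries_eq[OF compose_in_C[OF p ic] p] by blast+
qed

section \<open>Definable relations\<close>

definition row :: "nat \<Rightarrow> (nat \<Rightarrow> nat) \<Rightarrow> nat list" where
  "row k f = map f [0..<k]"

lemma length_row[simp]: "length (row k f) = k"
  by (simp add: row_def)

lemma nth_row[simp]: "i < k \<Longrightarrow> row k f ! i = f i"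
  by (simp add: row_def)

lemma row_nth: "length xs = k \<Longrightarrow> row k (\<lambda>i. xs ! i) = xs"
  by (auto simp: row_def map_nth)

lemma row_cong: "(\<And>i. i < k \<Longrightarrow> f i = g i) \<Longrightarrow> row k f = row k g"
  by (simp add: row_def)

lemma row_add: "row (k + k') f = row k f @ row k' (\<lambda>i. f (k + i))"
  by (auto simp: list_eq_iff_nth_eq nth_append)

text \<open>Membership in \<open>C\<close> is proved by computing with relations, where tensor
  product and composition become conjunction and elimination of a middle row. Labels are arbitrary
  functions on the naturals, so no alphabet has to be fixed and rows can be reindexed
  freely.\<close>

definition definable :: "nat \<Rightarrow> nat \<Rightarrow> ((nat \<Rightarrow> nat) \<Rightarrow> (nat \<Rightarrow> nat) \<Rightarrow> bool) \<Rightarrow> bool" where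
  "definable k l R \<longleftrightarrow> (\<exists>p\<in>C k l. \<forall>f g. compatible p (row k f) (row l g) \<longleftrightarrow> R f g)"

lemma definable_cong: "definable k l R \<Longrightarrow> (\<And>f g. R f g \<longleftrightarrow> R' f g) \<Longrightarrow> definable k l R'"
  by (simp add: definable_def)

lemma definable_involution: "definable k l R \<Longrightarrow> definable l k (\<lambda>f g. R g f)"
  unfolding definable_def using involution_in_C compatible_involution by (metis (no_types, lifting))

lemma definable_tensor:
  assumes "definable k l R" "definable k' l' S"
  shows "definable (k + k') (l + l') (\<lambda>f g. R f g \<and> S (\<lambda>i. f (k + i)) (\<lambda>i. g (l + i)))"
proof -
  obtain p q where pq: "p \<in> C k l" "q \<in> C k' l'"
    and "\<And>f g. compatible p (row k f) (row l g) \<longleftrightarrow> R f g" "\<And>f g. compatible q (row k' f) (row l' g) \<longleftrightarrow> S f g"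
    using assms unfolding definable_def by blast
  then show ?thesis
    unfolding definable_def using tensor_in_C[OF pq]
    by (intro bexI[of _ "tensor k l p q"]) (simp_all add: row_add compatible_tensor[OF C_subset C_subset])
qed

lemma definable_compose:
  assumes "definable k l R" "definable l m S"
  shows "definable k m (\<lambda>f g. \<exists>h. R f h \<and> S h g)"
proof -
  obtain p q where pq: "p \<in> C k l" "q \<in> C l m"
    and R: "\<And>f g. R f g \<longleftrightarrow> compatible p (row k f) (row l g)" and S: "\<And>f g. S f g \<longleftrightarrow> compatible q (row l f) (row m g)"
    using assms unfolding definable_def by metis
  have "compatible (compose q p) (row k f) (row m g) \<longleftrightarrow> (\<exists>h. R f h \<and> S h g)" for f g
  proof
    \<comment> \<open>An alphabet containing all letters that occur; the added 0 keeps the maximum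
      defined when the rows are empty.\<close>
    define N where "N = Suc (Max (set (row k f) \<union> set (row m g) \<union> {0}))"
    have "row k f \<in> words N k" "row m g \<in> words N m" "0 < N"
      by (auto simp: words_def N_def less_Suc_eq_le)
    moreover assume "compatible (compose q p) (row k f) (row m g)"
    ultimately obtain ys where ys: "ys \<in> words N l" "compatible p (row k f) ys" "compatible q ys (row m g)"
      using compatible_compose[OF pq] by blast
    then have "R f (\<lambda>i. ys ! i) \<and> S (\<lambda>i. ys ! i) g" by (simp add: R S row_nth words_length)
    then show "\<exists>h. R f h \<and> S h g" by blast
  next
    assume "\<exists>h. R f h \<and> S h g"
    then obtain h where h: "R f h" "S h g" by blast
    define N where "N = Suc (Max (set (row k f) \<union> set (row m g) \<union> set (row l h) \<union> {0}))"
    have N: "row k f \<in> words N k" "row m g \<in> words N m" "row l h \<in> words N l" "0 < N"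
      by (auto simp: words_def N_def less_Suc_eq_le)
    show "compatible (compose q p) (row k f) (row m g)"
      unfolding compatible_compose[OF pq N(1,2,4)] using h N(3) by (auto simp: R S)
  qed
  then show ?thesis
    unfolding definable_def using compose_in_C[OF pq] by blast
qed

text \<open>Separates the arithmetic of row lengths and the elimination of the middle row from the
  composition itself.\<close>

lemma definable_composeI:
  "\<lbrakk>definable k l R; definable l' m S; l = l'; k = k'; m = m'; \<And>f g. (\<exists>h. R f h \<and> S h g) \<longleftrightarrow> T f g\<rbrakk>
    \<Longrightarrow> definable k' m' T"
  using definable_cong[OF definable_compose] by blast

lemma definable_identity: "definable k k (\<lambda>f g. \<forall>i<k. f i = g i)"
  unfolding definable_def
  by (intro bexI[OF _ identity_partition_in_C]) (auto simp: compatible_identity list_eq_iff_nth_eq)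

lemma definable_cap: "definable 2 0 (\<lambda>f g. f 0 = f 1)"
  unfolding definable_def by (intro bexI[OF _ cap_in_C]) (auto simp: compatible_def)

end

section \<open>Coarsenings\<close>

locale group_theoretical_category = partition_category +
  assumes group_theoretical: "group_theoretical C"
begin

text \<open>Read from top to bottom, the defining partition carries a pair of equal labels across
  one strand to its right.\<close>

lemma definable_shift_pair: "definable 3 3 (\<lambda>f g. f 0 = f 1 \<and> f 0 = g 1 \<and> f 0 = g 2 \<and> f 2 = g 0)"
  unfolding definable_def
proof (intro bexI allI)
  show "{{Upper 1, Upper 2, Lower 2, Lower 3}, {Upper 3, Lower 1}} \<in> C 3 3"
    using group_theoretical by (simp add: group_theoretical_def)
  show "compatible {{Upper 1, Upper 2, Lower 2, Lower 3}, {Upper 3, Lower 1}} (row 3 f) (row 3 g) \<longleftrightarrow>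
      f 0 = f 1 \<and> f 0 = g 1 \<and> f 0 = g 2 \<and> f 2 = g 0" for f g
    by (simp add: compatible_def) metis
qed

text \<open>A strand beside a pair, followed by the defining partition, which ties the strand to one
  end of the pair and thereby joins all points into one block.\<close>

lemma definable_triple: "definable 1 3 (\<lambda>f g. g 0 = f 0 \<and> g 1 = f 0 \<and> g 2 = f 0)"
proof -
  have "definable (1 + 0) (1 + 2) (\<lambda>f g. (\<forall>i<1. f i = g i) \<and> g (1 + 0) = g (1 + 1))"
    by (rule definable_tensor[OF definable_identity definable_involution[OF definable_cap]])
  then have "definable 1 3 (\<lambda>f g. f 0 = g 0 \<and> g 1 = g 2)"
    by (simp add: numeral_3_eq_3 numeral_2_eq_2)
  from definable_compose[OF this definable_shift_pair] show ?thesis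
  proof (rule definable_cong)
    fix f g :: "nat \<Rightarrow> nat"
    show "(\<exists>h. (f 0 = h 0 \<and> h 1 = h 2) \<and> h 0 = h 1 \<and> h 0 = g 1 \<and> h 0 = g 2 \<and> h 2 = g 0) \<longleftrightarrow>
        g 0 = f 0 \<and> g 1 = f 0 \<and> g 2 = f 0"
      by (auto intro!: exI[of _ "\<lambda>_. f 0"])
  qed
qed

text \<open>A strand branching into three, placed beside a second strand to which its third branch
  is capped.\<close>

lemma definable_four_block: "definable 2 2 (\<lambda>f g. f 0 = f 1 \<and> g 0 = f 0 \<and> g 1 = f 0)"
proof -
  have "definable (1 + 1) (3 + 1) (\<lambda>f g. (g 0 = f 0 \<and> g 1 = f 0 \<and> g 2 = f 0) \<and> (\<forall>i<1. f (1 + i) = g (3 + i)))"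
    by (rule definable_tensor[OF definable_triple definable_identity])
  moreover have "definable (2 + 2) (2 + 0) (\<lambda>f g. (\<forall>i<2. f i = g i) \<and> f (2 + 0) = f (2 + 1))"
    by (rule definable_tensor[OF definable_identity definable_cap])
  ultimately show ?thesis
  proof (rule definable_composeI)
    fix f g :: "nat \<Rightarrow> nat"
    show "(\<exists>h. ((h 0 = f 0 \<and> h 1 = f 0 \<and> h 2 = f 0) \<and> (\<forall>i<1. f (1 + i) = h (3 + i))) \<and>
      (\<forall>i<2. h i = g i) \<and> h (2 + 0) = h (2 + 1)) \<longleftrightarrow> f 0 = f 1 \<and> g 0 = f 0 \<and> g 1 = f 0"
      by (auto simp: numeral_2_eq_2 numeral_3_eq_3 less_Suc_eq intro!: exI[of _ "\<lambda>_. f 0"])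
  qed simp_all
qed

text \<open>Iterates the defining partition to carry a pair across \<open>d\<close> strands. For
  \<open>d = 0\<close> the pair is still joined to its copy, which is the block of four.\<close>

lemma definable_move_pair:
  "definable (d + 2) (d + 2) (\<lambda>f g. f 0 = f 1 \<and> (\<forall>i<d. g i = f (i + 2)) \<and> g d = f 0 \<and> g (d + 1) = f 0)"
proof (induction d)
  case 0
  then show ?case using definable_four_block by (simp add: numeral_2_eq_2)
next
  case (Suc d)
  have "definable (d + 2 + 1) (d + 2 + 1) (\<lambda>f g. (f 0 = f 1 \<and> (\<forall>i<d. g i = f (i + 2)) \<and> g d = f 0 \<and> g (d + 1) = f 0) \<and>
      (\<forall>i<1. f (d + 2 + i) = g (d + 2 + i)))"
    by (rule definable_tensor[OF Suc definable_identity])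
  moreover have "definable (d + 3) (d + 3) (\<lambda>f g. (\<forall>i<d. f i = g i) \<and>
      (f (d + 0) = f (d + 1) \<and> f (d + 0) = g (d + 1) \<and> f (d + 0) = g (d + 2) \<and> f (d + 2) = g (d + 0)))"
    by (rule definable_tensor[OF definable_identity definable_shift_pair])
  ultimately show ?case
  proof (rule definable_composeI)
    fix f g :: "nat \<Rightarrow> nat"
    \<comment> \<open>The middle row: the pair has crossed \<open>d\<close> strands and the last one
      is still to its right.\<close>
    let ?h = "\<lambda>i. if i < d then f (i + 2) else if i < d + 2 then f 0 else f (d + 2)"
    show "(\<exists>h. ((f 0 = f 1 \<and> (\<forall>i<d. h i = f (i + 2)) \<and> h d = f 0 \<and> h (d + 1) = f 0) \<and> (\<forall>i<1. f (d + 2 + i) = h (d + 2 + i))) \<and>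
     (\<forall>i<d. h i = g i) \<and> (h (d + 0) = h (d + 1) \<and> h (d + 0) = g (d + 1) \<and> h (d + 0) = g (d + 2) \<and> h (d + 2) = g (d + 0))) \<longleftrightarrow>
     f 0 = f 1 \<and> (\<forall>i<Suc d. g i = f (i + 2)) \<and> g (Suc d) = f 0 \<and> g (Suc d + 1) = f 0" (is "(\<exists>h. ?P h) \<longleftrightarrow> ?Q")
    proof
      assume ?Q
      then have 1: "?P ?h" by (auto simp: less_Suc_eq)
      show "\<exists>h. ?P h" by (rule exI[of _ ?h]) (rule 1)
    qed (auto simp: less_Suc_eq)
  qed simp_all
qed

text \<open>Point \<open>i\<close> branches into three, and two of the branches are carried to the
  right end. Two copies are made rather than one because it is pairs that the defining partition
  moves across strands.\<close>

lemma definable_copy: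
  assumes "i < k"
  shows "definable k (k + 2) (\<lambda>f g. (\<forall>j<k. g j = f j) \<and> g k = f i \<and> g (k + 1) = f i)"
proof -
  obtain d where k: "k = i + 1 + d" using assms by (metis Suc_eq_plus1 add.commute add_Suc_right less_iff_Suc_add)
  have "definable (i + (1 + d)) (i + (3 + d)) (\<lambda>f g. (\<forall>j<i. f j = g j) \<and>
     (g (i + 0) = f (i + 0) \<and> g (i + 1) = f (i + 0) \<and> g (i + 2) = f (i + 0)) \<and> (\<forall>j<d. f (i + (1 + j)) = g (i + (3 + j))))"
    by (rule definable_tensor[OF definable_identity definable_tensor[OF definable_triple definable_identity]])
  moreover have "definable (i + 1 + (d + 2)) (i + 1 + (d + 2)) (\<lambda>f g. (\<forall>j<i + 1. f j = g j) \<and>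
     (f (i + 1 + 0) = f (i + 1 + 1) \<and> (\<forall>j<d. g (i + 1 + j) = f (i + 1 + (j + 2))) \<and> g (i + 1 + d) = f (i + 1 + 0) \<and>
      g (i + 1 + (d + 1)) = f (i + 1 + 0)))"
    by (rule definable_tensor[OF definable_identity definable_move_pair])
  ultimately show ?thesis
  proof (rule definable_composeI)
    fix f g :: "nat \<Rightarrow> nat"
    \<comment> \<open>The row after branching: three copies of label \<open>i\<close> in places
      \<open>i\<close> to \<open>i + 2\<close>, with the later labels displaced by 2.\<close>
    let ?h = "\<lambda>j. if j < i then f j else if j < i + 3 then f i else f (j - 2)"
    show "(\<exists>h. ((\<forall>j<i. f j = h j) \<and>
     (h (i + 0) = f (i + 0) \<and> h (i + 1) = f (i + 0) \<and> h (i + 2) = f (i + 0)) \<and> (\<forall>j<d. f (i + (1 + j)) = h (i + (3 + j)))) \<and>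
     (\<forall>j<i + 1. h j = g j) \<and>
     (h (i + 1 + 0) = h (i + 1 + 1) \<and> (\<forall>j<d. g (i + 1 + j) = h (i + 1 + (j + 2))) \<and> g (i + 1 + d) = h (i + 1 + 0) \<and>
      g (i + 1 + (d + 1)) = h (i + 1 + 0))) \<longleftrightarrow> (\<forall>j<k. g j = f j) \<and> g k = f i \<and> g (k + 1) = f i" (is "(\<exists>h. ?P h) \<longleftrightarrow> ?Q")
    proof
      assume ?Q
      then have "f i = g i" "\<And>j. j < d \<Longrightarrow> g (Suc (i + j)) = f (Suc (i + j))" by (simp_all add: k)
      with \<open>?Q\<close> have 1: "?P ?h" by (auto simp: k less_Suc_eq)
      show "\<exists>h. ?P h" by (rule exI[of _ ?h]) (rule 1)
    next
      assume "\<exists>h. ?P h"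
      then obtain h where h: "?P h" ..
      have "g j = f j" if "j < k" for j
      proof -
        consider "j < i" | "j = i" | "i < j" by linarith
        then show ?thesis
        proof cases
          case 3
          define j' where "j' = j - i - 1"
          have j': "j = i + 1 + j'" "j' < d" using 3 that by (simp_all add: j'_def k)
          have "g (i + 1 + j') = h (i + 1 + (j' + 2))" "f (i + (1 + j')) = h (i + (3 + j'))"
            using h j'(2) by simp_all
          then show ?thesis by (simp add: j' numeral_3_eq_3)
        qed (use h in auto)
      qed
      moreover have "g k = f i" "g (k + 1) = f i" using h by (simp_all add: k)
      ultimately show ?Q by blast
    qed
  qed (simp_all add: k)
qed

text \<open>Two copies of the upper point are led past the partition on additional strands and then
  absorbed by the lower point through the reversed copy, which forces equality of the two labels.
  The hypothesis on \<open>R\<close> says that it sees only the labels on its rows.\<close>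

lemma definable_merge_upper_lower:
  assumes P: "definable k l R" and "i < k" "j < l"
    and R: "\<And>f f' g g'. (\<And>i. i < k \<Longrightarrow> f i = f' i) \<Longrightarrow> (\<And>i. i < l \<Longrightarrow> g i = g' i) \<Longrightarrow> R f g \<longleftrightarrow> R f' g'"
  shows "definable k l (\<lambda>f g. R f g \<and> f i = g j)"
proof -
  have "definable (k + 2) (l + 2) (\<lambda>f g. R f g \<and> (\<forall>n<2. f (k + n) = g (l + n)))"
    by (rule definable_tensor[OF P definable_identity])
  from definable_compose[OF definable_compose[OF definable_copy[OF \<open>i < k\<close>] this] definable_involution[OF definable_copy[OF \<open>j < l\<close>]]]
  show ?thesis
  proof (rule definable_cong)
    fix f g :: "nat \<Rightarrow> nat"
    show "(\<exists>h. (\<exists>h'. ((\<forall>j<k. h' j = f j) \<and> h' k = f i \<and> h' (k + 1) = f i) \<and> R h' h \<and> (\<forall>n<2. h' (k + n) = h (l + n))) \<and>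
        (\<forall>j<l. h j = g j) \<and> h l = g j \<and> h (l + 1) = g j) \<longleftrightarrow> R f g \<and> f i = g j" (is "?L \<longleftrightarrow> ?Q")
    proof
      assume ?L
      then obtain h h' where h: "\<forall>j<k. h' j = f j" "h' k = f i" "R h' h" "\<forall>n<2. h' (k + n) = h (l + n)"
        "\<forall>j<l. h j = g j" "h l = g j" by blast
      have "R f g" using h(3) R[of h' f h g] h(1,5) by blast
      moreover have "f i = g j" using h(4)[rule_format, of 0] h(2,6) by simp
      ultimately show ?Q by blast
    next
      assume Q: ?Q
      let ?h' = "\<lambda>n. if n < k then f n else f i" and ?h = "\<lambda>n. if n < l then g n else g j"
      have "R ?h' ?h" using Q R[of ?h' f ?h g] by simp
      then show ?L using Q by (intro exI[of _ ?h] conjI exI[of _ ?h']) auto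
    qed
  qed
qed

text \<open>On the identity partition an upper point may be replaced by the lower point below it, so
  this is a case of merging across rows.\<close>

lemma definable_merge_same_row:
  assumes "i < k" "j < k"
  shows "definable k k (\<lambda>f g. (\<forall>n<k. f n = g n) \<and> f i = f j)"
proof -
  have "definable k k (\<lambda>f g. (\<forall>n<k. f n = g n) \<and> f i = g j)"
    using assms by (intro definable_merge_upper_lower[OF definable_identity]) auto
  then show ?thesis by (rule definable_cong) (use assms in auto)
qed

text \<open>Points in different rows are merged directly; points in the same row by composing with
  an identity partition in which the two strands have been merged.\<close>

lemma merge_in_C:
  assumes p: "p \<in> C k l" and a: "a \<in> points k l" and b: "b \<in> points k l"
  shows "\<exists>q\<in>C k l. \<forall>xs ys. length xs = k \<longrightarrow> length ys = l \<longrightarrow>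
    (compatible q xs ys \<longleftrightarrow> compatible p xs ys \<and> label xs ys a = label xs ys b)"
proof -
  define R where "R f g = compatible p (row k f) (row l g)" for f g
  have P: "definable k l R" unfolding definable_def R_def using p by blast
  have R: "R f g \<longleftrightarrow> R f' g'" if "\<And>i. i < k \<Longrightarrow> f i = f' i" "\<And>i. i < l \<Longrightarrow> g i = g' i" for f f' g g'
    using row_cong[of k f f'] row_cong[of l g g'] that by (simp add: R_def)
  have ul: "definable k l (\<lambda>f g. R f g \<and> f i = g j)" if "i < k" "j < l" for i j
    by (rule definable_merge_upper_lower[OF P that R])
  have uu: "definable k l (\<lambda>f g. R f g \<and> f i = f j)" if "i < k" "j < k" for i j
    using definable_compose[OF definable_merge_same_row[OF that] P]
    by (rule definable_cong) (use R in blast)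
  have ll: "definable k l (\<lambda>f g. R f g \<and> g i = g j)" if ij: "i < l" "j < l" for i j
    using definable_compose[OF P definable_merge_same_row[OF that]]
  proof (rule definable_cong)
    fix f g :: "nat \<Rightarrow> nat"
    show "(\<exists>h. R f h \<and> (\<forall>n<l. h n = g n) \<and> h i = h j) \<longleftrightarrow> R f g \<and> g i = g j"
      using R ij by (metis (no_types, lifting))
  qed
  have "definable k l (\<lambda>f g. R f g \<and> label (row k f) (row l g) a = label (row k f) (row l g) b)"
  proof (cases a; cases b)
    fix i j assume ab: "a = Upper i" "b = Upper j"
    then have "i - 1 < k" "j - 1 < k" using a b by (auto simp: points_def)
    with uu[OF this] show ?thesis by (simp add: ab)
  next
    fix i j assume ab: "a = Upper i" "b = Lower j"
    then have "i - 1 < k" "j - 1 < l" using a b by (auto simp: points_def)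
    with ul[OF this] show ?thesis by (simp add: ab)
  next
    fix i j assume ab: "a = Lower i" "b = Upper j"
    then have "j - 1 < k" "i - 1 < l" using a b by (auto simp: points_def)
    with ul[OF this] show ?thesis by (simp add: ab eq_commute)
  next
    fix i j assume ab: "a = Lower i" "b = Lower j"
    then have "i - 1 < l" "j - 1 < l" using a b by (auto simp: points_def)
    with ll[OF this] show ?thesis by (simp add: ab)
  qed
  then obtain q where q: "q \<in> C k l" "\<And>f g. compatible q (row k f) (row l g) \<longleftrightarrow>
      R f g \<and> label (row k f) (row l g) a = label (row k f) (row l g) b"
    unfolding definable_def by blast
  have "compatible q xs ys \<longleftrightarrow> compatible p xs ys \<and> label xs ys a = label xs ys b"
    if "length xs = k" "length ys = l" for xs ys
    using q(2)[of "\<lambda>i. xs ! i" "\<lambda>i. ys ! i"] that by (simp add: R_def row_nth)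
  then show ?thesis using q(1) by blast
qed

text \<open>The finitely many pairs of points lying in a common block of \<open>s\<close> are merged
  one after another. The result requires compatibility with both \<open>p\<close> and
  \<open>s\<close>, which is compatibility with \<open>s\<close> since \<open>p\<close> refines
  \<open>s\<close>.\<close>

theorem coarsening_in_C:
  assumes p: "p \<in> C k l" and s: "s \<in> partitions k l" and ps: "refines (points k l) p s"
  shows "s \<in> C k l"
proof -
  define Z where "Z = (\<Union>B\<in>s. B \<times> B)"
  have "\<exists>q\<in>C k l. \<forall>xs ys. length xs = k \<longrightarrow> length ys = l \<longrightarrow>
    (compatible q xs ys \<longleftrightarrow> compatible p xs ys \<and> (\<forall>(a, b)\<in>Y. label xs ys a = label xs ys b))"
    if "finite Y" "Y \<subseteq> Z" for Y
    using that
  proof (induction Y)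
    case empty
    then show ?case using p by auto
  next
    case (insert ab Y)
    obtain q where q: "q \<in> C k l" "\<And>xs ys. length xs = k \<Longrightarrow> length ys = l \<Longrightarrow>
      (compatible q xs ys \<longleftrightarrow> compatible p xs ys \<and> (\<forall>(a, b)\<in>Y. label xs ys a = label xs ys b))"
      using insert by auto
    obtain a b where ab: "ab = (a, b)" by (cases ab)
    then have "a \<in> points k l" "b \<in> points k l"
      using insert.prems partitions_Union[OF s] unfolding Z_def by blast+
    from merge_in_C[OF q(1) this] obtain r where r: "r \<in> C k l" "\<And>xs ys. length xs = k \<Longrightarrow> length ys = l \<Longrightarrow>
        (compatible r xs ys \<longleftrightarrow> compatible q xs ys \<and> label xs ys a = label xs ys b)"
      by blast
    then show ?case using q(2) by (intro bexI[OF _ r(1)]) (auto simp: ab)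
  qed
  moreover have "Z \<subseteq> points k l \<times> points k l"
    using partitions_Union[OF s] unfolding Z_def by blast
  then have "finite Z" by (rule finite_subset) (simp add: points_def)
  ultimately obtain q where q: "q \<in> C k l" "\<And>xs ys. length xs = k \<Longrightarrow> length ys = l \<Longrightarrow>
      (compatible q xs ys \<longleftrightarrow> compatible p xs ys \<and> (\<forall>(a, b)\<in>Z. label xs ys a = label xs ys b))"
    by blast
  have "(\<forall>(a, b)\<in>Z. label xs ys a = label xs ys b) \<longleftrightarrow> compatible s xs ys" for xs ys
    unfolding Z_def compatible_def by auto
  then have "q = s"
    using q(2) compatible_refines[OF ps]
    by (intro partition_eqI[OF C_subset[OF q(1)] s]) (auto simp: words_length)
  then show ?thesis using q(1) by simp
qed

end

section \<open>The Gram matrix\<close>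

text \<open>The upper row is turned down in front of the lower row without reversing its order, so
  that a pair of words on the two rows corresponds to their concatenation.\<close>

fun bend_point :: "nat \<Rightarrow> point \<Rightarrow> point" where
  "bend_point k (Upper i) = Lower i"
| "bend_point k (Lower j) = Lower (k + j)"

definition bend :: "nat \<Rightarrow> partition \<Rightarrow> partition" where
  "bend k p = (\<lambda>B. bend_point k ` B) ` p"

lemma bend_in_partitions:
  assumes "p \<in> partitions k l"
  shows "bend k p \<in> partitions 0 (k + l)"
proof -
  have inj: "inj_on (bend_point k) (points k l)"
    by (rule inj_onI) (auto simp: points_def)
  have "bend_point k ` points k l = points 0 (k + l)"
  proof -
    have "bend_point k ` points k l = Lower ` ({1..k} \<union> (\<lambda>j. k + j) ` {1..l})"
      by (simp only: points_def image_Un image_image bend_point.simps)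
    also have "{1..k} \<union> (\<lambda>j. k + j) ` {1..l} = {1..k + l}"
      by (simp add: image_add_atLeastAtMost) auto
    finally show ?thesis by (simp add: points_def)
  qed
  moreover have "partition_on (bend_point k ` points k l) ((`) (bend_point k) ` p - {{}})"
    using assms inj by (intro partition_on_inj_image) (simp_all add: partitions_def)
  moreover have "(`) (bend_point k) ` p - {{}} = bend k p"
    using assms by (auto simp: bend_def partitions_def partition_on_def)
  ultimately show ?thesis by (simp add: partitions_def)
qed

lemma compatible_bend:
  assumes "p \<in> partitions k l" "length xs = k"
  shows "compatible (bend k p) [] (xs @ ys) \<longleftrightarrow> compatible p xs ys"
proof -
  have "label [] (xs @ ys) (bend_point k a) = label xs ys a" if "a \<in> B" "B \<in> p" for a B
  proof -
    have "a \<in> points k l" using that partitions_Union[OF assms(1)] by blast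
    then show ?thesis using assms(2) by (auto simp: points_def nth_append)
  qed
  then show ?thesis by (simp add: compatible_def bend_def)
qed

lemma words_append: "bij_betw (\<lambda>(xs, ys). xs @ ys) (words N k \<times> words N l) (words N (k + l))"
proof (rule bij_betw_byWitness[where f' = "\<lambda>zs. (take k zs, drop k zs)"])
  have "set (take k zs) \<subseteq> set zs" "set (drop k zs) \<subseteq> set zs" for zs :: "nat list"
    by (rule set_take_subset) (rule set_drop_subset)
  then show "(\<lambda>zs. (take k zs, drop k zs)) ` words N (k + l) \<subseteq> words N k \<times> words N l"
    unfolding words_def by fastforce
qed (auto simp: words_def)

text \<open>After bending, all points lie on the middle row, so this is the number of blocks of the
  join of \<open>p\<close> and \<open>q\<close>: the exponent in the Gram matrix.\<close>

definition pairing :: "nat \<Rightarrow> partition \<Rightarrow> partition \<Rightarrow> nat" where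
  "pairing k p q = loops (involution (bend k q)) (bend k p)"

lemma involution_in_partitions:
  assumes "p \<in> partitions k l"
  shows "involution p \<in> partitions l k"
proof -
  have "flip (flip a) = a" for a by (cases a) auto
  then have "inj flip" by (rule inj_on_inverseI)
  have "flip ` points k l = points l k" by (auto simp: points_def image_Un image_image)
  moreover have "partition_on (flip ` points k l) ((`) flip ` p - {{}})"
    using assms \<open>inj flip\<close> by (intro partition_on_inj_image) (auto simp: partitions_def inj_on_def)
  moreover have "(`) flip ` p - {{}} = involution p"
    using assms by (auto simp: involution_def partitions_def partition_on_def)
  ultimately show ?thesis by (simp add: partitions_def)
qed

lemma card_common_words:
  assumes p: "p \<in> partitions k l" and q: "q \<in> partitions k l"
  shows "card {(xs, ys) \<in> words N k \<times> words N l. compatible p xs ys \<and> compatible q xs ys} = N ^ pairing k p q"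
proof -
  note b = bend_in_partitions[OF p] involution_in_partitions[OF bend_in_partitions[OF q]]
  let ?A = "\<lambda>N. {zs \<in> words N (k + l). compatible (bend k p) [] zs \<and> compatible (involution (bend k q)) zs []}"
  have card: "card (?A N) = (if compatible (compose (involution (bend k q)) (bend k p)) [] [] then N ^ pairing k p q else 0)" for N
    unfolding pairing_def by (rule card_middle_words[OF b]) simp_all
  \<comment> \<open>With one letter the constant word is counted, so the count is not 0; this
    excludes the second branch of \<open>card\<close>, a condition that does not involve
    \<open>N\<close>.\<close>
  have "replicate (k + l) 0 \<in> ?A 1"
    using compatible_replicate[OF b(1), of 0] compatible_replicate[OF b(2), of 0] by (simp add: replicate_in_words)
  then have "card (?A 1) \<noteq> 0" by (auto simp: card_eq_0_iff)
  then have "compatible (compose (involution (bend k q)) (bend k p)) [] []" using card[of 1] by presburger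
  then have "card (?A N) = N ^ pairing k p q" using card[of N] by simp
  moreover have "card (?A N) = card {(xs, ys) \<in> words N k \<times> words N l. compatible p xs ys \<and> compatible q xs ys}"
  proof -
    let ?B = "{(xs, ys) \<in> words N k \<times> words N l. compatible p xs ys \<and> compatible q xs ys}"
    have "?A N = (\<lambda>(xs, ys). xs @ ys) ` ?B"
    proof -
      have "?A N = {zs \<in> (\<lambda>(xs, ys). xs @ ys) ` (words N k \<times> words N l).
          compatible (bend k p) [] zs \<and> compatible (involution (bend k q)) zs []}"
        using words_append[of N k l] by (simp add: bij_betw_def)
      also have "\<dots> = (\<lambda>(xs, ys). xs @ ys) ` ?B"
        using compatible_bend[OF p] compatible_bend[OF q] by (auto simp: compatible_involution words_length image_iff)
      finally show ?thesis .
    qed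
    moreover have "inj_on (\<lambda>(xs, ys). xs @ ys) ?B"
      using words_append[of N k l] by (auto simp: bij_betw_def intro: inj_on_subset)
    ultimately show ?thesis by (simp add: card_image)
  qed
  ultimately show ?thesis by simp
qed

text \<open>The coarsest partition compatible with the two words.\<close>

definition label_kernel :: "nat \<Rightarrow> nat \<Rightarrow> nat list \<Rightarrow> nat list \<Rightarrow> partition" where
  "label_kernel k l xs ys = (\<lambda>a. {b \<in> points k l. label xs ys b = label xs ys a}) ` points k l"

lemma label_kernel_in_partitions: "label_kernel k l xs ys \<in> partitions k l"
  unfolding partitions_def
proof (rule CollectI, rule partition_onI)
  show "\<Union>(label_kernel k l xs ys) = points k l" by (auto simp: label_kernel_def)
  show "{} \<notin> label_kernel k l xs ys" by (auto simp: label_kernel_def)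
  show "disjnt B B'" if "B \<in> label_kernel k l xs ys" "B' \<in> label_kernel k l xs ys" "B \<noteq> B'" for B B'
    using that by (auto simp: label_kernel_def disjnt_def)
qed

lemma compatible_iff_refines:
  assumes p: "p \<in> partitions k l"
  shows "compatible p xs ys \<longleftrightarrow> refines (points k l) p (label_kernel k l xs ys)"
proof
  assume c: "compatible p xs ys"
  show "refines (points k l) p (label_kernel k l xs ys)"
    unfolding refines_def
  proof (intro conjI ballI)
    fix B assume B: "B \<in> p"
    then obtain a where "a \<in> B" using partitions_nonempty[OF p] by blast
    have "B \<subseteq> {b \<in> points k l. label xs ys b = label xs ys a}"
      using c B \<open>a \<in> B\<close> partitions_Union[OF p] unfolding compatible_def by blast
    moreover have "a \<in> points k l" using B \<open>a \<in> B\<close> partitions_Union[OF p] by blast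
    ultimately show "\<exists>B'\<in>label_kernel k l xs ys. B \<subseteq> B'" unfolding label_kernel_def by blast
  qed (use p label_kernel_in_partitions in \<open>auto simp: partitions_def\<close>)
next
  assume "refines (points k l) p (label_kernel k l xs ys)"
  moreover have "compatible (label_kernel k l xs ys) xs ys" by (auto simp: compatible_def label_kernel_def)
  ultimately show "compatible p xs ys" by (rule compatible_refines)
qed

definition falling_factorial :: "'a::comm_ring_1 \<Rightarrow> nat \<Rightarrow> 'a" where
  "falling_factorial x n = (\<Prod>i<n. x - of_nat i)"

text \<open>The truncated subtraction on the right is harmless: once \<open>n\<close> exceeds
  \<open>N\<close>, both products contain the factor 0 at \<open>i = N\<close>.\<close>

lemma falling_factorial_of_nat:
  "falling_factorial (of_nat N) n = (of_nat (\<Prod>i<n. N - i) :: 'a::comm_ring_1)"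
proof (cases "n \<le> N")
  case True
  then show ?thesis by (simp add: falling_factorial_def of_nat_diff)
next
  case False
  then have "(\<Prod>i<n. N - i) = 0" "(\<Prod>i<n. of_nat N - of_nat i :: 'a) = 0"
    by (auto intro!: prod_zero bexI[of _ N])
  then show ?thesis by (simp only: falling_factorial_def of_nat_0)
qed

text \<open>Words with kernel exactly \<open>s\<close> are injective assignments of letters to the
  blocks of \<open>s\<close>: distinct blocks must carry distinct letters. \<open>F\<close> reads
  off the letters of the blocks and \<open>G\<close> spreads them over the points.\<close>

lemma card_label_kernel:
  assumes s: "s \<in> partitions k l"
  shows "card {(xs, ys) \<in> words N k \<times> words N l. label_kernel k l xs ys = s} = (\<Prod>i<card s. N - i)"
proof -
  let ?A = "{(xs, ys) \<in> words N k \<times> words N l. label_kernel k l xs ys = s}"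
  let ?I = "{f \<in> s \<rightarrow>\<^sub>E {..<N}. inj_on f s}"
  define block where "block a = (THE B. B \<in> s \<and> a \<in> B)" for a
  have block: "block a \<in> s" "a \<in> block a" if a: "a \<in> points k l" for a
  proof -
    obtain B where "B \<in> s" "a \<in> B" using a partitions_Union[OF s] by blast
    then have "\<exists>!B. B \<in> s \<and> a \<in> B" using partitions_same_block[OF s] by blast
    from theI'[OF this] show "block a \<in> s" "a \<in> block a" by (simp_all add: block_def)
  qed
  have block_eq: "block a = B" if "B \<in> s" "a \<in> B" for a B
    using that partitions_same_block[OF s] block[of a] partitions_Union[OF s] by blast
  have some: "(SOME a. a \<in> B) \<in> B" if "B \<in> s" for B
    using partitions_nonempty[OF s that] by (simp add: some_in_eq ex_in_conv)
  have in_points: "a \<in> points k l" if "B \<in> s" "a \<in> B" for a B using that partitions_Union[OF s] by blast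
  define F where "F = (\<lambda>(xs, ys). restrict (\<lambda>B. label xs ys (SOME a. a \<in> B)) s)"
  define G where "G f = (map (\<lambda>i. f (block (Upper (Suc i)))) [0..<k], map (\<lambda>j. f (block (Lower (Suc j)))) [0..<l])" for f :: "point set \<Rightarrow> nat"
  have label_eq: "label xs ys a = label xs ys b \<longleftrightarrow> block a = block b"
    if "label_kernel k l xs ys = s" "a \<in> points k l" "b \<in> points k l" for xs ys a b
  proof -
    have B: "{c \<in> points k l. label xs ys c = label xs ys a} \<in> s" using that by (auto simp: label_kernel_def)
    have "block a = {c \<in> points k l. label xs ys c = label xs ys a}" using that by (intro block_eq[OF B]) auto
    moreover have "b \<in> block b" using block that by blast
    ultimately show ?thesis
    proof -
      assume a: "block a = {c \<in> points k l. label xs ys c = label xs ys a}" and b: "b \<in> block b"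
      show ?thesis
      proof
        assume "label xs ys a = label xs ys b"
        then have "b \<in> {c \<in> points k l. label xs ys c = label xs ys a}" using that(3) by simp
        from block_eq[OF B this] a show "block a = block b" by simp
      next
        assume "block a = block b"
        then have "b \<in> {c \<in> points k l. label xs ys c = label xs ys a}" using a b by simp
        then show "label xs ys a = label xs ys b" by simp
      qed
    qed
  qed
  have G_label: "label (fst (G f)) (snd (G f)) a = f (block a)" if "a \<in> points k l" for f a
    unfolding G_def fst_conv snd_conv by (rule label_map[OF that])
  have "bij_betw F ?A ?I"
  proof (rule bij_betw_byWitness[where f' = G])
    show "\<forall>x\<in>?A. G (F x) = x"
    proof
      fix x assume "x \<in> ?A"
      then obtain xs ys where x: "x = (xs, ys)" "xs \<in> words N k" "ys \<in> words N l" "label_kernel k l xs ys = s" by auto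
      have "F x (block a) = label xs ys a" if "a \<in> points k l" for a
      proof -
        have "label xs ys (SOME c. c \<in> block a) = label xs ys a"
        proof -
          have c: "(SOME c. c \<in> block a) \<in> block a" by (rule some[OF block(1)[OF that]])
          show ?thesis
            using label_eq[OF x(4) in_points[OF block(1)[OF that] c] that] block_eq[OF block(1)[OF that] c] by simp
        qed
        then show ?thesis using block[OF that] by (simp add: F_def x)
      qed
      then show "G (F x) = x"
        using x by (auto simp: G_def words_def points_def list_eq_iff_nth_eq)
    qed
  next
    show "\<forall>f\<in>?I. F (G f) = f"
    proof
      fix f assume f: "f \<in> ?I"
      show "F (G f) = f"
      proof
        fix B show "F (G f) B = f B"
        proof (cases "B \<in> s")
          case True
          then show ?thesis
            using G_label[OF in_points[OF True some[OF True]], of f] block_eq[OF True some[OF True]]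
            by (simp add: F_def case_prod_beta)
        next
          case False
          then show ?thesis using f by (auto simp: F_def case_prod_beta PiE_def extensional_def)
        qed
      qed
    qed
  next
    show "F ` ?A \<subseteq> ?I"
    proof (rule image_subsetI)
      fix x assume "x \<in> ?A"
      then obtain xs ys where x: "x = (xs, ys)" "xs \<in> words N k" "ys \<in> words N l" "label_kernel k l xs ys = s" by auto
      have "inj_on (F x) s"
      proof (rule inj_onI)
        fix B B' assume "B \<in> s" "B' \<in> s" "F x B = F x B'"
        then show "B = B'"
          using label_eq[OF x(4) in_points[OF \<open>B \<in> s\<close> some] in_points[OF \<open>B' \<in> s\<close> some]]
            block_eq[OF \<open>B \<in> s\<close> some] block_eq[OF \<open>B' \<in> s\<close> some] by (simp add: F_def x)
      qed
      moreover have "F x \<in> s \<rightarrow>\<^sub>E {..<N}"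
        using label_less[OF x(2,3)] in_points some by (auto simp: F_def x restrict_PiE_iff)
      ultimately show "F x \<in> ?I" by blast
    qed
  next
    show "G ` ?I \<subseteq> ?A"
    proof (rule image_subsetI)
      fix f assume f: "f \<in> ?I"
      then have fN: "f (block a) < N" if "a \<in> points k l" for a using block(1)[OF that] by auto
      have f_eq: "f (block a) = f (block b) \<longleftrightarrow> block a = block b" if "a \<in> points k l" "b \<in> points k l" for a b
        using f block(1)[OF that(1)] block(1)[OF that(2)] by (auto simp: inj_on_def)
      have "{b \<in> points k l. label (fst (G f)) (snd (G f)) b = label (fst (G f)) (snd (G f)) a} = block a"
        if a: "a \<in> points k l" for a
      proof (intro set_eqI iffI)
        fix b assume "b \<in> {b \<in> points k l. label (fst (G f)) (snd (G f)) b = label (fst (G f)) (snd (G f)) a}"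
        then have b: "b \<in> points k l" and "label (fst (G f)) (snd (G f)) b = label (fst (G f)) (snd (G f)) a" by simp_all
        then have "f (block b) = f (block a)" using a by (simp add: G_label)
        then have "block b = block a" using f_eq[OF b a] by blast
        then show "b \<in> block a" using block(2)[OF b] by simp
      next
        fix b assume b: "b \<in> block a"
        have bp: "b \<in> points k l" by (rule in_points[OF block(1)[OF a] b])
        have "block b = block a" by (rule block_eq[OF block(1)[OF a] b])
        then show "b \<in> {b \<in> points k l. label (fst (G f)) (snd (G f)) b = label (fst (G f)) (snd (G f)) a}"
          using a bp by (simp add: G_label)
      qed
      then have "label_kernel k l (fst (G f)) (snd (G f)) = block ` points k l" by (simp add: label_kernel_def)
      also have "\<dots> = s"
      proof
        show "block ` points k l \<subseteq> s" using block(1) by blast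
        show "s \<subseteq> block ` points k l"
        proof
          fix B assume B: "B \<in> s"
          show "B \<in> block ` points k l"
            using block_eq[OF B some[OF B]] in_points[OF B some[OF B]] by (metis imageI)
        qed
      qed
      finally show "G f \<in> ?A" using fN by (auto simp: G_def words_def points_def)
    qed
  qed
  then have "card ?A = card ?I" by (rule bij_betw_same_card)
  moreover have "finite s"
    using s finite_UnionD[of s] partitions_Union[OF s] by (simp add: points_def)
  ultimately show ?thesis
    using card_inj_on_subset_funcset[of s "{..<N}" s] by (simp add: atLeast0LessThan)
qed

section \<open>Factorization of the Gram matrix through the refinement order\<close>

context group_theoretical_category
begin

text \<open>The Gram matrix of the trace form factors through the order: both sides are polynomials
  in \<open>t\<close>, and for \<open>t = N\<close> the words counted on the left are sorted by their kernel.\<close>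

lemma pairing_expansion:
  fixes t :: complex
  assumes p: "p \<in> C k l" and q: "q \<in> C k l"
  shows "t ^ pairing k p q = (\<Sum>s | s \<in> C k l \<and> refines (points k l) p s \<and> refines (points k l) q s. falling_factorial t (card s))"
proof -
  let ?S = "{s. s \<in> C k l \<and> refines (points k l) p s \<and> refines (points k l) q s}"
  have fin: "finite ?S" by (rule finite_subset[of _ "C k l"]) auto
  have nat: "N ^ pairing k p q = (\<Sum>s\<in>?S. \<Prod>i<card s. N - i)" for N :: nat
  proof -
    let ?A = "{(xs, ys) \<in> words N k \<times> words N l. compatible p xs ys \<and> compatible q xs ys}"
    let ?g = "\<lambda>(xs, ys). label_kernel k l xs ys"
    have finA: "finite ?A" by (rule finite_subset[of _ "words N k \<times> words N l"]) auto
    \<comment> \<open>Kernels of words compatible with \<open>p\<close> are coarsenings of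
      \<open>p\<close>; this is where closure under coarsening enters.\<close>
    have "?g ` ?A \<subseteq> ?S"
      using coarsening_in_C[OF p label_kernel_in_partitions]
      by (auto simp: compatible_iff_refines[OF C_subset[OF p]] compatible_iff_refines[OF C_subset[OF q]])
    then have "card ?A = (\<Sum>s\<in>?S. card {x \<in> ?A. ?g x = s})"
      using sum.group[OF finA fin, of ?g "\<lambda>_. 1 :: nat"] by simp
    also have "\<dots> = (\<Sum>s\<in>?S. card {(xs, ys) \<in> words N k \<times> words N l. label_kernel k l xs ys = s})"
    proof (intro sum.cong refl arg_cong[where f = card])
      fix s assume "s \<in> ?S"
      then show "{x \<in> ?A. ?g x = s} = {(xs, ys) \<in> words N k \<times> words N l. label_kernel k l xs ys = s}"
        by (auto simp: compatible_iff_refines[OF C_subset[OF p]] compatible_iff_refines[OF C_subset[OF q]])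
    qed
    also have "\<dots> = (\<Sum>s\<in>?S. \<Prod>i<card s. N - i)"
      by (intro sum.cong refl card_label_kernel) (auto dest: C_subset)
    finally show ?thesis using card_common_words[OF C_subset[OF p] C_subset[OF q]] by simp
  qed
  \<comment> \<open>The difference of both sides as a polynomial in the parameter; it vanishes at
    all naturals, hence identically.\<close>
  define P where "P = monom 1 (pairing k p q) - (\<Sum>s\<in>?S. \<Prod>i<card s. [:- of_nat i, 1:] :: complex poly)"
  have polyP: "poly P x = x ^ pairing k p q - (\<Sum>s\<in>?S. falling_factorial x (card s))" for x
    by (simp add: P_def poly_monom poly_sum poly_prod falling_factorial_def)
  have "poly P (of_nat N) = 0" for N
    unfolding polyP using arg_cong[OF nat[of N], of "of_nat :: nat \<Rightarrow> complex"] by (simp add: falling_factorial_of_nat del: of_nat_prod)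
  then have "range of_nat \<subseteq> {x. poly P x = 0}" by auto
  moreover have "infinite (range (of_nat :: nat \<Rightarrow> complex))" by (simp add: finite_image_iff inj_on_def)
  ultimately have "infinite {x. poly P x = 0}" using finite_subset by blast
  then have "P = 0" using poly_roots_finite by blast
  then show ?thesis using polyP[of t] by simp
qed

text \<open>Strictly increasing along proper refinement inside \<open>C\<close>, so that extremal
  elements and induction over the order can be handled by natural numbers.\<close>

definition rank :: "nat \<Rightarrow> nat \<Rightarrow> partition \<Rightarrow> nat" where
  "rank k l s = card {p \<in> C k l. refines (points k l) p s}"

lemma refines_self:
  assumes "p \<in> C k l"
  shows "refines (points k l) p p"
  using C_subset[OF assms] by (intro refines_refl) (simp add: partitions_def)

lemma rank_less:
  assumes "p \<in> C k l" "s \<in> C k l" "refines (points k l) p s" "p \<noteq> s"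
  shows "rank k l p < rank k l s"
  unfolding rank_def
proof (rule psubset_card_mono)
  have "\<not> refines (points k l) s p" using refines_asym assms by blast
  moreover have "refines (points k l) q s" if "refines (points k l) q p" for q
    using that assms(3) unfolding refines_def by (meson subset_trans)
  ultimately show "{q \<in> C k l. refines (points k l) q p} \<subset> {q \<in> C k l. refines (points k l) q s}"
    using refines_self[OF assms(2)] assms(2) by blast
qed simp

text \<open>The zeta transform for the refinement order.\<close>

definition cumulative :: "nat \<Rightarrow> nat \<Rightarrow> (partition \<Rightarrow> complex) \<Rightarrow> partition \<Rightarrow> complex" where
  "cumulative k l f s = (\<Sum>p | p \<in> C k l \<and> refines (points k l) p s. f p)"

lemma finite_C_Collect[simp]: "finite {p. p \<in> C k l \<and> P p}"
  by (rule finite_subset[OF _ finite_C[of k l]]) blast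

text \<open>The factorization of the Gram matrix applied to a vector: zeta transform, multiplication
  by falling factorials, and the transposed zeta transform, obtained by exchanging the sums in
  \<open>pairing_expansion\<close>.\<close>

lemma sum_pairing:
  assumes q: "q \<in> C k l"
  shows "(\<Sum>p\<in>C k l. f p * t ^ pairing k p q) =
    (\<Sum>s | s \<in> C k l \<and> refines (points k l) q s. falling_factorial t (card s) * cumulative k l f s)"
proof -
  have "(\<Sum>p\<in>C k l. f p * t ^ pairing k p q) =
      (\<Sum>p\<in>C k l. \<Sum>s | s \<in> {s. s \<in> C k l \<and> refines (points k l) q s} \<and> refines (points k l) p s. falling_factorial t (card s) * f p)"
    by (intro sum.cong refl) (auto simp: pairing_expansion[OF _ q] sum_distrib_left mult.commute intro!: sum.cong)
  also have "\<dots> = (\<Sum>s | s \<in> C k l \<and> refines (points k l) q s. \<Sum>p | p \<in> C k l \<and> refines (points k l) p s. falling_factorial t (card s) * f p)"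
    by (rule sum.swap_restrict) simp_all
  finally show ?thesis by (simp add: cumulative_def sum_distrib_left)
qed

text \<open>At an element of the support of \<open>f\<close> of least rank,
  \<open>cumulative\<close> equals \<open>f\<close>, so the transform is not 0. At an element
  \<open>s\<close> of greatest rank where the transform is not 0, the sum for \<open>q = s\<close>
  has the single term at \<open>s\<close>, and its falling factorial is nonzero for \<open>t\<close>
  outside the naturals.\<close>

lemma pairing_nondegenerate:
  fixes t :: complex
  assumes t: "t \<notin> \<nat>" and f: "\<And>p. p \<notin> C k l \<Longrightarrow> f p = 0" and "f \<noteq> (\<lambda>_. 0)"
  shows "\<exists>q\<in>C k l. (\<Sum>p\<in>C k l. f p * t ^ pairing k p q) \<noteq> 0"
proof -
  let ?S = "{p. p \<in> C k l \<and> f p \<noteq> 0}" and ?T = "{s. s \<in> C k l \<and> cumulative k l f s \<noteq> 0}"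
  have "?S \<noteq> {}"
  proof
    assume "?S = {}"
    then have "f p = 0" for p using f by blast
    then show False using assms(3) by auto
  qed
  then have "Min (rank k l ` ?S) \<in> rank k l ` ?S" by (intro Min_in) auto
  then obtain p where p: "p \<in> ?S" "rank k l p = Min (rank k l ` ?S)" by auto
  have "cumulative k l f p = (\<Sum>q\<in>{p}. f q)"
    unfolding cumulative_def
  proof (rule sum.mono_neutral_right)
    show "\<forall>q\<in>{q. q \<in> C k l \<and> refines (points k l) q p} - {p}. f q = 0"
    proof (rule ballI, rule ccontr)
      fix q assume q: "q \<in> {q. q \<in> C k l \<and> refines (points k l) q p} - {p}" "f q \<noteq> 0"
      then have "rank k l q < rank k l p" using p by (intro rank_less) auto
      moreover have "Min (rank k l ` ?S) \<le> rank k l q" using q by (intro Min_le) auto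
      ultimately show False using p by simp
    qed
  qed (use p refines_self in auto)
  then have "p \<in> ?T" using p by simp
  then have "Max (rank k l ` ?T) \<in> rank k l ` ?T" by (intro Max_in) auto
  then obtain s where s: "s \<in> ?T" "rank k l s = Max (rank k l ` ?T)" by auto
  have "(\<Sum>p\<in>C k l. f p * t ^ pairing k p s) =
      (\<Sum>u | u \<in> C k l \<and> refines (points k l) s u. falling_factorial t (card u) * cumulative k l f u)"
    using s by (intro sum_pairing) simp
  also have "\<dots> = (\<Sum>u\<in>{s}. falling_factorial t (card u) * cumulative k l f u)"
  proof (rule sum.mono_neutral_right)
    show "\<forall>u\<in>{u. u \<in> C k l \<and> refines (points k l) s u} - {s}. falling_factorial t (card u) * cumulative k l f u = 0"
    proof (rule ballI, rule ccontr)
      fix u assume u: "u \<in> {u. u \<in> C k l \<and> refines (points k l) s u} - {s}"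
        "falling_factorial t (card u) * cumulative k l f u \<noteq> 0"
      then have "rank k l s < rank k l u" using s by (intro rank_less) auto
      moreover have "rank k l u \<le> Max (rank k l ` ?T)" using u by (intro Max_ge) auto
      ultimately show False using s by simp
    qed
  qed (use s refines_self in auto)
  also have "\<dots> \<noteq> 0" using s t by (auto simp: falling_factorial_def)
  finally show ?thesis using s by blast
qed

text \<open>Moebius inversion, carried out by solving for the values of \<open>f\<close> in order of
  increasing rank.\<close>

lemma ex_cumulative_delta:
  assumes "s \<in> C k l"
  shows "\<exists>f. (\<forall>p. p \<notin> C k l \<longrightarrow> f p = 0) \<and> (\<forall>u\<in>C k l. cumulative k l f u = (if u = s then 1 else 0))"
proof -
  have "\<exists>f. (\<forall>p. p \<notin> C k l \<longrightarrow> f p = 0) \<and> (\<forall>u\<in>C k l. rank k l u \<le> n \<longrightarrow> cumulative k l f u = (if u = s then 1 else 0))" for n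
  proof (induction n)
    case 0
    have "0 < rank k l u" if "u \<in> C k l" for u
      using refines_self[OF that] that by (auto simp: rank_def card_gt_0_iff)
    then show ?case by (intro exI[of _ "\<lambda>_. 0"]) force
  next
    case (Suc n)
    then obtain f where f: "\<And>p. p \<notin> C k l \<Longrightarrow> f p = 0"
      "\<And>u. u \<in> C k l \<Longrightarrow> rank k l u \<le> n \<Longrightarrow> cumulative k l f u = (if u = s then 1 else 0)" by blast
    let ?L = "\<lambda>u. {p. p \<in> C k l \<and> refines (points k l) p u}"
    \<comment> \<open>Only values of rank \<open>Suc n\<close> are altered, and proper refinements
      have smaller rank; so the transforms already adjusted remain unchanged.\<close>
    define g where "g u = (if u \<in> C k l \<and> rank k l u = Suc n then (if u = s then 1 else 0) - (\<Sum>p\<in>?L u - {u}. f p) else f u)" for u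
    have "cumulative k l g u = (if u = s then 1 else 0)" if u: "u \<in> C k l" "rank k l u \<le> Suc n" for u
    proof -
      have lower: "g p = f p" if "p \<in> ?L u - {u}" for p
        using that u rank_less[of p k l u] by (auto simp: g_def)
      have "u \<in> ?L u" using u refines_self by simp
      then have "cumulative k l g u = g u + (\<Sum>p\<in>?L u - {u}. g p)"
        unfolding cumulative_def by (intro sum.remove) simp_all
      also have "(\<Sum>p\<in>?L u - {u}. g p) = (\<Sum>p\<in>?L u - {u}. f p)" using lower by (intro sum.cong) auto
      finally have g: "cumulative k l g u = g u + (\<Sum>p\<in>?L u - {u}. f p)" .
      show ?thesis
      proof (cases "rank k l u = Suc n")
        case True
        then show ?thesis using g u by (simp add: g_def)
      next
        case False
        have "cumulative k l f u = f u + (\<Sum>p\<in>?L u - {u}. f p)"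
          unfolding cumulative_def using \<open>u \<in> ?L u\<close> by (intro sum.remove) simp_all
        then show ?thesis using g False f(2)[of u] u by (simp add: g_def)
      qed
    qed
    moreover have "g p = 0" if "p \<notin> C k l" for p using that f(1) by (simp add: g_def)
    ultimately show ?case by blast
  qed
  from this[of "Max (rank k l ` C k l)"] show ?thesis by auto
qed

text \<open>\<open>m\<close> pairs side by side on the lower row; pairs are all that is available in
  every category.\<close>

lemma ex_partition_with_blocks: "\<exists>p\<in>C 0 (2 * m). card p = m"
proof (induction m)
  case 0
  then show ?case using empty_in_C by (intro bexI[of _ "{}"]) simp_all
next
  case (Suc m)
  then obtain p where p: "p \<in> C 0 (2 * m)" "card p = m" by blast
  let ?q = "tensor 0 (2 * m) p (involution {{Upper 1, Upper 2}})"
  have q: "?q \<in> C 0 (2 * Suc m)"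
    using tensor_in_C[OF p(1) involution_in_C[OF cap_in_C]] by simp
  have "?q = insert {Lower (2 * m + 1), Lower (2 * m + 2)} p"
    by (simp add: tensor_def involution_def)
  moreover have "{Lower (2 * m + 1), Lower (2 * m + 2)} \<notin> p"
  proof
    assume "{Lower (2 * m + 1), Lower (2 * m + 2)} \<in> p"
    then have "Lower (2 * m + 1) \<in> \<Union>p" by blast
    then show False unfolding partitions_Union[OF C_subset[OF p(1)]] by (auto simp: points_def)
  qed
  moreover have "finite p"
    using finite_UnionD[of p] partitions_Union[OF C_subset[OF p(1)]] by (simp add: points_def)
  ultimately have "card ?q = Suc m" using p by simp
  then show ?case using q by blast
qed

text \<open>Take \<open>f\<close> whose zeta transform is concentrated at a partition with
  \<open>n + 1\<close> blocks. In \<open>sum_pairing\<close> only the falling factorial of length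
  \<open>n + 1\<close> at \<open>n\<close> survives, and it contains the factor
  \<open>n - n\<close>.\<close>

lemma ex_negligible:
  fixes n :: nat
  defines "k \<equiv> 2 * Suc n"
  shows "\<exists>f :: partition \<Rightarrow> complex. (\<forall>p. p \<notin> C 0 k \<longrightarrow> f p = 0) \<and> f \<noteq> (\<lambda>_. 0) \<and>
    (\<forall>q\<in>C 0 k. (\<Sum>p\<in>C 0 k. f p * of_nat n ^ pairing 0 p q) = 0)"
proof -
  obtain s where s: "s \<in> C 0 k" "card s = Suc n" using ex_partition_with_blocks[of "Suc n"] k_def by blast
  obtain f where f: "\<And>p. p \<notin> C 0 k \<Longrightarrow> f p = 0" "\<And>u. u \<in> C 0 k \<Longrightarrow> cumulative 0 k f u = (if u = s then 1 else 0)"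
    using ex_cumulative_delta[OF s(1)] by blast
  have "falling_factorial (of_nat n :: complex) (Suc n) = 0"
    by (simp add: falling_factorial_def)
  then have "(\<Sum>p\<in>C 0 k. f p * of_nat n ^ pairing 0 p q) = 0" if "q \<in> C 0 k" for q
    unfolding sum_pairing[OF that] using f(2) s(2) by (intro sum.neutral) auto
  moreover have "f \<noteq> (\<lambda>_. 0)" using f(2)[OF s(1)] by (auto simp: cumulative_def)
  ultimately show ?thesis using f(1) by (intro exI[of _ f]) simp
qed

end

section \<open>Interpolating partition categories\<close>

text \<open>A composite in \<open>Rep\<^sub>0\<close> collects the pairs with a given composed
  partition; summing against \<open>G\<close> over all results amounts to summing over the
  pairs.\<close>

lemma sum_fibre:
  fixes G :: "'u \<Rightarrow> 'c::semiring_0"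
  assumes "finite U" "\<And>q p. q \<in> Q \<Longrightarrow> p \<in> P \<Longrightarrow> \<phi> q p \<in> U"
  shows "(\<Sum>u\<in>U. G u * (\<Sum>q\<in>Q. \<Sum>p\<in>P. if \<phi> q p = u then B q p else 0)) = (\<Sum>q\<in>Q. \<Sum>p\<in>P. G (\<phi> q p) * B q p)"
proof -
  have "(\<Sum>u\<in>U. G u * (\<Sum>q\<in>Q. \<Sum>p\<in>P. if \<phi> q p = u then B q p else 0)) =
      (\<Sum>u\<in>U. \<Sum>q\<in>Q. \<Sum>p\<in>P. if u = \<phi> q p then G (\<phi> q p) * B q p else 0)"
    by (auto simp: sum_distrib_left intro!: sum.cong)
  also have "\<dots> = (\<Sum>q\<in>Q. \<Sum>u\<in>U. \<Sum>p\<in>P. if u = \<phi> q p then G (\<phi> q p) * B q p else 0)"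
    by (rule sum.swap)
  also have "\<dots> = (\<Sum>q\<in>Q. \<Sum>p\<in>P. \<Sum>u\<in>U. if u = \<phi> q p then G (\<phi> q p) * B q p else 0)"
    by (intro sum.cong refl sum.swap)
  also have "\<dots> = (\<Sum>q\<in>Q. \<Sum>p\<in>P. G (\<phi> q p) * B q p)"
    using assms by (intro sum.cong refl) simp
  finally show ?thesis .
qed

definition basis :: "partition \<Rightarrow> partition \<Rightarrow> complex" where
  "basis p = (\<lambda>r. if r = p then 1 else 0)"

context partition_category
begin

lemma Rep0_simps:
  "Obj (Rep\<^sub>0 C t) = UNIV" "Hom (Rep\<^sub>0 C t) k l = {f. \<forall>p. p \<notin> C k l \<longrightarrow> f p = 0}"
  "Ident (Rep\<^sub>0 C t) k = basis (identity_partition k)" "Scale (Rep\<^sub>0 C t) c f = (\<lambda>p. c * f p)"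
  by (auto simp: Rep\<^sub>0_def basis_def)

lemma Rep0_Comp:
  "Comp (Rep\<^sub>0 C t) k l m g f r =
    (\<Sum>q\<in>C l m. \<Sum>p\<in>C k l. if compose q p = r then t ^ loops q p * g q * f p else 0)"
  by (simp add: Rep\<^sub>0_def)

text \<open>Both sides become sums over triples of partitions, which agree term by term by the two
  parts of \<open>compose_assoc\<close>.\<close>

lemma Rep0_assoc:
  "Comp (Rep\<^sub>0 C t) k m n h (Comp (Rep\<^sub>0 C t) k l m g f) = Comp (Rep\<^sub>0 C t) k l n (Comp (Rep\<^sub>0 C t) l m n h g) f"
proof
  fix r
  have "Comp (Rep\<^sub>0 C t) k m n h (Comp (Rep\<^sub>0 C t) k l m g f) r =
    (\<Sum>s\<in>C m n. \<Sum>u\<in>C k m. (if compose s u = r then t ^ loops s u * h s else 0) *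
      (\<Sum>q\<in>C l m. \<Sum>p\<in>C k l. if compose q p = u then t ^ loops q p * g q * f p else 0))"
    unfolding Rep0_Comp by (intro sum.cong refl) simp
  also have "\<dots> = (\<Sum>s\<in>C m n. \<Sum>q\<in>C l m. \<Sum>p\<in>C k l.
      (if compose s (compose q p) = r then t ^ loops s (compose q p) * h s else 0) * (t ^ loops q p * g q * f p))"
    by (intro sum.cong refl sum_fibre) (auto intro: compose_in_C)
  also have "\<dots> = (\<Sum>s\<in>C m n. \<Sum>q\<in>C l m. \<Sum>p\<in>C k l.
      if compose (compose s q) p = r then t ^ (loops s q + loops (compose s q) p) * (h s * g q * f p) else 0)"
  proof (intro sum.cong refl)
    fix s q p assume "s \<in> C m n" "q \<in> C l m" "p \<in> C k l"
    then show "(if compose s (compose q p) = r then t ^ loops s (compose q p) * h s else 0) * (t ^ loops q p * g q * f p) =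
      (if compose (compose s q) p = r then t ^ (loops s q + loops (compose s q) p) * (h s * g q * f p) else 0)"
      using compose_assoc[of p k l q m s n] by (auto simp: power_add[symmetric] algebra_simps)
  qed
  also have "\<dots> = (\<Sum>p\<in>C k l. \<Sum>s\<in>C m n. \<Sum>q\<in>C l m.
      (if compose (compose s q) p = r then t ^ loops (compose s q) p * f p else 0) * (t ^ loops s q * h s * g q))"
  proof -
    have swap: "(\<Sum>s\<in>C m n. \<Sum>q\<in>C l m. \<Sum>p\<in>C k l. X s q p) = (\<Sum>p\<in>C k l. \<Sum>s\<in>C m n. \<Sum>q\<in>C l m. X s q p)"
      for X :: "partition \<Rightarrow> partition \<Rightarrow> partition \<Rightarrow> complex"
    proof -
      have "(\<Sum>s\<in>C m n. \<Sum>q\<in>C l m. \<Sum>p\<in>C k l. X s q p) = (\<Sum>s\<in>C m n. \<Sum>p\<in>C k l. \<Sum>q\<in>C l m. X s q p)"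
        by (intro sum.cong refl sum.swap)
      also have "\<dots> = (\<Sum>p\<in>C k l. \<Sum>s\<in>C m n. \<Sum>q\<in>C l m. X s q p)" by (rule sum.swap)
      finally show ?thesis .
    qed
    show ?thesis by (rule trans[OF swap]) (intro sum.cong refl, simp add: power_add)
  qed
  also have "\<dots> = (\<Sum>p\<in>C k l. \<Sum>u\<in>C l n. (if compose u p = r then t ^ loops u p * f p else 0) *
      (\<Sum>s\<in>C m n. \<Sum>q\<in>C l m. if compose s q = u then t ^ loops s q * h s * g q else 0))"
    by (intro sum.cong refl sum_fibre[symmetric]) (auto intro: compose_in_C)
  also have "\<dots> = Comp (Rep\<^sub>0 C t) k l n (Comp (Rep\<^sub>0 C t) l m n h g) f r"
    unfolding Rep0_Comp by (subst sum.swap) (intro sum.cong refl, simp)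
  finally show "Comp (Rep\<^sub>0 C t) k m n h (Comp (Rep\<^sub>0 C t) k l m g f) r =
    Comp (Rep\<^sub>0 C t) k l n (Comp (Rep\<^sub>0 C t) l m n h g) f r" .
qed

lemma linear_category_Rep0: "linear_category (Rep\<^sub>0 C t)"
proof (rule linear_category.intro)
  show V: "vector_space (Scale (Rep\<^sub>0 C t))"
    by unfold_locales (auto simp: Rep0_simps fun_eq_iff algebra_simps)
  interpret V: vector_space "Scale (Rep\<^sub>0 C t)" by (rule V)
  show "module.subspace (Scale (Rep\<^sub>0 C t)) (Hom (Rep\<^sub>0 C t) k l)" for k l
    by (auto simp: V.subspace_def Rep0_simps)
  show "Ident (Rep\<^sub>0 C t) k \<in> Hom (Rep\<^sub>0 C t) k k" for k
    using identity_partition_in_C by (auto simp: Rep0_simps basis_def)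
  show "Comp (Rep\<^sub>0 C t) k l m g f \<in> Hom (Rep\<^sub>0 C t) k m" for k l m f g
    by (auto simp: Rep0_simps Rep0_Comp intro!: sum.neutral intro: compose_in_C)
  fix k l f assume f: "f \<in> Hom (Rep\<^sub>0 C t) k l"
  show "Comp (Rep\<^sub>0 C t) k l l (Ident (Rep\<^sub>0 C t) l) f = f"
  proof
    fix r
    have "Comp (Rep\<^sub>0 C t) k l l (Ident (Rep\<^sub>0 C t) l) f r =
      (\<Sum>q\<in>C l l. if q = identity_partition l then (\<Sum>p\<in>C k l. if p = r then f p else 0) else 0)"
      unfolding Rep0_Comp Rep0_simps basis_def
    proof (intro sum.cong refl)
      fix q assume "q \<in> C l l"
      show "(\<Sum>p\<in>C k l. if compose q p = r then t ^ loops q p * (if q = identity_partition l then 1 else 0) * f p else 0) =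
        (if q = identity_partition l then \<Sum>p\<in>C k l. if p = r then f p else 0 else 0)"
      proof (cases "q = identity_partition l")
        case True
        then show ?thesis by (auto simp: compose_identity intro!: sum.cong)
      next
        case False
        then show ?thesis by (simp cong: if_cong)
      qed
    qed
    also have "\<dots> = f r" using f identity_partition_in_C by (auto simp: Rep0_simps)
    finally show "Comp (Rep\<^sub>0 C t) k l l (Ident (Rep\<^sub>0 C t) l) f r = f r" .
  qed
  show "Comp (Rep\<^sub>0 C t) k k l f (Ident (Rep\<^sub>0 C t) k) = f"
  proof
    fix r
    have "Comp (Rep\<^sub>0 C t) k k l f (Ident (Rep\<^sub>0 C t) k) r =
      (\<Sum>q\<in>C k l. \<Sum>p\<in>C k k. if p = identity_partition k then (if q = r then f q else 0) else 0)"
      unfolding Rep0_Comp Rep0_simps basis_def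
      by (intro sum.cong refl) (auto simp: compose_identity cong: if_cong)
    also have "\<dots> = f r" using f identity_partition_in_C by (auto simp: Rep0_simps)
    finally show "Comp (Rep\<^sub>0 C t) k k l f (Ident (Rep\<^sub>0 C t) k) r = f r" .
  qed
qed (auto simp: Rep0_assoc Rep0_Comp Rep0_simps fun_eq_iff sum.distrib[symmetric] sum_distrib_left algebra_simps intro!: sum.cong)

text \<open>The categorical trace: pairing with the identity joins each upper point to the lower
  point below it, and every loop of the closed diagram contributes a factor
  \<open>t\<close>.\<close>

definition trace :: "complex \<Rightarrow> nat \<Rightarrow> (partition \<Rightarrow> complex) \<Rightarrow> complex" where
  "trace t k x = (\<Sum>p\<in>C k k. x p * t ^ pairing k p (identity_partition k))"

text \<open>Closing up the composite gives the same diagram as pairing \<open>p\<close> with the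
  involution of \<open>q\<close>. Counting the labellings over two letters in both ways compares the
  exponents.\<close>

lemma pairing_compose:
  assumes p: "p \<in> C k a" and q: "q \<in> C a k"
  shows "loops q p + pairing k (compose q p) (identity_partition k) = pairing k p (involution q)"
proof -
  note id = identity_partition_in_partitions[of k]
  have "(2::nat) ^ pairing k p (involution q) =
      card {(xs, ys) \<in> words 2 k \<times> words 2 a. compatible p xs ys \<and> compatible (involution q) xs ys}"
    by (rule card_common_words[OF C_subset[OF p] C_subset[OF involution_in_C[OF q]], symmetric])
  also have "{(xs, ys) \<in> words 2 k \<times> words 2 a. compatible p xs ys \<and> compatible (involution q) xs ys} =
      (SIGMA xs:words 2 k. {ys \<in> words 2 a. compatible p xs ys \<and> compatible q ys xs})"
    by (auto simp: compatible_involution)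
  also have "card \<dots> = (\<Sum>xs\<in>words 2 k. card {ys \<in> words 2 a. compatible p xs ys \<and> compatible q ys xs})"
    by (rule card_SigmaI) auto
  also have "\<dots> = (\<Sum>xs\<in>words 2 k. if compatible (compose q p) xs xs then 2 ^ loops q p else 0)"
    by (intro sum.cong refl card_middle_words[OF C_subset[OF p] C_subset[OF q]])
  also have "\<dots> = 2 ^ loops q p * card {xs \<in> words 2 k. compatible (compose q p) xs xs}"
    by (simp add: sum.If_cases Int_def)
  also have "card {xs \<in> words 2 k. compatible (compose q p) xs xs} =
      card {(xs, ys) \<in> words 2 k \<times> words 2 k. compatible (compose q p) xs ys \<and> compatible (identity_partition k) xs ys}"
  proof -
    have "{(xs, ys) \<in> words 2 k \<times> words 2 k. compatible (compose q p) xs ys \<and> compatible (identity_partition k) xs ys} =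
        (\<lambda>xs. (xs, xs)) ` {xs \<in> words 2 k. compatible (compose q p) xs xs}"
      by (auto simp: compatible_identity words_length)
    then show ?thesis by (simp add: card_image inj_on_def)
  qed
  also have "\<dots> = 2 ^ pairing k (compose q p) (identity_partition k)"
    by (rule card_common_words[OF C_subset[OF compose_in_C[OF p q]] id])
  finally show ?thesis by (simp add: power_add[symmetric])
qed

text \<open>Both sides count the same pairs of words with the roles of the rows exchanged; this is
  the cyclicity of the trace on basis elements.\<close>

lemma pairing_commute:
  assumes p: "p \<in> C k a" and q: "q \<in> C a k"
  shows "pairing k p (involution q) = pairing a q (involution p)"
proof -
  have "(2::nat) ^ pairing k p (involution q) =
      card {(xs, ys) \<in> words 2 k \<times> words 2 a. compatible p xs ys \<and> compatible (involution q) xs ys}"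
    by (rule card_common_words[OF C_subset[OF p] C_subset[OF involution_in_C[OF q]], symmetric])
  also have "{(xs, ys) \<in> words 2 k \<times> words 2 a. compatible p xs ys \<and> compatible (involution q) xs ys} =
      prod.swap ` {(ys, xs) \<in> words 2 a \<times> words 2 k. compatible q ys xs \<and> compatible (involution p) ys xs}"
    by (auto simp: compatible_involution image_iff)
  also have "card \<dots> = card {(ys, xs) \<in> words 2 a \<times> words 2 k. compatible q ys xs \<and> compatible (involution p) ys xs}"
    by (rule card_image) (simp add: inj_on_def)
  also have "\<dots> = 2 ^ pairing a q (involution p)"
    by (rule card_common_words[OF C_subset[OF q] C_subset[OF involution_in_C[OF p]]])
  finally show ?thesis by simp
qed

text \<open>Identifies the trace form with the Gram matrix, up to the involution on one side, so
  that nondegeneracy of the pairing carries over to the trace.\<close>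

lemma trace_Comp:
  "trace t k (Comp (Rep\<^sub>0 C t) k a k n m) = (\<Sum>q\<in>C a k. \<Sum>p\<in>C k a. n q * m p * t ^ pairing k p (involution q))"
proof -
  have "trace t k (Comp (Rep\<^sub>0 C t) k a k n m) = (\<Sum>u\<in>C k k. t ^ pairing k u (identity_partition k) *
      (\<Sum>q\<in>C a k. \<Sum>p\<in>C k a. if compose q p = u then t ^ loops q p * n q * m p else 0))"
    by (simp add: trace_def Rep0_Comp mult.commute)
  also have "\<dots> = (\<Sum>q\<in>C a k. \<Sum>p\<in>C k a. t ^ pairing k (compose q p) (identity_partition k) * (t ^ loops q p * n q * m p))"
    by (rule sum_fibre) (auto intro: compose_in_C)
  also have "\<dots> = (\<Sum>q\<in>C a k. \<Sum>p\<in>C k a. n q * m p * t ^ pairing k p (involution q))"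
    by (intro sum.cong refl) (simp add: pairing_compose[symmetric] power_add)
  finally show ?thesis .
qed

lemma basis_in_Hom: "p \<in> C k l \<Longrightarrow> basis p \<in> Hom (Rep\<^sub>0 C t) k l"
  by (auto simp: Rep0_simps basis_def)

lemma Comp_basis:
  assumes "p \<in> C k l" "q \<in> C l m"
  shows "Comp (Rep\<^sub>0 C t) k l m (basis q) (basis p) = Scale (Rep\<^sub>0 C t) (t ^ loops q p) (basis (compose q p))"
proof
  fix r
  have "Comp (Rep\<^sub>0 C t) k l m (basis q) (basis p) r =
      (\<Sum>q'\<in>C l m. \<Sum>p'\<in>C k l. if p' = p then if q' = q then if compose q p = r then t ^ loops q p else 0 else 0 else 0)"
    unfolding Rep0_Comp basis_def by (intro sum.cong refl) (auto cong: if_cong)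
  also have "\<dots> = (\<Sum>q'\<in>C l m. if q' = q then if compose q p = r then t ^ loops q p else 0 else 0)"
    using assms by simp
  also have "\<dots> = (if compose q p = r then t ^ loops q p else 0)" using assms by simp
  finally show "Comp (Rep\<^sub>0 C t) k l m (basis q) (basis p) r = Scale (Rep\<^sub>0 C t) (t ^ loops q p) (basis (compose q p)) r"
    by (auto simp: Rep0_simps basis_def)
qed

lemma expand_in_basis:
  assumes "f \<in> Hom (Rep\<^sub>0 C t) k l"
  shows "f = (\<Sum>p\<in>C k l. Scale (Rep\<^sub>0 C t) (f p) (basis p))"
proof
  fix r
  have "(\<Sum>p\<in>C k l. f p * basis p r) = (\<Sum>p\<in>C k l. if p = r then f r else 0)"
    by (intro sum.cong) (auto simp: basis_def)
  then show "f r = (\<Sum>p\<in>C k l. Scale (Rep\<^sub>0 C t) (f p) (basis p)) r"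
    using assms by (simp add: Rep0_simps sum_fun_apply)
qed

lemma Hom_subset_span: "Hom (Rep\<^sub>0 C t) k l \<subseteq> module.span (Scale (Rep\<^sub>0 C t)) (basis ` C k l)"
proof
  interpret linear_category "Rep\<^sub>0 C t" by (rule linear_category_Rep0)
  fix f assume "f \<in> Hom (Rep\<^sub>0 C t) k l"
  then show "f \<in> vs.span (basis ` C k l)"
    by (subst expand_in_basis, assumption) (intro vs.span_sum vs.span_scale vs.span_base imageI)
qed

lemma additive_completion_finite_dim:
  "\<exists>T. finite T \<and> Hom (additive_completion (Rep\<^sub>0 C t)) xs ys \<subseteq> module.span (Scale (additive_completion (Rep\<^sub>0 C t))) T"
proof -
  let ?A = "additive_completion (Rep\<^sub>0 C t)"
  interpret A: linear_category ?A
    by (intro linear_category_additive_completion linear_category_Rep0)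
  define E where "E i j p = (\<lambda>i' j'. if i' = i \<and> j' = j then basis p else 0)" for i j :: nat and p
  let ?T = "\<Union>i<length ys. \<Union>j<length xs. E i j ` C (xs ! j) (ys ! i)"
  have "M \<in> A.vs.span ?T" if M: "M \<in> Hom ?A xs ys" for M
  proof -
    have MH: "M i j \<in> Hom (Rep\<^sub>0 C t) (xs ! j) (ys ! i)" if "i < length ys" "j < length xs" for i j
      using M that by (auto simp: additive_completion_def)
    have M0: "M i j = 0" if "\<not> (i < length ys \<and> j < length xs)" for i j
      using M that by (auto simp: additive_completion_def)
    have "M = (\<Sum>i<length ys. \<Sum>j<length xs. \<Sum>p\<in>C (xs ! j) (ys ! i). Scale ?A (M i j p) (E i j p))"
    proof (intro ext)
      fix i' j' r
      have "(\<Sum>i<length ys. \<Sum>j<length xs. \<Sum>p\<in>C (xs ! j) (ys ! i). Scale ?A (M i j p) (E i j p)) i' j' r =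
        (\<Sum>i<length ys. \<Sum>j<length xs. \<Sum>p\<in>C (xs ! j) (ys ! i). if p = r then if j = j' then if i = i' then M i j r else 0 else 0 else 0)"
        unfolding sum_fun_apply
        by (intro sum.cong refl) (auto simp: additive_completion_def Rep0_simps E_def basis_def)
      also have "\<dots> = (\<Sum>i<length ys. \<Sum>j<length xs. if j = j' then if i = i' then M i j r else 0 else 0)"
        using MH by (intro sum.cong refl) (auto simp: Rep0_simps)
      also have "\<dots> = (\<Sum>i<length ys. if i = i' then if j' < length xs then M i j' r else 0 else 0)"
        by (intro sum.cong refl) simp
      also have "\<dots> = M i' j' r" using M0[of i' j'] by auto
      finally show "M i' j' r = (\<Sum>i<length ys. \<Sum>j<length xs. \<Sum>p\<in>C (xs ! j) (ys ! i). Scale ?A (M i j p) (E i j p)) i' j' r" ..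
    qed
    also have "\<dots> \<in> A.vs.span ?T"
      by (intro A.vs.span_sum A.vs.span_scale A.vs.span_base) auto
    finally show ?thesis .
  qed
  moreover have "finite ?T" by simp
  ultimately show ?thesis by blast
qed

section \<open>Projections\<close>

definition projection :: "nat \<Rightarrow> partition \<Rightarrow> bool" where
  "projection k e \<longleftrightarrow> e \<in> C k k \<and> involution e = e \<and> compose e e = e"

lemma projection_identity: "projection k (identity_partition k)"
proof -
  note id = identity_partition_in_C[of k]
  have "involution (identity_partition k) = identity_partition k"
    by (rule partition_eqI[OF C_subset[OF involution_in_C[OF id]] C_subset[OF id]])
      (auto simp: compatible_involution compatible_identity words_length)
  then show ?thesis using id by (simp add: projection_def compose_identity)
qed

text \<open>The range projection of \<open>p\<close>; that it fixes \<open>p\<close> is the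
  regularity of the involutive semigroup.\<close>

lemma projection_of:
  assumes "p \<in> C k l"
  shows "projection l (compose p (involution p))" "compose (compose p (involution p)) p = p"
proof -
  note ip = involution_in_C[OF assms] and pp = compose_in_C[OF involution_in_C[OF assms] assms]
  show 1: "compose (compose p (involution p)) p = p"
    using compose_regular[OF assms] compose_assoc(2)[OF assms ip assms] by simp
  have "compose (compose p (involution p)) (compose p (involution p)) = compose p (involution p)"
    using compose_assoc(2)[OF ip assms pp] 1 by simp
  then show "projection l (compose p (involution p))"
    using pp involution_compose[OF ip assms] involution_involution[OF assms] by (simp add: projection_def)
qed

end

section \<open>Semisimplicity for generic parameters\<close>

locale generic_parameter = group_theoretical_category +
  fixes t :: complex
  assumes generic: "t \<notin> \<nat>"
begin

sublocale linear_category "Rep\<^sub>0 C t"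
  by (rule linear_category_Rep0)

lemma t_nonzero: "t \<noteq> 0"
  using generic Nats_0 by auto

lemma Obj_Rep0[simp]: "k \<in> Obj (Rep\<^sub>0 C t)"
  by (simp add: Rep0_simps)

text \<open>Nondegeneracy is tested on basis elements: composing with the involution of
  \<open>q\<close> and taking the trace yields the pairing with \<open>q\<close>. The argument on
  the left of the composite is reduced to the same form by \<open>pairing_commute\<close>.\<close>

lemma traced_object_Rep0: "traced_object (Rep\<^sub>0 C t) k (trace t k)"
proof unfold_locales
  show "trace t k (x + y) = trace t k x + trace t k y" for x y
    by (simp add: trace_def algebra_simps sum.distrib)
  show "trace t k (Scale (Rep\<^sub>0 C t) r x) = r * trace t k x" for r x
    by (simp add: trace_def Rep0_simps sum_distrib_left mult_ac)
  show "trace t k (Comp (Rep\<^sub>0 C t) k k k x y) = trace t k (Comp (Rep\<^sub>0 C t) k k k y x)" for x y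
  proof -
    have "trace t k (Comp (Rep\<^sub>0 C t) k k k x y) = (\<Sum>q\<in>C k k. \<Sum>p\<in>C k k. y p * x q * t ^ pairing k q (involution p))"
      unfolding trace_Comp
    proof (intro sum.cong refl)
      fix q p assume "q \<in> C k k" "p \<in> C k k"
      then show "x q * y p * t ^ pairing k p (involution q) = y p * x q * t ^ pairing k q (involution p)"
        using pairing_commute[of p k k q] by simp
    qed
    also have "\<dots> = trace t k (Comp (Rep\<^sub>0 C t) k k k y x)"
      unfolding trace_Comp by (rule sum.swap)
    finally show ?thesis .
  qed
  show "\<exists>T. finite T \<and> Hom (Rep\<^sub>0 C t) k a \<subseteq> vs.span T" for a
    using Hom_subset_span by (intro exI[of _ "basis ` C k a"]) simp
next
  fix a m assume m: "m \<in> Hom (Rep\<^sub>0 C t) k a" "m \<noteq> 0"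
  then obtain q where q: "q \<in> C k a" "(\<Sum>p\<in>C k a. m p * t ^ pairing k p q) \<noteq> 0"
    using pairing_nondegenerate[OF generic, of k a m] by (force simp: Rep0_simps zero_fun_def)
  have "trace t k (Comp (Rep\<^sub>0 C t) k a k (basis (involution q)) m) =
      (\<Sum>q'\<in>C a k. if q' = involution q then \<Sum>p\<in>C k a. m p * t ^ pairing k p (involution q') else 0)"
    unfolding trace_Comp by (intro sum.cong refl) (simp add: basis_def)
  also have "\<dots> = (\<Sum>p\<in>C k a. m p * t ^ pairing k p q)"
    using involution_in_C[OF q(1)] by (simp add: involution_involution[OF q(1)])
  finally show "\<exists>n\<in>Hom (Rep\<^sub>0 C t) a k. trace t k (Comp (Rep\<^sub>0 C t) k a k n m) \<noteq> 0"
    using q(2) basis_in_Hom[OF involution_in_C[OF q(1)]] by metis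
next
  fix a n assume n: "n \<in> Hom (Rep\<^sub>0 C t) a k" "n \<noteq> 0"
  then obtain q where q: "q \<in> C a k" "(\<Sum>p\<in>C a k. n p * t ^ pairing a p q) \<noteq> 0"
    using pairing_nondegenerate[OF generic, of a k n] by (force simp: Rep0_simps zero_fun_def)
  have "trace t k (Comp (Rep\<^sub>0 C t) k a k n (basis (involution q))) =
      (\<Sum>q'\<in>C a k. \<Sum>p\<in>C k a. if p = involution q then n q' * t ^ pairing k p (involution q') else 0)"
    unfolding trace_Comp by (intro sum.cong refl) (simp add: basis_def)
  also have "\<dots> = (\<Sum>p\<in>C a k. n p * t ^ pairing a p q)"
    using involution_in_C[OF q(1)] pairing_commute[OF involution_in_C[OF q(1)]]
    by (simp add: involution_involution[OF q(1)] cong: sum.cong)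
  finally show "\<exists>m\<in>Hom (Rep\<^sub>0 C t) k a. trace t k (Comp (Rep\<^sub>0 C t) k a k n m) \<noteq> 0"
    using q(2) basis_in_Hom[OF involution_in_C[OF q(1)]] by metis
qed simp_all

text \<open>Induction on the number of projections below \<open>e\<close>. A joint operator for the
  proper ones exists by hypothesis, and its complement \<open>F\<close> kills them. An element of
  the corner at \<open>e\<close> either is invertible there, with its involution as inverse, or
  factors through a smaller projection and is killed by \<open>F\<close>. What remains is spanned by
  a finite group, twisted by the powers of \<open>t\<close> counting loops.\<close>

lemma ex_averaging_absorbs_projection:
  "projection k e \<Longrightarrow> \<exists>av. averaging (Rep\<^sub>0 C t) av \<and> absorbs av (k, k, basis e)"
proof (induction "card {f. projection k f \<and> compose e f = f}" arbitrary: e rule: less_induct)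
  case (less e)
  let ?D = "Rep\<^sub>0 C t"
  interpret traced_object ?D k "trace t k" by (rule traced_object_Rep0)
  have e: "e \<in> C k k" "involution e = e" "compose e e = e" using less.prems by (simp_all add: projection_def)
  have fin: "finite {f. projection k f \<and> P f}" for P
    by (rule finite_subset[of _ "C k k"]) (auto simp: projection_def)
  let ?X = "(\<lambda>f. (k, k, basis f)) ` {f. projection k f \<and> compose e f = f \<and> f \<noteq> e}"
  have "\<exists>av. averaging ?D av \<and> (\<forall>y\<in>?X. absorbs av y)"
  proof (rule ex_averaging_absorbs_finite)
    show "finite ?X" using fin[of "\<lambda>f. compose e f = f \<and> f \<noteq> e"] by simp
    fix y assume "y \<in> ?X"
    then obtain f where y: "y = (k, k, basis f)" and f: "projection k f" "compose e f = f" "f \<noteq> e" by auto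
    have fC: "f \<in> C k k" "involution f = f" using f by (simp_all add: projection_def)
    \<comment> \<open>The order on projections is two-sided: apply the involution to
      \<open>compose e f = f\<close>.\<close>
    have fe: "compose f e = f" using involution_compose[OF fC(1) e(1)] f(2) fC(2) e(2) by simp
    have "{g. projection k g \<and> compose f g = g} \<subset> {g. projection k g \<and> compose e g = g}"
    proof (rule psubsetI)
      show "{g. projection k g \<and> compose f g = g} \<subseteq> {g. projection k g \<and> compose e g = g}"
      proof (rule subsetI)
        fix g assume "g \<in> {g. projection k g \<and> compose f g = g}"
        then have g: "projection k g" "compose f g = g" by simp_all
        then have "compose e g = g"
          using compose_assoc(2)[of g k k f k e k] fC(1) e(1) f(2) by (simp add: projection_def)
        then show "g \<in> {g. projection k g \<and> compose e g = g}" using g(1) by simp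
      qed
      show "{g. projection k g \<and> compose f g = g} \<noteq> {g. projection k g \<and> compose e g = g}"
      proof
        assume eq: "{g. projection k g \<and> compose f g = g} = {g. projection k g \<and> compose e g = g}"
        have "e \<in> {g. projection k g \<and> compose e g = g}" using less.prems e(3) by simp
        then have "e \<in> {g. projection k g \<and> compose f g = g}" by (simp only: eq)
        then show False using fe f(3) by simp
      qed
    qed
    then have "card {g. projection k g \<and> compose f g = g} < card {g. projection k g \<and> compose e g = g}"
      by (rule psubset_card_mono[OF fin])
    from less.hyps[OF this f(1)] show "\<exists>av. averaging ?D av \<and> absorbs av y" by (simp add: y)
  qed (auto simp: projection_def basis_in_Hom)
  then obtain av1 where av1: "averaging ?D av1"
    and "\<And>f. projection k f \<Longrightarrow> compose e f = f \<Longrightarrow> f \<noteq> e \<Longrightarrow> absorbs av1 (k, k, basis f)" by auto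
  then have kill: "Comp ?D k k k (Ident ?D k - average_id av1 k) (basis f) = 0"
    if "projection k f" "compose e f = f" "f \<noteq> e" for f
    using that by (simp add: absorbs_def Comp_diff_left Ident_in_Hom Comp_Ident_left average_id_in_Hom projection_def basis_in_Hom)
  have FH: "Ident ?D k - average_id av1 k \<in> Hom ?D k k"
    by (intro diff_in_Hom Ident_in_Hom average_id_in_Hom[OF av1]) simp_all
  define F where "F = Ident ?D k - average_id av1 k"
  have FN: "Comp ?D k k k F x = Comp ?D k k k x F" if "x \<in> Hom ?D k k" for x
    using that average_id_natural[OF av1, of k k x] average_id_in_Hom[OF av1, of k]
    by (simp add: F_def Comp_diff_left Comp_diff_right Ident_in_Hom Comp_Ident_left Comp_Ident_right)
  note F_in = FH[folded F_def] and kill' = kill[folded F_def]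
  define l where "l = loops e e"
  \<comment> \<open>In the algebra the square of \<open>basis e\<close> is \<open>t ^ l\<close>
    times itself; dividing by this scalar gives an idempotent.\<close>
  define \<epsilon> where "\<epsilon> = Scale ?D (1 / t ^ l) (basis e)"
  \<comment> \<open>The group of units of the corner for which the involution is the inverse, with
    \<open>e\<close> as neutral element.\<close>
  define G where "G = {g \<in> C k k. compose e g = g \<and> compose g e = g \<and>
    compose g (involution g) = e \<and> compose (involution g) g = e}"
  have GC: "g \<in> C k k" "involution g \<in> C k k" if "g \<in> G" for g using that involution_in_C by (auto simp: G_def)
  have eG: "e \<in> G" using e by (simp add: G_def)
  have iG: "involution g \<in> G" if "g \<in> G" for g
    using that involution_compose[OF e(1), of g k] involution_compose[OF _ e(1), of g k] e(2)
    by (auto simp: G_def involution_in_C involution_involution)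
  \<comment> \<open>Loop additivity for the triple \<open>e\<close>, \<open>e\<close>,
    \<open>g\<close> has the number of loops of \<open>e\<close> and \<open>g\<close> twice on one
    side and once on the other, which leaves \<open>l\<close>.\<close>
  have loops_e: "loops e g = l" "loops g e = l" if "g \<in> G" for g
    using compose_assoc(1)[of g k k e k e k] compose_assoc(1)[of e k k e k g k] that e by (auto simp: G_def l_def)
  \<comment> \<open>Loop additivity for \<open>g\<close>, its involution and \<open>g\<close>; the
    two remaining terms both equal \<open>l\<close>. This makes the left and the right inverse carry
    the same scalar.\<close>
  have loops_inv: "loops (involution g) g = loops g (involution g)" if "g \<in> G" for g
    using compose_assoc(1)[OF GC(1)[OF that] GC(2)[OF that] GC(1)[OF that]] loops_e[OF that] that by (simp add: G_def)
  have multG: "compose g h \<in> G" if g: "g \<in> G" and h: "h \<in> G" for g h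
  proof -
    note C = GC[OF g] GC[OF h] compose_in_C[OF GC(1)[OF h] GC(1)[OF g]] compose_in_C[OF GC(2)[OF g] GC(2)[OF h]]
    have i: "involution (compose g h) = compose (involution h) (involution g)"
      by (rule involution_compose[OF C(3,1)])
    have "compose e (compose g h) = compose g h" "compose (compose g h) e = compose g h"
      using compose_assoc(2)[OF C(3,1) e(1)] compose_assoc(2)[OF e(1) C(3,1)] g h by (simp_all add: G_def)
    moreover have "compose (compose g h) (compose (involution h) (involution g)) = e"
    proof -
      have "compose (compose g h) (compose (involution h) (involution g)) =
          compose g (compose h (compose (involution h) (involution g)))"
        by (rule compose_assoc(2)[OF C(6,3,1), symmetric])
      also have "compose h (compose (involution h) (involution g)) = compose (compose h (involution h)) (involution g)"
        by (rule compose_assoc(2)[OF C(2,4,3)])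
      also have "\<dots> = involution g" using h iG[OF g] by (simp add: G_def)
      finally show ?thesis using g by (simp add: G_def)
    qed
    moreover have "compose (compose (involution h) (involution g)) (compose g h) = e"
    proof -
      have "compose (compose (involution h) (involution g)) (compose g h) =
          compose (involution h) (compose (involution g) (compose g h))"
        by (rule compose_assoc(2)[OF C(5,2,4), symmetric])
      also have "compose (involution g) (compose g h) = compose (compose (involution g) g) h"
        by (rule compose_assoc(2)[OF C(3,1,2)])
      also have "\<dots> = h" using g h by (simp add: G_def)
      finally show ?thesis using h by (simp add: G_def)
    qed
    ultimately show ?thesis using C(5) i by (simp add: G_def)
  qed
  have injG: "inj_on (compose g) G" if g: "g \<in> G" for g
  proof (rule inj_on_inverseI[of _ "compose (involution g)"])
    fix h assume h: "h \<in> G"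
    have "compose (involution g) (compose g h) = compose (compose (involution g) g) h"
      by (rule compose_assoc(2)[OF GC(1)[OF h] GC[OF g]])
    then show "compose (involution g) (compose g h) = h" using g h by (simp add: G_def)
  qed
  \<comment> \<open>The product with \<open>basis g\<close> yields a power of \<open>t\<close> from
    the loops times \<open>basis e\<close>; the further \<open>t ^ l\<close> is due to the unit
    being \<open>\<epsilon>\<close> instead of \<open>basis e\<close>.\<close>
  define q' where "q' g = Scale ?D (1 / t ^ (loops g (involution g) + l)) (basis (involution g))" for g
  note [simp] = t_nonzero basis_in_Hom Scale_in_Hom Comp_Scale_left Comp_Scale_right Comp_basis e
  have \<epsilon>H: "\<epsilon> \<in> Hom ?D k k" by (simp add: \<epsilon>_def)
  have "\<exists>av. averaging ?D av \<and> absorbs av (k, k, \<epsilon>)"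
  proof (rule ex_averaging_absorbs_corner[OF av1 \<epsilon>H, where G = G and q = basis and q' = q' and mul = compose and c = "\<lambda>g h. t ^ loops g h"])
    show "Comp ?D k k k \<epsilon> \<epsilon> = \<epsilon>" by (simp add: \<epsilon>_def l_def[symmetric])
    show "finite G" by (rule finite_subset[of _ "C k k"]) (auto simp: G_def)
    show "G \<noteq> {}" using eG by blast
  next
    fix g assume g: "g \<in> G"
    then have [simp]: "compose e g = g" "compose g e = g" "compose g (involution g) = e" "compose (involution g) g = e"
      by (auto simp: G_def)
    have [simp]: "g \<in> C k k" "involution g \<in> C k k" "involution g \<in> G" using GC[OF g] iG[OF g] by auto
    have [simp]: "compose e (involution g) = involution g" "compose (involution g) e = involution g"
      using iG[OF g] by (auto simp: G_def)
    show "basis g \<in> Hom ?D k k" "q' g \<in> Hom ?D k k" using g by (simp_all add: q'_def)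
    show "Comp ?D k k k \<epsilon> (basis g) = basis g" "Comp ?D k k k (basis g) \<epsilon> = basis g"
      using g by (simp_all add: \<epsilon>_def loops_e)
    show "Comp ?D k k k \<epsilon> (q' g) = q' g" "Comp ?D k k k (q' g) \<epsilon> = q' g"
      using g by (simp_all add: \<epsilon>_def q'_def loops_e mult.commute)
    show "Comp ?D k k k (basis g) (q' g) = \<epsilon>" "Comp ?D k k k (q' g) (basis g) = \<epsilon>"
      using g by (simp_all add: \<epsilon>_def q'_def loops_inv power_add)
    show "inj_on (compose g) G" by (rule injG[OF g])
    fix h assume h: "h \<in> G"
    show "compose g h \<in> G" by (rule multG[OF g h])
    show "Comp ?D k k k (basis g) (basis h) = Scale ?D (t ^ loops g h) (basis (compose g h))"
      using GC(1)[OF h] by simp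
  next
    fix x assume x: "x \<in> Hom ?D k k"
    let ?S = "vs.span ((\<lambda>g. Comp ?D k k k (Ident ?D k - average_id av1 k) (basis g)) ` G)"
    have key: "Comp ?D k k k F (basis p) \<in> ?S" if p: "p \<in> C k k" "compose e p = p" "compose p e = p" for p
    proof -
      note ip = involution_in_C[OF p(1)]
      have ie: "compose e (involution p) = involution p"
        using involution_compose[OF p(1) e(1)] involution_compose[OF e(1) p(1)] p by simp
      note pr1 = projection_of[OF p(1)] and pr2 = projection_of[OF ip]
      note ii = involution_involution[OF p(1)]
      have e1: "compose e (compose p (involution p)) = compose p (involution p)"
        using compose_assoc(2)[OF ip p(1) e(1)] p by simp
      have e2: "compose e (compose (involution p) p) = compose (involution p) p"
        using compose_assoc(2)[OF p(1) ip e(1)] ie by simp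
      \<comment> \<open>Outside \<open>G\<close> one of the two projections of \<open>p\<close> lies
        strictly below \<open>e\<close>. The equation
        \<open>compose (compose p (involution p)) p = p\<close>, or its mirror image, holds in the
        algebra up to a power of \<open>t\<close>, which is invertible; as \<open>F\<close> is
        central and kills that projection, it kills \<open>basis p\<close>.\<close>
      consider "p \<in> G" | "compose p (involution p) \<noteq> e" | "compose (involution p) p \<noteq> e"
        using p by (auto simp: G_def)
      then show ?thesis
      proof cases
        case 1
        then show ?thesis unfolding F_def by (intro vs.span_base) blast
      next
        case 2
        let ?f = "compose p (involution p)"
        have f: "?f \<in> C k k" by (rule compose_in_C[OF ip p(1)])
        have "Scale ?D (t ^ loops ?f p) (Comp ?D k k k F (basis p)) = Comp ?D k k k F (Comp ?D k k k (basis ?f) (basis p))"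
          using f p(1) F_in pr1(2) by simp
        also have "\<dots> = Comp ?D k k k (Comp ?D k k k F (basis ?f)) (basis p)"
          using f p(1) F_in by (intro Comp_assoc) simp_all
        also have "\<dots> = 0"
          using kill'[OF pr1(1) e1 2] p(1) by (simp add: Comp_0_left)
        finally have "Comp ?D k k k F (basis p) = 0" by simp
        then show ?thesis by (simp add: vs.span_zero)
      next
        case 3
        let ?f = "compose (involution p) p"
        have f: "?f \<in> C k k" by (rule compose_in_C[OF p(1) ip])
        have pf: "compose p ?f = p" by (rule compose_regular[OF p(1)])
        have "Scale ?D (t ^ loops p ?f) (Comp ?D k k k F (basis p)) = Comp ?D k k k F (Comp ?D k k k (basis p) (basis ?f))"
          using f p(1) F_in pf by simp
        also have "\<dots> = Comp ?D k k k (Comp ?D k k k F (basis p)) (basis ?f)"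
          using f p(1) F_in by (intro Comp_assoc) simp_all
        also have "\<dots> = Comp ?D k k k (Comp ?D k k k (basis p) F) (basis ?f)"
          using FN[of "basis p"] p(1) by simp
        also have "\<dots> = Comp ?D k k k (basis p) (Comp ?D k k k F (basis ?f))"
          using f p(1) F_in by (intro Comp_assoc_right) simp_all
        also have "\<dots> = 0"
          using kill'[of ?f] pr2(1) e2 3 p(1) ii by (simp add: Comp_0_right)
        finally have "Comp ?D k k k F (basis p) = 0" by simp
        then show ?thesis by (simp add: vs.span_zero)
      qed
    qed
    have FC: "Comp ?D k k k F (Comp ?D k k k \<epsilon> (Comp ?D k k k (basis p) \<epsilon>)) \<in> ?S" if p: "p \<in> C k k" for p
    proof -
      note pe = compose_in_C[OF e(1) p] and epe = compose_in_C[OF compose_in_C[OF e(1) p] e(1)]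
      have "compose e (compose e (compose p e)) = compose e (compose p e)"
        using compose_assoc(2)[OF pe e(1) e(1)] by simp
      moreover have "compose (compose e (compose p e)) e = compose e (compose p e)"
        using compose_assoc(2)[OF e(1) pe e(1)] compose_assoc(2)[OF e(1) e(1) p] by simp
      ultimately have "Comp ?D k k k F (basis (compose e (compose p e))) \<in> ?S"
        by (intro key epe)
      then show ?thesis
        using p pe epe F_in by (simp add: \<epsilon>_def vs.span_scale)
    qed
    have "Comp ?D k k k F (Comp ?D k k k \<epsilon> (Comp ?D k k k x \<epsilon>)) =
      (\<Sum>p\<in>C k k. Scale ?D (x p) (Comp ?D k k k F (Comp ?D k k k \<epsilon> (Comp ?D k k k (basis p) \<epsilon>))))"
    \<comment> \<open>By linearity it suffices to treat basis elements; compressing one by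
      \<open>\<epsilon>\<close> gives a multiple of a basis element of the corner.\<close>
    proof -
      have "Comp ?D k k k x \<epsilon> = (\<Sum>p\<in>C k k. Scale ?D (x p) (Comp ?D k k k (basis p) \<epsilon>))"
        by (subst expand_in_basis[OF x], subst Comp_sum_left) (use \<epsilon>H in auto)
      then show ?thesis
        using \<epsilon>H F_in by (simp add: Comp_sum_right Comp_in_Hom)
    qed
    also have "\<dots> \<in> ?S" by (intro vs.span_sum vs.span_scale FC)
    finally show "Comp ?D k k k (Ident ?D k - average_id av1 k) (Comp ?D k k k \<epsilon> (Comp ?D k k k x \<epsilon>)) \<in> ?S"
      by (simp only: F_def)
  qed
  then obtain av where av: "averaging ?D av" "absorbs av (k, k, \<epsilon>)" by blast
  have "Scale ?D (1 / t ^ l) (Comp ?D k k k (average_id av k) (basis e)) = Scale ?D (1 / t ^ l) (basis e)"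
    using av(2) average_id_in_Hom[OF av(1), of k] by (simp add: absorbs_def \<epsilon>_def)
  then have "absorbs av (k, k, basis e)" by (simp add: absorbs_def)
  then show ?case using av(1) by blast
qed

text \<open>The identity partition is itself a projection, and an operator absorbing it has the
  identity as \<open>average_id\<close> on \<open>k\<close>.\<close>

theorem semisimple_Rep: "semisimple (Rep C t)"
  unfolding Rep_def
proof (rule semisimple_karoubi_envelope[OF linear_category_Rep0 regular_additive_completion[OF linear_category_Rep0]])
  fix k
  obtain av where av: "averaging (Rep\<^sub>0 C t) av" "absorbs av (k, k, basis (identity_partition k))"
    using ex_averaging_absorbs_projection[OF projection_identity] by blast
  then have "average_id av k = Ident (Rep\<^sub>0 C t) k"
    using Comp_Ident_right[of k k "average_id av k"] average_id_in_Hom[OF av(1), of k]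
    by (simp add: absorbs_def Rep0_simps(3))
  then show "\<exists>av. averaging (Rep\<^sub>0 C t) av \<and> average_id av k = Ident (Rep\<^sub>0 C t) k" using av(1) by blast
qed (rule additive_completion_finite_dim)

end

section \<open>Natural parameters\<close>

lemma (in group_theoretical_category) not_semisimple_Rep:
  assumes "t \<in> \<nat>"
  shows "\<not> semisimple (Rep C t)"
proof
  assume ss: "semisimple (Rep C t)"
  obtain n where t: "t = of_nat n" using assms by (auto simp: Nats_def)
  let ?A = "additive_completion (Rep\<^sub>0 C t)" and ?K = "Rep C t"
  note lin = linear_category_Rep0[of t]
  interpret A: linear_category ?A by (rule linear_category_additive_completion[OF lin])
  interpret K: linear_category ?K
    unfolding Rep_def karoubi_envelope_def by (rule linear_category_idempotent_completion[OF A.linear_category_axioms])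
  define k where "k = 2 * Suc n"
  obtain f :: "partition \<Rightarrow> complex" where f: "\<And>p. p \<notin> C 0 k \<Longrightarrow> f p = 0" "f \<noteq> (\<lambda>_. 0)"
    "\<And>q. q \<in> C 0 k \<Longrightarrow> (\<Sum>p\<in>C 0 k. f p * t ^ pairing 0 p q) = 0"
    using ex_negligible[of n] unfolding k_def t by blast
  \<comment> \<open>With both rows empty there is a single pair of words, so the exponent of the
    closed composite is 0 and \<open>pairing_compose\<close> identifies loops with the
    pairing.\<close>
  have loops: "loops q p = pairing 0 p (involution q)" if "q \<in> C k 0" "p \<in> C 0 k" for p q
  proof -
    have "compose q p \<in> C 0 0" by (rule compose_in_C[OF that(2,1)])
    have "(2::nat) ^ pairing 0 (compose q p) (identity_partition 0) =
        card {(xs, ys) \<in> words 2 0 \<times> words 2 0. compatible (compose q p) xs ys \<and> compatible (identity_partition 0) xs ys}"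
      by (rule card_common_words[OF C_subset[OF \<open>compose q p \<in> C 0 0\<close>] identity_partition_in_partitions, symmetric])
    also have "\<dots> \<le> card (words 2 0 \<times> words 2 0)"
      by (intro card_mono) auto
    finally have "(2::nat) ^ pairing 0 (compose q p) (identity_partition 0) < 2 ^ 1" by simp
    then have "pairing 0 (compose q p) (identity_partition 0) = 0"
      by (simp only: power_strict_increasing_iff)
    then show ?thesis using pairing_compose[OF that(2,1)] by simp
  qed
  \<comment> \<open>Endomorphisms of the object 0 are multiples of the empty partition, and the
    coefficient is a combination of pairings of \<open>f\<close> with partitions in
    \<open>C 0 k\<close>, all of which vanish.\<close>
  have zero: "Comp (Rep\<^sub>0 C t) 0 k 0 h f = 0" for h
  proof
    fix r
    show "Comp (Rep\<^sub>0 C t) 0 k 0 h f r = 0 r"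
    proof (cases "r = {}")
      case True
      have "compose q p = {}" if "q \<in> C k 0" "p \<in> C 0 k" for p q
        using C_subset[OF compose_in_C[OF that(2,1)]] by (simp add: partitions_def points_def partition_on_empty)
      then have "Comp (Rep\<^sub>0 C t) 0 k 0 h f r = (\<Sum>q\<in>C k 0. h q * (\<Sum>p\<in>C 0 k. f p * t ^ pairing 0 p (involution q)))"
        unfolding Rep0_Comp sum_distrib_left using True by (intro sum.cong refl) (simp add: loops)
      also have "\<dots> = 0" using f(3) involution_in_C by (intro sum.neutral) auto
      finally show ?thesis by simp
    next
      case False
      have "compose q p \<noteq> r" if "q \<in> C k 0" "p \<in> C 0 k" for p q
        using False C_subset[OF compose_in_C[OF that(2,1)]] by (auto simp: partitions_def points_def partition_on_empty)
      then show ?thesis unfolding Rep0_Comp by (simp add: sum.neutral)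
    qed
  qed
  \<comment> \<open>The negligible morphism as a one-by-one matrix between the objects given by 0
    and \<open>k\<close> with identity idempotents.\<close>
  define M where "M = (\<lambda>(i::nat) (j::nat). if i = 0 \<and> j = 0 then f else 0)"
  have obj: "[0] \<in> Obj ?A" "[k] \<in> Obj ?A" by (simp_all add: additive_completion_def Rep0_simps)
  have MH: "M \<in> Hom ?A [0] [k]" using f(1) by (auto simp: M_def additive_completion_def Rep0_simps)
  have "M = 0"
  proof (rule K.semisimple_no_negligible[OF ss])
    show "([0], Ident ?A [0]) \<in> Obj ?K" "([k], Ident ?A [k]) \<in> Obj ?K"
      using obj by (simp_all add: Rep_def karoubi_envelope_def idempotent_completion_def A.Ident_in_Hom A.Comp_Ident_left)
    show "M \<in> Hom ?K ([0], Ident ?A [0]) ([k], Ident ?A [k])"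
      using obj MH by (simp add: Rep_def karoubi_envelope_def idempotent_completion_def A.Comp_Ident_left A.Comp_Ident_right)
    fix h
    show "Comp ?K ([0], Ident ?A [0]) ([k], Ident ?A [k]) ([0], Ident ?A [0]) h M = 0"
      by (auto simp: Rep_def karoubi_envelope_def idempotent_completion_def additive_completion_def M_def zero fun_eq_iff)
  qed
  then have "M 0 0 = 0" by simp
  then show False using f(2) by (simp add: M_def zero_fun_def)
qed

theorem theorem1p1:
  fixes C :: "nat \<Rightarrow> nat \<Rightarrow> partition set" and t :: complex
  assumes "category_of_partitions C" and "group_theoretical C"
  shows "semisimple (Rep C t) \<longleftrightarrow> t \<notin> \<nat>"
proof
  interpret group_theoretical_category C using assms by unfold_locales
  show "t \<notin> \<nat>" if "semisimple (Rep C t)" using that not_semisimple_Rep by blast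
  assume "t \<notin> \<nat>"
  then interpret generic_parameter C t by unfold_locales
  show "semisimple (Rep C t)" by (rule semisimple_Rep)
qed

end
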